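(* Let $(L',Q')$, $(L,Q)$, $\bar G=L'\times L$ and $\bar P=Q'\times Q$ be as in one of the two series (A) ($n\ge 2l-1$, $l>3$) or (C) ($n>4$) described in the context, so that $\bar G/\bar P\cong \mathbb{R}P^1\times L/Q$. Let $l_1,l_2\in L$ with $l_1Q\neq l_2Q$ and put $$\bar M:=\mathbb{R}P^1\times\big(L/Q-\{l_1Q,l_2Q\}\big)\subset \bar G/\bar P .$$ Then the flat model $(\bar G\to\bar G/\bar P,\omega_{\bar G})$ restricts to a non-homogeneous symmetric parabolic geometry of type $(\bar G,\bar P)$ on $\bar M$ if and only if there is $q\in Q$ such that $$q\,l_1^{-1}l_2Q=e_4\wedge\dots\wedge e_{l-1}\wedge e_{l+1}\quad\text{in the case (A)},$$ respectively $$q\,l_1^{-1}l_2Q=e_4\wedge\dots\wedge e_{n-1}\wedge f_n\quad\text{in the case (C)}.$$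
   Context: **Series (A).** Let $n,l$ be integers with $l>3$ and $n\geq 2l-1$. Let $e_4,\dots,e_n$ be the standard basis of $\mathbb{R}^{n-3}$, let $L=GL(n-3,\mathbb{R})$, and let $Q\subset L$ be the stabilizer of the subspace $e_4\wedge\dots\wedge e_l$. Then $L/Q$ is the Grassmannian of $(l-3)$-planes in $\mathbb{R}^{n-3}$. **Series (C).** Let $n>4$. Let $\mathbb{R}^{2n-6}$ have basis $e_4,\dots,e_n,f_4,\dots,f_n$ and symplectic form $\Omega$ with $\Omega(e_i,f_j)=\delta_{ij}$ and $\Omega(e_i,e_j)=\Omega(f_i,f_j)=0$. Let $L=CSp(2n-6,\mathbb{R})$ be the group of linear maps preserving $\Omega$ up to a nonzero real multiple, and let $Q\subset L$ be the stabilizer of the subspace $e_4\wedge\dots\wedge e_n$. Then $L/Q$ is the Grassmannian of maximally isotropic $(n-3)$-planes in $\mathbb{R}^{2n-6}$. **Common notation.** A decomposable wedge $a_1\wedge\dots\wedge a_k$ of linearly independent vectors denotes the subspace they span. A coset $gQ$ is identified with the image under $g$ of the subspace stabilized by $Q$. $L'=GL(2,\mathbb{R})$, with $Q'$ the stabilizer of the line spanned by $e_1$ in $\mathbb{R}^2$ with basis $e_1,e_2$; thus $L'/Q'\cong\mathbb{R}P^1$. **Parabolic geometries.** For a reductive Lie group $G$ with parabolic subgroup $P$, a parabolic geometry of type $(G,P)$ on a smooth connected manifold $M$ is a principal $P$-bundle $\mathcal{G}\to M$ with a Cartan connection $\omega\in\Omega^1(\mathcal{G},\mathfrak{g})$ (geometries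 are assumed regular and normal). The flat model is $(G\to G/P,\omega_G)$ with $\omega_G$ the Maurer–Cartan form; it restricts to a parabolic geometry over any connected open subset of $G/P$. An automorphism is a principal bundle automorphism of $\mathcal{G}$ preserving $\omega$. The geometry is homogeneous if its automorphism group acts transitively on $M$. A symmetry at $x\in M$ is an automorphism whose underlying diffeomorphism $\phi_x$ satisfies $\phi_x(x)=x$ and $T_x\phi_x=-\mathrm{id}$ on $T_x^{-1}M$, where $T^{-1}M$ is the bracket generating distribution induced by the grading component $\mathfrak{g}_{-1}$; for the types $(\bar G,\bar P)$ and $(L,Q)$ considered here, $T^{-1}M=TM$. The geometry is symmetric if there is a symmetry at each $x\in M$. *)

theory Defs
  imports "HOL-Analysis.Analysis" "HOL-Algebra.Left_Coset"
begin

section \<open>Smooth maps on subsets of Euclidean spaces\<close>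

primrec Ck_on :: "nat \<Rightarrow> 'a::euclidean_space set \<Rightarrow> ('a \<Rightarrow> 'b::euclidean_space) \<Rightarrow> bool" where
  "Ck_on 0 U f \<longleftrightarrow> continuous_on U f"
| "Ck_on (Suc k) U f \<longleftrightarrow>
     (\<forall>x\<in>U. f differentiable (at x)) \<and> (\<forall>v. Ck_on k U (\<lambda>x. frechet_derivative f (at x) v))"

text \<open>On an embedded submanifold \<open>S\<close> this is smoothness for the induced manifold structure:
  local extendability to a smooth map on an open subset of the ambient space.\<close>

definition smooth_on :: "'a::euclidean_space set \<Rightarrow> ('a \<Rightarrow> 'b::euclidean_space) \<Rightarrow> bool" where
  "smooth_on S f \<longleftrightarrow>
     (\<forall>x\<in>S. \<exists>U g. open U \<and> x \<in> U \<and> (\<forall>k. Ck_on k U g) \<and> (\<forall>y\<in>S \<inter> U. g y = f y))"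

definition diffeomorphism ::
    "'a::euclidean_space set \<Rightarrow> 'b::euclidean_space set \<Rightarrow> ('a \<Rightarrow> 'b) \<Rightarrow> bool" where
  "diffeomorphism S T f \<longleftrightarrow> bij_betw f S T \<and> smooth_on S f \<and> smooth_on T (inv_into S f)"

definition tangent_space :: "'a::euclidean_space set \<Rightarrow> 'a \<Rightarrow> 'a set" where
  "tangent_space S x =
     {v. \<exists>c e. 0 < e \<and> smooth_on {-e<..<e} c \<and> c ` {-e<..<e} \<subseteq> S \<and> c (0::real) = x \<and>
               (c has_vector_derivative v) (at 0)}"

text \<open>A derivative within a submanifold \<open>S\<close> is determined only on \<open>tangent_space S x\<close>;
  \<open>differential S f x\<close> is applied to tangent vectors only.\<close>

definition differential ::
    "'a::euclidean_space set \<Rightarrow> ('a \<Rightarrow> 'b::euclidean_space) \<Rightarrow> 'a \<Rightarrow> 'a \<Rightarrow> 'b" where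
  "differential S f x = frechet_derivative f (at x within S)"


section \<open>Lie groups embedded in Euclidean spaces\<close>

abbreviation lie_algebra :: "('g::euclidean_space) monoid \<Rightarrow> 'g set" where
  "lie_algebra G \<equiv> tangent_space (carrier G) \<one>\<^bsub>G\<^esub>"

definition Ad :: "('g::euclidean_space) monoid \<Rightarrow> 'g \<Rightarrow> 'g \<Rightarrow> 'g" where
  "Ad G g = differential (carrier G) (\<lambda>h. g \<otimes>\<^bsub>G\<^esub> h \<otimes>\<^bsub>G\<^esub> inv\<^bsub>G\<^esub> g) \<one>\<^bsub>G\<^esub>"

text \<open>The derivative of \<open>Ad\<close> at the identity.\<close>

definition lie_bracket :: "('g::euclidean_space) monoid \<Rightarrow> 'g \<Rightarrow> 'g \<Rightarrow> 'g" where
  "lie_bracket G A B = differential (carrier G) (\<lambda>g. Ad G g B) \<one>\<^bsub>G\<^esub> A"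

definition maurer_cartan :: "('g::euclidean_space) monoid \<Rightarrow> 'g \<Rightarrow> 'g \<Rightarrow> 'g" where
  "maurer_cartan G g = differential (carrier G) (\<lambda>h. inv\<^bsub>G\<^esub> g \<otimes>\<^bsub>G\<^esub> h) g"


section \<open>Cartan geometries\<close>

text \<open>The data of a Cartan geometry of type \<open>(G, P)\<close>, with \<open>P \<subseteq> carrier G\<close>: the total space of
  the bundle, the right action of \<open>P\<close> on it, and a \<open>1\<close>-form with values in the Lie algebra of
  \<open>G\<close>. The points of the base manifold are the \<open>P\<close>-orbits, so the bundle projection is
  \<open>orbit P X\<close>.\<close>

record ('e, 'g) geometry =
  total_space :: "'e set"
  right_act :: "'e \<Rightarrow> 'g \<Rightarrow> 'e"
  cartan_form :: "'e \<Rightarrow> 'e \<Rightarrow> 'g"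

definition orbit :: "'g set \<Rightarrow> ('e, 'g) geometry \<Rightarrow> 'e \<Rightarrow> 'e set" where
  "orbit P X u = right_act X u ` P"

definition base :: "'g set \<Rightarrow> ('e, 'g) geometry \<Rightarrow> 'e set set" where
  "base P X = orbit P X ` total_space X"

definition base_topology ::
    "'g set \<Rightarrow> ('e::topological_space, 'g) geometry \<Rightarrow> 'e set topology" where
  "base_topology P X =
     topology (\<lambda>W. W \<subseteq> base P X \<and>
       openin (top_of_set (total_space X)) {u \<in> total_space X. orbit P X u \<in> W})"

lemma openin_base_topology:
  "openin (base_topology P X) W \<longleftrightarrow> W \<subseteq> base P X \<and>
     openin (top_of_set (total_space X)) {u \<in> total_space X. orbit P X u \<in> W}"
proof -
  let ?E = "total_space X"
  let ?p = "\<lambda>W. {u \<in> ?E. orbit P X u \<in> W}"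
  have 1: "openin (top_of_set ?E) (?p (S \<inter> T))"
    if "openin (top_of_set ?E) (?p S)" "openin (top_of_set ?E) (?p T)" for S T
  proof -
    have "?p (S \<inter> T) = ?p S \<inter> ?p T" by blast
    then show ?thesis using openin_Int[OF that] by simp
  qed
  have 2: "openin (top_of_set ?E) (?p (\<Union>\<K>))"
    if "\<forall>K\<in>\<K>. openin (top_of_set ?E) (?p K)" for \<K>
  proof -
    have "?p (\<Union>\<K>) = \<Union>(?p ` \<K>)" by blast
    then show ?thesis using that by (metis (no_types, lifting) imageE openin_Union)
  qed
  have "istopology (\<lambda>W. W \<subseteq> base P X \<and> openin (top_of_set ?E) (?p W))"
    unfolding istopology_def using 1 2 by blast
  then show ?thesis
    unfolding base_topology_def by (simp add: topology_inverse')
qed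

text \<open>Local trivializations \<open>V \<times> P \<rightarrow> U\<close> over charts: \<open>V\<close> is open in a linear subspace \<open>H\<close>, which
  serves as the model space of the base. They provide both the smooth structure of the base and the
  local triviality of the bundle.\<close>

definition principal_bundle ::
    "('g::euclidean_space) monoid \<Rightarrow> 'g set \<Rightarrow> ('e::euclidean_space, 'g) geometry \<Rightarrow> bool" where
  "principal_bundle G P X \<longleftrightarrow>
     (\<forall>u\<in>total_space X. \<forall>p\<in>P. right_act X u p \<in> total_space X) \<and>
     (\<forall>u\<in>total_space X. right_act X u \<one>\<^bsub>G\<^esub> = u) \<and>
     (\<forall>u\<in>total_space X. \<forall>p\<in>P. \<forall>q\<in>P.
        right_act X (right_act X u p) q = right_act X u (p \<otimes>\<^bsub>G\<^esub> q)) \<and>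
     smooth_on (total_space X \<times> P) (\<lambda>(u, p). right_act X u p) \<and>
     Hausdorff_space (base_topology P X) \<and>
     (\<forall>u\<in>total_space X. \<exists>(H::'e set) V U \<psi>. subspace H \<and> openin (top_of_set H) V \<and>
        openin (top_of_set (total_space X)) U \<and> u \<in> U \<and> diffeomorphism (V \<times> P) U \<psi> \<and>
        (\<forall>x\<in>V. \<forall>p\<in>P. \<forall>q\<in>P. right_act X (\<psi> (x, p)) q = \<psi> (x, p \<otimes>\<^bsub>G\<^esub> q)))"

definition cartan_connection ::
    "('g::euclidean_space) monoid \<Rightarrow> 'g set \<Rightarrow> ('e::euclidean_space, 'g) geometry \<Rightarrow> bool" where
  "cartan_connection G P X \<longleftrightarrow>
     (let E = total_space X; \<omega> = cartan_form X in
       smooth_on (SIGMA u:E. tangent_space E u) (\<lambda>(u, v). \<omega> u v) \<and>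
       (\<forall>u\<in>E. \<forall>v\<in>tangent_space E u. \<forall>w\<in>tangent_space E u. \<forall>a b.
          \<omega> u (a *\<^sub>R v + b *\<^sub>R w) = a *\<^sub>R \<omega> u v + b *\<^sub>R \<omega> u w) \<and>
       (\<forall>u\<in>E. bij_betw (\<omega> u) (tangent_space E u) (lie_algebra G)) \<and>
       (\<forall>u\<in>E. \<forall>p\<in>P. \<forall>v\<in>tangent_space E u.
          \<omega> (right_act X u p) (differential E (\<lambda>w. right_act X w p) u v) =
          Ad G (inv\<^bsub>G\<^esub> p) (\<omega> u v)) \<and>
       (\<forall>u\<in>E. \<forall>A\<in>tangent_space P \<one>\<^bsub>G\<^esub>.
          \<omega> u (differential P (right_act X u) \<one>\<^bsub>G\<^esub> A) = A))"

text \<open>The curvature \<open>d\<omega> + [\<omega>, \<omega>] / 2\<close> as a function of \<open>A, B\<close> in the Lie algebra: evaluated on the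
  constant vector fields \<open>\<omega>\<^sup>-\<^sup>1(A)\<close>, \<open>\<omega>\<^sup>-\<^sup>1(B)\<close> it is \<open>[A, B] - \<omega>([\<omega>\<^sup>-\<^sup>1(A), \<omega>\<^sup>-\<^sup>1(B)])\<close>.\<close>

definition constant_field :: "('e::euclidean_space, 'g) geometry \<Rightarrow> 'g \<Rightarrow> 'e \<Rightarrow> 'e" where
  "constant_field X A u = inv_into (tangent_space (total_space X) u) (cartan_form X u) A"

definition curvature ::
    "('g::euclidean_space) monoid \<Rightarrow> ('e::euclidean_space, 'g) geometry \<Rightarrow> 'e \<Rightarrow> 'g \<Rightarrow> 'g \<Rightarrow> 'g" where
  "curvature G X u A B =
     lie_bracket G A B -
     cartan_form X u
       (differential (total_space X) (constant_field X B) u (constant_field X A u) -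
        differential (total_space X) (constant_field X A) u (constant_field X B u))"

text \<open>Normality: the Kostant codifferential
  \<open>(\<partial>\<^sup>*\<kappa>)(A) = (\<Sum>i. 2 [Z\<^sub>i, \<kappa>(A, Y\<^sub>i)] - \<kappa>([Z\<^sub>i, A], Y\<^sub>i))\<close> of the curvature vanishes. Here \<open>\<beta>\<close> is an
  invariant nondegenerate bilinear form on the Lie algebra \<open>\<gg>\<close> of \<open>G\<close>, the nilradical \<open>\<nn>\<close> of the
  Lie algebra \<open>\<pp>\<close> of \<open>P\<close> is the \<open>\<beta>\<close>-annihilator of \<open>\<pp>\<close>, and \<open>Y\<^sub>i\<close>, \<open>Z\<^sub>i\<close> are dual bases of \<open>\<gg>/\<pp>\<close> and
  \<open>\<nn>\<close>.\<close>

definition normal_geometry ::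
    "('g::euclidean_space) monoid \<Rightarrow> 'g set \<Rightarrow> ('g \<Rightarrow> 'g \<Rightarrow> real) \<Rightarrow>
     ('e::euclidean_space, 'g) geometry \<Rightarrow> bool" where
  "normal_geometry G P \<beta> X \<longleftrightarrow>
     (let \<gg> = lie_algebra G; \<pp> = tangent_space P \<one>\<^bsub>G\<^esub>;
          \<nn> = {Z \<in> \<gg>. \<forall>B\<in>\<pp>. \<beta> Z B = 0}
      in \<forall>(m::nat) Y Z.
           (\<forall>i<m. Y i \<in> \<gg> \<and> Z i \<in> \<nn>) \<and>
           (\<forall>i<m. \<forall>j<m. \<beta> (Z i) (Y j) = (if i = j then 1 else 0)) \<and>
           (\<forall>A\<in>\<gg>. \<exists>c. A - (\<Sum>i<m. c i *\<^sub>R Y i) \<in> \<pp>) \<longrightarrow>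
           (\<forall>u\<in>total_space X. \<forall>A\<in>\<gg>.
              (\<Sum>i<m. 2 *\<^sub>R lie_bracket G (Z i) (curvature G X u A (Y i)) -
                      curvature G X u (lie_bracket G (Z i) A) (Y i)) = 0))"

text \<open>Regularity (the curvature has positive homogeneity with respect to the filtration of \<open>\<gg>\<close>)
  imposes nothing when \<open>\<gg> = \<gg>\<^sub>-\<^sub>1 \<oplus> \<gg>\<^sub>0 \<oplus> \<gg>\<^sub>1\<close>, as for all types \<open>(G, P)\<close> considered below.\<close>

definition parabolic_geometry ::
    "('g::euclidean_space) monoid \<Rightarrow> 'g set \<Rightarrow> ('g \<Rightarrow> 'g \<Rightarrow> real) \<Rightarrow>
     ('e::euclidean_space, 'g) geometry \<Rightarrow> bool" where
  "parabolic_geometry G P \<beta> X \<longleftrightarrow>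
     principal_bundle G P X \<and> connected_space (base_topology P X) \<and> cartan_connection G P X \<and>
     normal_geometry G P \<beta> X"

definition automorphism ::
    "'g set \<Rightarrow> ('e::euclidean_space, 'g) geometry \<Rightarrow> ('e \<Rightarrow> 'e) \<Rightarrow> bool" where
  "automorphism P X \<Phi> \<longleftrightarrow>
     diffeomorphism (total_space X) (total_space X) \<Phi> \<and>
     (\<forall>u\<in>total_space X. \<forall>p\<in>P. \<Phi> (right_act X u p) = right_act X (\<Phi> u) p) \<and>
     (\<forall>u\<in>total_space X. \<forall>v\<in>tangent_space (total_space X) u.
        cartan_form X (\<Phi> u) (differential (total_space X) \<Phi> u v) = cartan_form X u v)"

text \<open>An automorphism \<open>\<Phi>\<close> maps orbits to orbits, so its underlying diffeomorphism of the base is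
  the direct image \<open>x \<mapsto> \<Phi> ` x\<close>.\<close>

definition homogeneous :: "'g set \<Rightarrow> ('e::euclidean_space, 'g) geometry \<Rightarrow> bool" where
  "homogeneous P X \<longleftrightarrow>
     (\<forall>x\<in>base P X. \<forall>y\<in>base P X. \<exists>\<Phi>. automorphism P X \<Phi> \<and> \<Phi> ` x = y)"

definition base_smooth ::
    "'g set \<Rightarrow> ('e::euclidean_space, 'g) geometry \<Rightarrow> ('e set \<Rightarrow> real) \<Rightarrow> bool" where
  "base_smooth P X f \<longleftrightarrow> smooth_on (total_space X) (\<lambda>u. f (orbit P X u))"

text \<open>Tangent vectors of the base as derivations: since the projection \<open>p\<close> is a submersion, every
  tangent vector at \<open>x = p u\<close> is \<open>T p v\<close> for some tangent vector \<open>v\<close> at \<open>u\<close>, and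
  \<open>(T p v) f = d (f \<circ> p) v\<close>.\<close>

definition base_tangent ::
    "'g set \<Rightarrow> ('e::euclidean_space, 'g) geometry \<Rightarrow> 'e set \<Rightarrow> (('e set \<Rightarrow> real) \<Rightarrow> real) set" where
  "base_tangent P X x =
     {(\<lambda>f. differential (total_space X) (\<lambda>w. f (orbit P X w)) u v) | u v.
        u \<in> total_space X \<and> orbit P X u = x \<and> v \<in> tangent_space (total_space X) u}"

definition pushforward :: "('m \<Rightarrow> 'm) \<Rightarrow> (('m \<Rightarrow> real) \<Rightarrow> real) \<Rightarrow> ('m \<Rightarrow> real) \<Rightarrow> real" where
  "pushforward \<phi> D = (\<lambda>f. D (f \<circ> \<phi>))"

text \<open>The condition on the tangent map is imposed on the whole tangent space. This is the notion of
  symmetry for types in which the distribution induced by \<open>\<gg>\<^sub>-\<^sub>1\<close> is the whole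
  tangent bundle.\<close>

definition symmetry_at ::
    "'g set \<Rightarrow> ('e::euclidean_space, 'g) geometry \<Rightarrow> 'e set \<Rightarrow> ('e \<Rightarrow> 'e) \<Rightarrow> bool" where
  "symmetry_at P X x \<Phi> \<longleftrightarrow>
     automorphism P X \<Phi> \<and> \<Phi> ` x = x \<and>
     (\<forall>D\<in>base_tangent P X x. \<forall>f. base_smooth P X f \<longrightarrow> pushforward ((`) \<Phi>) D f = - D f)"

definition symmetric_geometry :: "'g set \<Rightarrow> ('e::euclidean_space, 'g) geometry \<Rightarrow> bool" where
  "symmetric_geometry P X \<longleftrightarrow> (\<forall>x\<in>base P X. \<exists>\<Phi>. symmetry_at P X x \<Phi>)"

text \<open>The restriction of the flat model to a set \<open>M\<close> of left cosets of \<open>P\<close>.\<close>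

definition flat_model_on ::
    "('g::euclidean_space) monoid \<Rightarrow> 'g set \<Rightarrow> 'g set set \<Rightarrow> ('g, 'g) geometry" where
  "flat_model_on G P M =
     \<lparr>total_space = {g \<in> carrier G. g <#\<^bsub>G\<^esub> P \<in> M}, right_act = mult G,
      cartan_form = maurer_cartan G\<rparr>"

lemma base_flat_model_on:
  assumes "M \<subseteq> lcosets\<^bsub>G\<^esub> P"
  shows "base P (flat_model_on G P M) = M"
proof -
  have "orbit P (flat_model_on G P M) g = g <#\<^bsub>G\<^esub> P" for g
    by (auto simp: orbit_def flat_model_on_def l_coset_def)
  then show ?thesis
    using assms by (auto simp: base_def flat_model_on_def LCOSETS_def image_iff)
qed


section \<open>The groups\<close>

definition GL :: "(real^'n^'n) monoid" where
  "GL = \<lparr>carrier = {A. invertible A}, monoid.mult = (**), one = mat 1\<rparr>"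

text \<open>The symplectic form on the space with basis \<open>e\<^sub>i = axis (Inl i) 1\<close> and
  \<open>f\<^sub>i = axis (Inr i) 1\<close>.\<close>

definition symp :: "real^('n::finite + 'n) \<Rightarrow> real^('n + 'n) \<Rightarrow> real" where
  "symp x y = (\<Sum>i\<in>UNIV. x $ Inl i * y $ Inr i - x $ Inr i * y $ Inl i)"

definition CSp :: "(real^('n::finite + 'n)^('n + 'n)) monoid" where
  "CSp = \<lparr>carrier = {A. \<exists>c. c \<noteq> 0 \<and> (\<forall>x y. symp (A *v x) (A *v y) = c * symp x y)},
          monoid.mult = (**), one = mat 1\<rparr>"

lemma symp_basis:
  fixes i j :: "'n::finite"
  shows "symp (axis (Inl i) 1) (axis (Inr j) 1) = (if i = j then 1 else 0)"
    and "symp (axis (Inl i) 1) (axis (Inl j) 1) = 0"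
    and "symp (axis (Inr i) 1) (axis (Inr j) 1) = 0"
proof -
  have *: "axis (Inl i) 1 $ Inl k = (if k = i then 1 else (0::real))"
    "axis (Inr i) 1 $ Inr k = (if k = i then 1 else (0::real))"
    "axis (Inl i) 1 $ Inr k = (0::real)" "axis (Inr i) 1 $ Inl k = (0::real)" for i k :: 'n
    by (auto simp: axis_def)
  show "symp (axis (Inl i) 1) (axis (Inr j) 1) = (if i = j then 1 else 0)"
    "symp (axis (Inl i) 1) (axis (Inl j) 1) = 0"
    "symp (axis (Inr i) 1) (axis (Inr j) 1) = 0"
    by (simp_all add: symp_def * flip: of_bool_def)
qed

text \<open>The stabilizer in \<open>G\<close> of a subspace \<open>W\<close>.\<close>

definition stab :: "(real^'n^'n) monoid \<Rightarrow> (real^'n) set \<Rightarrow> (real^'n^'n) set" where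
  "stab G W = {g \<in> carrier G. (*v) g ` W = W}"

definition line_stab :: "(real^2^2) set" where
  "line_stab = stab GL (span {axis 1 1})"

text \<open>\<open>L'/Q' \<times> (L/Q - {l\<^sub>1Q, l\<^sub>2Q})\<close> for \<open>L' = GL\<close> and \<open>Q' = line_stab\<close>. A left coset of \<open>Q' \<times> Q\<close> in
  \<open>L' \<times> L\<close> is literally the product of a left coset of \<open>Q'\<close> and one of \<open>Q\<close>.\<close>

definition M_bar ::
    "('h::euclidean_space) monoid \<Rightarrow> 'h set \<Rightarrow> 'h \<Rightarrow> 'h \<Rightarrow> ((real^2^2) \<times> 'h) set set" where
  "M_bar L Q l1 l2 =
     {A \<times> B | A B. A \<in> lcosets\<^bsub>GL\<^esub> line_stab \<and>
        B \<in> lcosets\<^bsub>L\<^esub> Q - {l1 <#\<^bsub>L\<^esub> Q, l2 <#\<^bsub>L\<^esub> Q}}"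

lemma M_bar_subset: "M_bar L Q l1 l2 \<subseteq> lcosets\<^bsub>GL \<times>\<times> L\<^esub> (line_stab \<times> Q)"
proof -
  have "(a, b) <#\<^bsub>GL \<times>\<times> L\<^esub> (line_stab \<times> Q) = (a <#\<^bsub>GL\<^esub> line_stab) \<times> (b <#\<^bsub>L\<^esub> Q)" for a b
    by (force simp: l_coset_def DirProd_def)
  then show ?thesis
    by (fastforce simp: M_bar_def LCOSETS_def DirProd_def)
qed

definition trace_form :: "(real^2^2) \<times> (real^'n^'n) \<Rightarrow> (real^2^2) \<times> (real^'n^'n) \<Rightarrow> real" where
  "trace_form A B = trace (fst A ** fst B) + trace (snd A ** snd B)"

text \<open>The flat model of type \<open>(L' \<times> L, Q' \<times> Q)\<close> restricts to a non-homogeneous symmetric parabolic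
  geometry on \<open>M_bar L Q l1 l2\<close>.\<close>

definition nonhomogeneous_symmetric_restriction ::
    "(real^'n^'n) monoid \<Rightarrow> (real^'n^'n) set \<Rightarrow> real^'n^'n \<Rightarrow> real^'n^'n \<Rightarrow> bool" where
  "nonhomogeneous_symmetric_restriction L Q l1 l2 \<longleftrightarrow>
     (let G = GL \<times>\<times> L; P = line_stab \<times> Q; X = flat_model_on G P (M_bar L Q l1 l2)
      in parabolic_geometry G P trace_form X \<and> \<not> homogeneous P X \<and> symmetric_geometry P X)"

end

theory Submission
  imports Defs
begin

text \<open>By Liouville's theorem every automorphism of the restricted flat model is a left multiplication by
  some \<open>(a, b)\<close>, and \<open>b\<close> permutes the two subspaces \<open>x1 = l1 W\<close> and \<open>x2 = l2 W\<close>. It is a symmetry over \<open>x\<close> iff,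
  up to scale, \<open>b\<close> is the reflection that fixes \<open>x\<close> and is \<open>- id\<close> on a complement \<open>C\<close>, which is Lagrangian
  in series (C).

  If \<open>x1 \<inter> x2\<close> is a hyperplane of \<open>x1\<close>, then for every \<open>x\<close> some complement yields a reflection that
  fixes or exchanges \<open>x1\<close> and \<open>x2\<close>. The geometry is not homogeneous, since \<open>x1 + x2\<close> is invariant
  and contains some but not all of the remaining points. If \<open>x1 \<inter> x2\<close> is smaller, the point spanned by a
  hyperplane of \<open>x1\<close> containing \<open>x1 \<inter> x2\<close> and by some \<open>u1 - u2\<close> with \<open>u1 \<in> x1\<close>, \<open>u2 \<in> x2\<close> admits no
  symmetry. Finally, \<open>Q\<close> acts transitively on the points that meet \<open>W\<close> in a hyperplane of \<open>W\<close>.\<close>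

section \<open>Calculus of smooth maps\<close>

text \<open>A tangent vector at x is a linear map from x to the quotient by x, on which b acts by
  conjugation. Acting by -1 there forces exactly that b is a scalar r on x and -r modulo x. The
  obstruction uses this form; the constructions use the freedom in the complement C on which b = -r.
  Symmetries are defined through smooth functions on the base. Excluding one therefore requires
  globally defined functions with enough derivatives, and the entries of the orthogonal projection
  onto b W provide them. Both groups consist of units of a matrix algebra, so the Maurer-Cartan form
  is \<open>ainv u \<odot> v\<close>, differentials of translations are products, and the curvature
  vanishes identically. The remaining set is not a single chart. Connectedness and Liouville's
  theorem rest on a global fact: any two remaining points have a common isotropic complement, hence
  lie in one big cell, and this cell stays connected when two points are removed. The two series are
  treated at once by an alternating form that is zero or nondegenerate; only a few lemmas
  distinguish the cases.\<close>

lemma Ck_on_subset: "Ck_on k U f \<Longrightarrow> V \<subseteq> U \<Longrightarrow> Ck_on k V f"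
  by (induction k arbitrary: f) (auto intro: continuous_on_subset)

lemma frechet_derivative_transform_open:
  assumes "open U" "x \<in> U" "\<And>y. y \<in> U \<Longrightarrow> f y = g y"
  shows "frechet_derivative f (at x) = frechet_derivative g (at x)"
    and "f differentiable (at x) \<longleftrightarrow> g differentiable (at x)"
proof -
  have "(f has_derivative f') (at x) \<longleftrightarrow> (g has_derivative f') (at x)" for f'
    using assms by (metis has_derivative_transform_within_open)
  then show "frechet_derivative f (at x) = frechet_derivative g (at x)"
    "f differentiable (at x) \<longleftrightarrow> g differentiable (at x)"
    by (auto simp: frechet_derivative_def differentiable_def)
qed

lemma Ck_on_cong:
  assumes "open U" "\<And>y. y \<in> U \<Longrightarrow> f y = g y" "Ck_on k U f"
  shows "Ck_on k U g"
  using assms(2,3)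
proof (induction k arbitrary: f g)
  case 0
  then show ?case using continuous_on_cong[of U U f g] by simp
next
  case (Suc k)
  have "Ck_on k U (\<lambda>x. frechet_derivative g (at x) v)" for v
    using Suc.IH[of "\<lambda>x. frechet_derivative f (at x) v"] Suc.prems
      frechet_derivative_transform_open(1)[OF assms(1) _ Suc.prems(1)] by auto
  then show ?case
    using Suc.prems frechet_derivative_transform_open(2)[OF assms(1) _ Suc.prems(1)] by auto
qed

text \<open>\<open>frechet_derivative\<close> is a chosen object; openness of \<open>U\<close> is
  what allows it to be replaced inside \<open>Ck_on\<close> by an explicit formula.\<close>

lemma Ck_on_SucI:
  assumes "open U" "\<And>x. x \<in> U \<Longrightarrow> (f has_derivative f' x) (at x)" "\<And>v. Ck_on k U (\<lambda>x. f' x v)"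
  shows "Ck_on (Suc k) U f"
proof -
  have "frechet_derivative f (at x) = f' x" if "x \<in> U" for x
    using frechet_derivative_at[OF assms(2)[OF that]] by simp
  then have "Ck_on k U (\<lambda>x. frechet_derivative f (at x) v)" for v
    using Ck_on_cong[OF assms(1) _ assms(3)[of v]] by auto
  then show ?thesis using assms(2) by (auto simp: differentiable_def)
qed

lemma Ck_on_SucD:
  assumes "Ck_on (Suc k) U f"
  shows "\<And>x. x \<in> U \<Longrightarrow> (f has_derivative frechet_derivative f (at x)) (at x)"
    and "\<And>v. Ck_on k U (\<lambda>x. frechet_derivative f (at x) v)"
  using assms frechet_derivative_works by auto

lemma Ck_on_Suc_lower: "Ck_on (Suc k) U f \<Longrightarrow> Ck_on k U f"
proof (induction k arbitrary: f)
  case 0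
  then show ?case
    by (auto intro!: continuous_at_imp_continuous_on differentiable_imp_continuous_within)
qed auto

lemma Ck_on_const: "open U \<Longrightarrow> Ck_on k U (\<lambda>x. c)"
proof (induction k arbitrary: c)
  case (Suc k)
  then show ?case by (intro Ck_on_SucI[where f' = "\<lambda>x v. 0"]) auto
qed simp

lemma Ck_on_bounded_linear:
  assumes "bounded_linear h" "open U"
  shows "Ck_on k U f \<Longrightarrow> Ck_on k U (\<lambda>x. h (f x))"
proof (induction k arbitrary: f)
  case 0
  then show ?case using assms(1) by (auto intro: bounded_linear.continuous_on)
next
  case (Suc k)
  show ?case
    by (rule Ck_on_SucI[OF assms(2) bounded_linear.has_derivative[OF assms(1)
        Ck_on_SucD(1)[OF Suc.prems]] Suc.IH[OF Ck_on_SucD(2)[OF Suc.prems]]])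
qed

lemma Ck_on_add:
  assumes "open U"
  shows "Ck_on k U f \<Longrightarrow> Ck_on k U g \<Longrightarrow> Ck_on k U (\<lambda>x. f x + g x)"
proof (induction k arbitrary: f g)
  case 0
  then show ?case by (auto intro: continuous_on_add)
next
  case (Suc k)
  show ?case
    by (rule Ck_on_SucI[OF assms has_derivative_add[OF
        Ck_on_SucD(1)[OF Suc.prems(1)] Ck_on_SucD(1)[OF Suc.prems(2)]]
        Suc.IH[OF Ck_on_SucD(2)[OF Suc.prems(1)] Ck_on_SucD(2)[OF Suc.prems(2)]]])
qed

lemma Ck_on_sum:
  assumes "open U" "\<And>i. i \<in> I \<Longrightarrow> Ck_on k U (f i)"
  shows "Ck_on k U (\<lambda>x. \<Sum>i\<in>I. f i x)"
  using assms(2)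
  by (induction I rule: infinite_finite_induct) (auto intro: Ck_on_const Ck_on_add assms(1))

lemma Ck_on_bilinear:
  assumes "bounded_bilinear h" "open U"
  shows "Ck_on k U f \<Longrightarrow> Ck_on k U g \<Longrightarrow> Ck_on k U (\<lambda>x. h (f x) (g x))"
proof (induction k arbitrary: f g)
  case 0
  then show ?case using assms(1) by (auto intro: bounded_bilinear.continuous_on)
next
  case (Suc k)
  show ?case
    by (rule Ck_on_SucI[OF assms(2) bounded_bilinear.FDERIV[OF assms(1)
        Ck_on_SucD(1)[OF Suc.prems(1)] Ck_on_SucD(1)[OF Suc.prems(2)]]
        Ck_on_add[OF assms(2) Suc.IH[OF Ck_on_Suc_lower[OF Suc.prems(1)] Ck_on_SucD(2)[OF Suc.prems(2)]]
          Suc.IH[OF Ck_on_SucD(2)[OF Suc.prems(1)] Ck_on_Suc_lower[OF Suc.prems(2)]]]])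
qed

text \<open>In the chain rule the direction fed into the derivative of \<open>g\<close> varies with
  x, while \<open>Ck_on\<close> and the induction hypothesis speak of fixed directions. Expanding
  that direction in the basis gives a sum of products of functions with fixed directions.\<close>

lemma Ck_on_compose:
  assumes "open U" "open V" "f ` U \<subseteq> V"
  shows "Ck_on k U f \<Longrightarrow> Ck_on k V g \<Longrightarrow> Ck_on k U (\<lambda>x. g (f x))"
proof (induction k arbitrary: g)
  case 0
  then show ?case using assms(3) by (auto intro: continuous_on_compose2)
next
  case (Suc k)
  let ?g' = "\<lambda>y. frechet_derivative g (at y)"
  let ?f' = "\<lambda>x. frechet_derivative f (at x)"
  have f: "(f has_derivative ?f' x) (at x)" if "x \<in> U" for x
    using Ck_on_SucD(1)[OF Suc.prems(1) that] .
  have g: "(g has_derivative ?g' (f x)) (at (f x))" if "x \<in> U" for x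
    using Ck_on_SucD(1)[OF Suc.prems(2)] assms(3) that by blast
  have chain: "((\<lambda>x. g (f x)) has_derivative (\<lambda>v. \<Sum>b\<in>Basis. (?f' x v \<bullet> b) *\<^sub>R ?g' (f x) b)) (at x)"
    if "x \<in> U" for x
  proof -
    interpret linear "?g' (f x)" using has_derivative_linear[OF g[OF that]] .
    have eq: "?g' (f x) w = (\<Sum>b\<in>Basis. (w \<bullet> b) *\<^sub>R ?g' (f x) b)" for w
    proof -
      have "?g' (f x) (\<Sum>b\<in>Basis. (w \<bullet> b) *\<^sub>R b) = (\<Sum>b\<in>Basis. (w \<bullet> b) *\<^sub>R ?g' (f x) b)"
        by (simp only: sum scale)
      then show ?thesis by (simp only: euclidean_representation)
    qed
    have expand: "(\<lambda>v. ?g' (f x) (?f' x v)) = (\<lambda>v. \<Sum>b\<in>Basis. (?f' x v \<bullet> b) *\<^sub>R ?g' (f x) b)"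
      by (rule ext) (rule eq)
    show ?thesis
      using has_derivative_compose[OF f[OF that] g[OF that]] unfolding expand .
  qed
  have "Ck_on k U (\<lambda>x. \<Sum>b\<in>Basis. (?f' x v \<bullet> b) *\<^sub>R ?g' (f x) b)" for v
  proof (rule Ck_on_sum[OF assms(1)])
    fix b :: 'b
    have "Ck_on k U (\<lambda>x. ?g' (f x) b)"
      by (rule Suc.IH[OF Ck_on_Suc_lower[OF Suc.prems(1)] Ck_on_SucD(2)[OF Suc.prems(2)]])
    then show "Ck_on k U (\<lambda>x. (?f' x v \<bullet> b) *\<^sub>R ?g' (f x) b)"
      by (rule Ck_on_bilinear[OF bounded_bilinear_scaleR assms(1)
            Ck_on_bounded_linear[OF bounded_linear_inner_left assms(1) Ck_on_SucD(2)[OF Suc.prems(1)]]])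
  qed
  with chain show ?case by (rule Ck_on_SucI[OF assms(1)])
qed

section \<open>Smooth maps on arbitrary subsets\<close>

lemma smooth_onE:
  assumes "smooth_on S f" "x \<in> S"
  obtains U g where "open U" "x \<in> U" "\<forall>k. Ck_on k U g" "\<forall>y\<in>S \<inter> U. g y = f y"
  using assms unfolding smooth_on_def by blast

lemma smooth_onI:
  assumes "\<And>x. x \<in> S \<Longrightarrow> \<exists>U g. open U \<and> x \<in> U \<and> (\<forall>k. Ck_on k U g) \<and> (\<forall>y\<in>S \<inter> U. g y = f y)"
  shows "smooth_on S f"
  using assms by (simp add: smooth_on_def)

lemma smooth_on_subset: "smooth_on S f \<Longrightarrow> T \<subseteq> S \<Longrightarrow> smooth_on T f"
  unfolding smooth_on_def
  by (intro ballI, drule bspec, erule subsetD, assumption, elim exE, intro exI, fast)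

lemma smooth_on_cong: "(\<And>x. x \<in> S \<Longrightarrow> f x = g x) \<Longrightarrow> smooth_on S f \<longleftrightarrow> smooth_on S g"
  unfolding smooth_on_def by (intro ball_cong ex_cong1) auto

lemma smooth_on_open: "open U \<Longrightarrow> (\<And>k. Ck_on k U f) \<Longrightarrow> S \<subseteq> U \<Longrightarrow> smooth_on S f"
  unfolding smooth_on_def by blast

lemma smooth_on_const: "smooth_on S (\<lambda>x. c)"
  by (rule smooth_on_open[of UNIV]) (auto intro: Ck_on_const)

lemma Ck_on_ident: "open U \<Longrightarrow> Ck_on k U (\<lambda>x. x)"
  by (cases k) (auto intro!: Ck_on_SucI[where f' = "\<lambda>x v. v"] Ck_on_const)

lemma smooth_on_ident: "smooth_on S (\<lambda>x. x)"
  by (rule smooth_on_open[of UNIV]) (auto intro: Ck_on_ident)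

lemma smooth_on_bilinear:
  assumes h: "bounded_bilinear h" and "smooth_on S f" "smooth_on S g"
  shows "smooth_on S (\<lambda>x. h (f x) (g x))"
proof (rule smooth_onI)
  fix x assume x: "x \<in> S"
  obtain U f1 where
    U: "open U" "x \<in> U" "\<forall>k. Ck_on k U f1" "\<forall>y\<in>S \<inter> U. f1 y = f y"
    by (rule smooth_onE[OF assms(2) x])
  obtain V g1 where
    V: "open V" "x \<in> V" "\<forall>k. Ck_on k V g1" "\<forall>y\<in>S \<inter> V. g1 y = g y"
    by (rule smooth_onE[OF assms(3) x])
  have "Ck_on k (U \<inter> V) (\<lambda>x. h (f1 x) (g1 x))" for k
    by (intro Ck_on_bilinear[OF h] Ck_on_subset[OF U(3)[rule_format]] Ck_on_subset[OF V(3)[rule_format]]) (use U V in auto)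
  then show "\<exists>U g'. open U \<and> x \<in> U \<and> (\<forall>k. Ck_on k U g') \<and> (\<forall>y\<in>S \<inter> U. g' y = h (f y) (g y))"
    using U V by (intro exI[of _ "U \<inter> V"] exI[of _ "\<lambda>x. h (f1 x) (g1 x)"]) auto
qed

lemma smooth_on_bounded_linear:
  assumes h: "bounded_linear h" and "smooth_on S f"
  shows "smooth_on S (\<lambda>x. h (f x))"
proof (rule smooth_onI)
  fix x assume x: "x \<in> S"
  obtain U f1 where
    U: "open U" "x \<in> U" "\<forall>k. Ck_on k U f1" "\<forall>y\<in>S \<inter> U. f1 y = f y"
    by (rule smooth_onE[OF assms(2) x])
  then show "\<exists>U g. open U \<and> x \<in> U \<and> (\<forall>k. Ck_on k U g) \<and> (\<forall>y\<in>S \<inter> U. g y = h (f y))"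
    using Ck_on_bounded_linear[OF h U(1) U(3)[rule_format]]
    by (intro exI[of _ U] exI[of _ "\<lambda>x. h (f1 x)"]) auto
qed

lemma smooth_on_add:
  assumes "smooth_on S f" "smooth_on S g"
  shows "smooth_on S (\<lambda>x. f x + g x)"
proof (rule smooth_onI)
  fix x assume x: "x \<in> S"
  obtain U f1 where
    U: "open U" "x \<in> U" "\<forall>k. Ck_on k U f1" "\<forall>y\<in>S \<inter> U. f1 y = f y"
    by (rule smooth_onE[OF assms(1) x])
  obtain V g1 where
    V: "open V" "x \<in> V" "\<forall>k. Ck_on k V g1" "\<forall>y\<in>S \<inter> V. g1 y = g y"
    by (rule smooth_onE[OF assms(2) x])
  have "Ck_on k (U \<inter> V) (\<lambda>x. f1 x + g1 x)" for k
    by (intro Ck_on_add Ck_on_subset[OF U(3)[rule_format]] Ck_on_subset[OF V(3)[rule_format]]) (use U V in auto)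
  then show "\<exists>U g'. open U \<and> x \<in> U \<and> (\<forall>k. Ck_on k U g') \<and> (\<forall>y\<in>S \<inter> U. g' y = f y + g y)"
    using U V by (intro exI[of _ "U \<inter> V"] exI[of _ "\<lambda>x. f1 x + g1 x"]) auto
qed

lemma smooth_on_minus: "smooth_on S f \<Longrightarrow> smooth_on S (\<lambda>x. - f x)"
  by (rule smooth_on_bounded_linear[OF bounded_linear_minus[OF bounded_linear_ident]])

lemma smooth_on_diff: "smooth_on S f \<Longrightarrow> smooth_on S g \<Longrightarrow> smooth_on S (\<lambda>x. f x - g x)"
  using smooth_on_add[OF _ smooth_on_minus] by force

lemma smooth_on_Pair:
  assumes "smooth_on S f" "smooth_on S g"
  shows "smooth_on S (\<lambda>x. (f x, g x))"
proof -
  have 1: "bounded_linear (\<lambda>a::'b. (a, 0::'c))" "bounded_linear (\<lambda>b::'c. (0::'b, b))"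
    by (auto intro!: bounded_linear_Pair bounded_linear_ident bounded_linear_zero)
  have "smooth_on S (\<lambda>x. (f x, 0) + (0, g x))"
    by (intro smooth_on_add smooth_on_bounded_linear[OF 1(1)] smooth_on_bounded_linear[OF 1(2)] assms)
  then show ?thesis by simp
qed

lemma smooth_on_fst: "smooth_on S f \<Longrightarrow> smooth_on S (\<lambda>x. fst (f x))"
  by (rule smooth_on_bounded_linear[OF bounded_linear_fst])

lemma smooth_on_snd: "smooth_on S f \<Longrightarrow> smooth_on S (\<lambda>x. snd (f x))"
  by (rule smooth_on_bounded_linear[OF bounded_linear_snd])

lemma smooth_on_compose:
  assumes "smooth_on S f" "smooth_on T g" "f ` S \<subseteq> T"
  shows "smooth_on S (\<lambda>x. g (f x))"
proof (rule smooth_onI)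
  fix x assume x: "x \<in> S"
  obtain U f1 where
    U: "open U" "x \<in> U" "\<forall>k. Ck_on k U f1" "\<forall>y\<in>S \<inter> U. f1 y = f y"
    by (rule smooth_onE[OF assms(1) x])
  have fx: "f x \<in> T" using assms(3) x by auto
  obtain V g1 where
    V: "open V" "f x \<in> V" "\<forall>k. Ck_on k V g1" "\<forall>y\<in>T \<inter> V. g1 y = g y"
    by (rule smooth_onE[OF assms(2) fx])
  have "continuous_on U f1" using U(3)[rule_format, of 0] by simp
  then have o: "open (U \<inter> f1 -` V)" using continuous_open_preimage U(1) V(1) by blast
  have "Ck_on k (U \<inter> f1 -` V) (\<lambda>x. g1 (f1 x))" for k
    by (rule Ck_on_compose[OF o V(1) _ Ck_on_subset[OF U(3)[rule_format]] V(3)[rule_format]]) auto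
  then show "\<exists>U g'. open U \<and> x \<in> U \<and> (\<forall>k. Ck_on k U g') \<and> (\<forall>y\<in>S \<inter> U. g' y = g (f y))"
    using U V o x assms(3)
    by (intro exI[of _ "U \<inter> f1 -` V"] exI[of _ "\<lambda>x. g1 (f1 x)"]) (auto simp: image_subset_iff)
qed

lemma smooth_on_imp_has_derivative:
  assumes "smooth_on S f" "x \<in> S"
  obtains f' where "(f has_derivative f') (at x within S)"
proof -
  obtain U f1 where
    U: "open U" "x \<in> U" "\<forall>k. Ck_on k U f1" "\<forall>y\<in>S \<inter> U. f1 y = f y"
    by (rule smooth_onE[OF assms])
  have "(f1 has_derivative frechet_derivative f1 (at x)) (at x within S)"
    using Ck_on_SucD(1)[OF U(3)[rule_format] U(2)] by (rule has_derivative_at_withinI)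
  moreover obtain d where "d > 0" "ball x d \<subseteq> U" using U openE by blast
  ultimately have "(f has_derivative frechet_derivative f1 (at x)) (at x within S)"
    by (elim has_derivative_transform_within[where d = d])
      (use assms(2) U in \<open>auto simp: dist_commute subset_iff\<close>)
  then show ?thesis using that by blast
qed

lemma smooth_on_imp_continuous_on: "smooth_on S f \<Longrightarrow> continuous_on S f"
  by (metis smooth_on_imp_has_derivative has_derivative_continuous continuous_on_eq_continuous_within)

section \<open>Tangent vectors and differentials\<close>

lemma tangent_spaceE:
  assumes "v \<in> tangent_space S x"
  obtains c e where "0 < e" "smooth_on {-e<..<e} c" "c ` {-e<..<e} \<subseteq> S" "c (0::real) = x"
    "(c has_vector_derivative v) (at 0)"
  using assms unfolding tangent_space_def by blast

lemma tangent_spaceI: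
  assumes "0 < e" "smooth_on {-e<..<e} c" "c ` {-e<..<e} \<subseteq> S" "c (0::real) = x"
    "(c has_vector_derivative v) (at 0)"
  shows "v \<in> tangent_space S x"
  unfolding tangent_space_def using assms by (intro CollectI exI[of _ c] exI[of _ e] conjI)

lemma has_vector_derivative_chain_within:
  fixes c :: "real \<Rightarrow> 'a::real_normed_vector"
  assumes f: "(f has_derivative f') (at (c 0) within S)"
    and e: "0 < e" "c ` {-e<..<e} \<subseteq> S" and c: "(c has_vector_derivative v) (at 0)"
  shows "((\<lambda>t. f (c t)) has_vector_derivative f' v) (at 0)"
proof -
  let ?T = "{-e<..<e}"
  have T: "at (0::real) within ?T = at 0" by (rule at_within_open) (use e in auto)
  have "(f has_derivative f') (at (c 0) within c ` ?T)" using f e(2) has_derivative_subset by blast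
  moreover have "(c has_derivative (\<lambda>h. h *\<^sub>R v)) (at 0 within ?T)"
    using c T by (simp add: has_vector_derivative_def)
  ultimately have "((\<lambda>t. f (c t)) has_derivative (\<lambda>h. f' (h *\<^sub>R v))) (at 0 within ?T)"
    using has_derivative_in_compose by blast
  then show ?thesis
    using linear_scale[OF has_derivative_linear[OF f]] T by (simp add: has_vector_derivative_def)
qed

text \<open>Derivatives within \<open>S\<close> are not unique, and \<open>differential\<close>
  picks one of them. On the velocity of a curve inside \<open>S\<close> any two compute the
  derivative of the same function of one variable, so they agree there.\<close>

lemma differential_tangent:
  assumes f: "(f has_derivative f') (at x within S)" and v: "v \<in> tangent_space S x"
  shows "differential S f x v = f' v"
proof -
  from v obtain c e where c: "0 < e" "smooth_on {-e<..<e} c" "c ` {-e<..<e} \<subseteq> S" "c (0::real) = x"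
    "(c has_vector_derivative v) (at 0)" by (rule tangent_spaceE)
  have "(f has_derivative differential S f x) (at x within S)"
    unfolding differential_def using f frechet_derivative_works by (auto simp: differentiable_def)
  then have "((\<lambda>t. f (c t)) has_vector_derivative differential S f x v) (at 0)"
    using has_vector_derivative_chain_within[of f _ c S e] c by auto
  moreover have "((\<lambda>t. f (c t)) has_vector_derivative f' v) (at 0)"
    using has_vector_derivative_chain_within[of f f' c S e] c f by auto
  ultimately show ?thesis by (rule vector_derivative_unique_at)
qed

lemma differential_curve:
  assumes "smooth_on S f" "0 < e" "c ` {-e<..<e} \<subseteq> S" "smooth_on {-e<..<e} c"
    and "(c has_vector_derivative v) (at (0::real))"
  shows "((\<lambda>t. f (c t)) has_vector_derivative differential S f (c 0) v) (at 0)"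
proof -
  have "c 0 \<in> S" using assms by auto
  then obtain f' where f': "(f has_derivative f') (at (c 0) within S)"
    using smooth_on_imp_has_derivative[OF assms(1)] by blast
  have v: "v \<in> tangent_space S (c 0)"
    using tangent_spaceI[OF assms(2,4,3) _ assms(5)] by simp
  show ?thesis
    using has_vector_derivative_chain_within[OF f' assms(2,3,5)] differential_tangent[OF f' v] by simp
qed

lemma differential_tangent_space:
  assumes "smooth_on S f" "f ` S \<subseteq> T" "v \<in> tangent_space S x"
  shows "differential S f x v \<in> tangent_space T (f x)"
proof -
  from assms(3) obtain c e where c: "0 < e" "smooth_on {-e<..<e} c" "c ` {-e<..<e} \<subseteq> S" "c (0::real) = x"
    "(c has_vector_derivative v) (at 0)" by (rule tangent_spaceE)
  have "smooth_on {-e<..<e} (\<lambda>t. f (c t))" using smooth_on_compose[OF c(2) assms(1) c(3)] .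
  moreover have "((\<lambda>t. f (c t)) has_vector_derivative differential S f x v) (at 0)"
    using differential_curve[OF assms(1) c(1,3,2,5)] c(4) by simp
  ultimately show ?thesis
    using c assms(2) by (intro tangent_spaceI[of e "\<lambda>t. f (c t)"]) auto
qed

lemma tangent_space_mono: "S \<subseteq> T \<Longrightarrow> tangent_space S x \<subseteq> tangent_space T x"
proof
  fix v assume ST: "S \<subseteq> T" and v: "v \<in> tangent_space S x"
  from v obtain c e where c: "0 < e" "smooth_on {-e<..<e} c" "c ` {-e<..<e} \<subseteq> S" "c (0::real) = x"
    "(c has_vector_derivative v) (at 0)" by (rule tangent_spaceE)
  from c(3) ST have "c ` {-e<..<e} \<subseteq> T" by (rule order_trans)
  from tangent_spaceI[OF c(1,2) this c(4,5)] show "v \<in> tangent_space T x" .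
qed

lemma tangent_space_openin:
  assumes "openin (top_of_set S) T" "x \<in> T"
  shows "tangent_space T x = tangent_space S x"
proof
  show "tangent_space T x \<subseteq> tangent_space S x"
    by (rule tangent_space_mono[OF openin_imp_subset[OF assms(1)]])
next
  show "tangent_space S x \<subseteq> tangent_space T x"
  proof
    fix v assume "v \<in> tangent_space S x"
    then obtain c e where c: "0 < e" "smooth_on {-e<..<e} c" "c ` {-e<..<e} \<subseteq> S" "c (0::real) = x"
      "(c has_vector_derivative v) (at 0)" by (rule tangent_spaceE)
    obtain U where U: "open U" "T = S \<inter> U" using assms(1) by (auto simp: openin_open)
    have "open ({-e<..<e} \<inter> c -` U)"
      by (intro continuous_open_preimage smooth_on_imp_continuous_on c U) auto
    moreover have "0 \<in> {-e<..<e} \<inter> c -` U" using c assms(2) U by auto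
    ultimately obtain d where d: "d > 0" "ball 0 d \<subseteq> {-e<..<e} \<inter> c -` U" using openE by blast
    have "{-d<..<d} = ball 0 d" by (auto simp: dist_real_def)
    then have sub: "{-d<..<d} \<subseteq> {-e<..<e} \<inter> c -` U" using d by simp
    then have "c ` {-d<..<d} \<subseteq> T" using c(3) U(2) by auto
    moreover have "smooth_on {-d<..<d} c" using smooth_on_subset[OF c(2)] sub by auto
    ultimately show "v \<in> tangent_space T x"
      using tangent_spaceI[OF d(1) _ _ c(4,5)] by blast
  qed
qed

lemma smooth_on_has_vector_derivative:
  fixes f :: "real \<Rightarrow> 'a::euclidean_space"
  assumes "smooth_on UNIV f"
  shows "(f has_vector_derivative vector_derivative f (at t)) (at t)"
proof -
  obtain f' where "(f has_derivative f') (at t)" using smooth_on_imp_has_derivative[OF assms, of t] by auto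
  then show ?thesis using vector_derivative_works differentiable_def by blast
qed

text \<open>Reduces a differential to calculus in one variable, along an arbitrary curve with the
  given velocity; the Lie bracket is computed in this way.\<close>

lemma differential_eqI:
  assumes f: "smooth_on T f" and v: "v \<in> tangent_space T x"
    and *: "\<And>c. c 0 = x \<Longrightarrow> (c has_vector_derivative v) (at (0::real)) \<Longrightarrow>
      ((\<lambda>t. f (c t)) has_vector_derivative w) (at 0)"
  shows "differential T f x v = w"
proof -
  from v obtain c r where c: "0 < r" "smooth_on {-r<..<r} c" "c ` {-r<..<r} \<subseteq> T" "c (0::real) = x"
    "(c has_vector_derivative v) (at 0)" by (rule tangent_spaceE)
  from differential_curve[OF f c(1,3,2,5)] *[OF c(4,5)] show ?thesis
    using vector_derivative_unique_at c(4) by blast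
qed

lemma differential_cong:
  assumes "x \<in> T" "\<And>y. y \<in> T \<Longrightarrow> f y = g y"
  shows "differential T f x = differential T g x"
proof -
  have "(f has_derivative f') (at x within T) \<longleftrightarrow> (g has_derivative f') (at x within T)" for f'
    using assms by (metis has_derivative_transform)
  then show ?thesis by (simp add: differential_def frechet_derivative_def)
qed

section \<open>Units of finite-dimensional algebras\<close>

text \<open>One abstract algebra serves both for square matrices and for pairs of them. Translations
  in a group of units are restrictions of linear maps, so their differentials are again
  products.\<close>

locale fd_algebra =
  fixes mul :: "'g::euclidean_space \<Rightarrow> 'g \<Rightarrow> 'g" (infixl "\<odot>" 70) and e :: 'g
  assumes bil: "bounded_bilinear mul"
    and assoc: "(x \<odot> y) \<odot> z = x \<odot> (y \<odot> z)"
    and unit_l [simp]: "e \<odot> x = x"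
    and unit_r [simp]: "x \<odot> e = x"
begin

sublocale bil: bounded_bilinear mul by (rule bil)

lemmas distribs = bil.add_left bil.add_right bil.diff_left bil.diff_right bil.minus_left
  bil.minus_right
declare bil.zero_left [simp] bil.zero_right [simp]

definition unit :: "'g \<Rightarrow> bool" where
  "unit x \<longleftrightarrow> (\<exists>y. x \<odot> y = e \<and> y \<odot> x = e)"

definition ainv :: "'g \<Rightarrow> 'g" where
  "ainv x = (SOME y. x \<odot> y = e \<and> y \<odot> x = e)"

lemma ainv: "unit x \<Longrightarrow> x \<odot> ainv x = e" "unit x \<Longrightarrow> ainv x \<odot> x = e"
  unfolding unit_def ainv_def by (metis (mono_tags, lifting) someI_ex)+

lemma ainv_cancel [simp]:
  "unit x \<Longrightarrow> x \<odot> (ainv x \<odot> y) = y" "unit x \<Longrightarrow> ainv x \<odot> (x \<odot> y) = y"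
  by (metis ainv assoc unit_l)+

lemma unitI: "x \<odot> y = e \<Longrightarrow> y \<odot> x = e \<Longrightarrow> unit x"
  unfolding unit_def by blast

lemma ainv_eqI: "x \<odot> y = e \<Longrightarrow> y \<odot> x = e \<Longrightarrow> ainv x = y"
  by (metis ainv(2) assoc unit_l unit_r unitI)

lemma unit_e [simp]: "unit e" and ainv_e [simp]: "ainv e = e"
  by (auto intro: unitI ainv_eqI)

lemma unit_ainv: "unit x \<Longrightarrow> unit (ainv x)" and ainv_ainv: "unit x \<Longrightarrow> ainv (ainv x) = x"
  using ainv by (blast intro: unitI ainv_eqI)+

lemma unit_mul: "unit x \<Longrightarrow> unit y \<Longrightarrow> unit (x \<odot> y)"
  and ainv_mul: "unit x \<Longrightarrow> unit y \<Longrightarrow> ainv (x \<odot> y) = ainv y \<odot> ainv x"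
  by (auto intro!: unitI[of _ "ainv y \<odot> ainv x"] ainv_eqI simp: assoc ainv)

lemma reflection_square: "E \<odot> E = E \<Longrightarrow> (E + E - e) \<odot> (E + E - e) = e"
  by (simp add: distribs)

lemma linear_left: "linear (\<lambda>y. x \<odot> y)"
  by (simp add: bil.bounded_linear_right bounded_linear.linear)

text \<open>The lower bound \<open>norm z \<le> c * norm (y \<odot> z)\<close> survives small
  perturbations of a unit. It gives injectivity of multiplication by \<open>y\<close>, hence
  surjectivity in finite dimension; it also bounds \<open>ainv y\<close> uniformly near
  \<open>x\<close>.\<close>

lemma unit_near:
  assumes "unit x"
  obtains d c where "d > 0" "c > 0" "\<forall>y. norm (y - x) < d \<longrightarrow> unit y"
    "\<forall>y z. norm (y - x) < d \<longrightarrow> norm z \<le> c * norm (y \<odot> z)"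
proof -
  obtain K where K: "K > 0" "\<And>a b. norm (a \<odot> b) \<le> norm a * norm b * K"
    using bil.pos_bounded by blast
  define a where "a = norm (ainv x) * K + 1"
  have a: "a > 0" using K by (auto simp: a_def intro: add_nonneg_pos)
  have lower: "norm z \<le> a * norm (x \<odot> z)" for z
  proof -
    have "norm z = norm (ainv x \<odot> (x \<odot> z))" using assms by simp
    also have "\<dots> \<le> norm (ainv x) * norm (x \<odot> z) * K" by (rule K(2))
    also have "\<dots> \<le> a * norm (x \<odot> z)" by (simp add: a_def algebra_simps)
    finally show ?thesis .
  qed
  \<comment> \<open>The radius makes \<open>a * norm ((y - x) \<odot> z)\<close> at most half of
    \<open>norm z\<close>, so half of the lower bound is left.\<close>
  have near: "norm z \<le> 2 * a * norm (y \<odot> z)" if "norm (y - x) < 1 / (2 * a * K)" for y z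
  proof -
    have "norm ((y - x) \<odot> z) \<le> norm (y - x) * norm z * K" by (rule K(2))
    also have "\<dots> \<le> 1 / (2 * a * K) * norm z * K"
      using that K(1) by (intro mult_right_mono) auto
    also have "\<dots> = norm z / (2 * a)" using K(1) a by (simp add: field_simps)
    finally have "a * norm ((y - x) \<odot> z) \<le> norm z / 2"
      using a by (simp add: field_simps)
    moreover have "norm (x \<odot> z) \<le> norm (y \<odot> z) + norm ((y - x) \<odot> z)"
      using norm_triangle_ineq4[of "y \<odot> z" "(y - x) \<odot> z"] by (simp add: bil.diff_left)
    then have "a * norm (x \<odot> z) \<le> a * norm (y \<odot> z) + a * norm ((y - x) \<odot> z)"
      using a by (simp add: flip: distrib_left)
    ultimately show ?thesis using lower[of z] by simp
  qed
  have "unit y" if "norm (y - x) < 1 / (2 * a * K)" for y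
  proof -
    have inj: "z = 0" if "y \<odot> z = 0" for z
      using near[OF \<open>norm (y - x) < _\<close>, of z] that by simp
    then have "inj (\<lambda>z. y \<odot> z)"
      using linear_injective_0[OF linear_left, of y] by blast
    then have "surj (\<lambda>z. y \<odot> z)" using linear_injective_imp_surjective[OF linear_left] by blast
    then obtain z where z: "y \<odot> z = e" by (metis surjD)
    \<comment> \<open>Injectivity of multiplication by \<open>y\<close> turns the right inverse into
      a two-sided one.\<close>
    have "y \<odot> (z \<odot> y - e) = 0" by (simp add: distribs z flip: assoc)
    then have "z \<odot> y = e" using inj by fastforce
    with z show ?thesis by (rule unitI)
  qed
  then show ?thesis using that[of "1 / (2 * a * K)" "2 * a"] near a K(1) by auto
qed

lemma open_units: "open (Collect unit)"
  unfolding open_dist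
  by (metis dist_norm mem_Collect_eq unit_near)

lemma ainv_diff: "unit x \<Longrightarrow> unit y \<Longrightarrow> ainv y - ainv x = - (ainv y \<odot> (y - x) \<odot> ainv x)"
  by (simp add: distribs assoc ainv)

text \<open>By \<open>ainv_diff\<close> the increment of the inverse is a product containing
  \<open>y - x\<close>. Applying the identity a second time to the error of the linear approximation
  makes that error quadratic in \<open>y - x\<close>, with a constant coming from
  \<open>unit_near\<close>.\<close>

lemma ainv_has_derivative:
  assumes x: "unit x"
  shows "(ainv has_derivative (\<lambda>v. - (ainv x \<odot> v \<odot> ainv x))) (at x)"
proof -
  obtain K where K: "K > 0" "\<And>a b. norm (a \<odot> b) \<le> norm a * norm b * K"
    using bil.pos_bounded by blast
  obtain d c where dc: "d > 0" "c > 0" "\<forall>y. norm (y - x) < d \<longrightarrow> unit y"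
    "\<forall>y z. norm (y - x) < d \<longrightarrow> norm z \<le> c * norm (y \<odot> z)" by (rule unit_near[OF x])
  note d = dc(1,2) dc(3)[rule_format] dc(4)[rule_format]
  have ev: "\<forall>\<^sub>F y in at x. norm (y - x) < d"
    using d(1) by (auto simp: eventually_at dist_norm)
  have K3: "norm (a \<odot> b \<odot> c') \<le> norm a * norm b * norm c' * (K * K)" for a b c'
  proof -
    have "norm (a \<odot> b \<odot> c') \<le> norm (a \<odot> b) * (norm c' * K)" using K(2)[of "a \<odot> b" c'] by (simp add: mult_ac)
    also have "\<dots> \<le> (norm a * norm b * K) * (norm c' * K)" using K by (intro mult_right_mono) auto
    finally show ?thesis by (simp add: mult_ac)
  qed
  have lip: "norm (ainv y - ainv x) \<le> (c * norm e) * norm (ainv x) * (K * K) * norm (y - x)"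
    if "norm (y - x) < d" for y
  proof -
    have "norm (ainv y) \<le> c * norm e" using d(4)[OF that, of "ainv y"] d(3)[OF that] by (simp add: ainv)
    then have "norm (ainv y) * (norm (y - x) * norm (ainv x) * (K * K))
       \<le> (c * norm e) * (norm (y - x) * norm (ainv x) * (K * K))"
      using K(1) by (intro mult_right_mono) auto
    then show ?thesis
      using K3[of "ainv y" "y - x" "ainv x"] ainv_diff[OF x d(3)[OF that]] by (simp add: mult_ac)
  qed
  let ?C = "(c * norm e) * norm (ainv x) * (K * K) * norm (ainv x) * (K * K)"
  have quad: "norm (ainv y - ainv x - - (ainv x \<odot> (y - x) \<odot> ainv x)) / norm (y - x) \<le> ?C * norm (y - x)"
    if "norm (y - x) < d" for y
  proof -
    have "(ainv y - ainv x) \<odot> (y - x) \<odot> ainv x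
        = ainv y \<odot> (y - x) \<odot> ainv x - ainv x \<odot> (y - x) \<odot> ainv x"
      by (simp only: bil.diff_left)
    then have "ainv y - ainv x - - (ainv x \<odot> (y - x) \<odot> ainv x)
        = - ((ainv y - ainv x) \<odot> (y - x) \<odot> ainv x)"
      using ainv_diff[OF x d(3)[OF that]] by (simp only:) simp
    then have "norm (ainv y - ainv x - - (ainv x \<odot> (y - x) \<odot> ainv x))
        = norm ((ainv y - ainv x) \<odot> (y - x) \<odot> ainv x)"
      by (simp only: norm_minus_cancel)
    also have "\<dots> \<le> norm (ainv y - ainv x) * (norm (y - x) * norm (ainv x) * (K * K))"
      using K3[of "ainv y - ainv x" "y - x" "ainv x"] by (simp add: mult_ac)
    also have "\<dots> \<le> ((c * norm e) * norm (ainv x) * (K * K) * norm (y - x)) * (norm (y - x) * norm (ainv x) * (K * K))"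
      using K(1) by (intro mult_right_mono lip that) auto
    finally show ?thesis by (cases "y = x") (simp_all add: divide_simps mult_ac)
  qed
  have "((\<lambda>y. norm (ainv y - ainv x - - (ainv x \<odot> (y - x) \<odot> ainv x)) / norm (y - x)) \<longlongrightarrow> 0) (at x)"
  proof (rule Lim_null_comparison)
    show "\<forall>\<^sub>F y in at x. norm (norm (ainv y - ainv x - - (ainv x \<odot> (y - x) \<odot> ainv x)) / norm (y - x))
       \<le> ?C * norm (y - x)"
      using ev by eventually_elim (use quad in simp)
    have "((\<lambda>y. ?C * norm (y - x)) \<longlongrightarrow> ?C * norm (x - x)) (at x)" by (intro tendsto_intros)
    then show "((\<lambda>y. ?C * norm (y - x)) \<longlongrightarrow> 0) (at x)" by simp
  qed
  moreover have "bounded_linear (\<lambda>v. - (ainv x \<odot> v \<odot> ainv x))"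
    by (intro bounded_linear_minus bounded_linear_compose[OF bil.bounded_linear_left bil.bounded_linear_right, unfolded o_def])
  ultimately show ?thesis by (simp only: has_derivative_iff_norm)
qed

text \<open>The derivative of inversion is a polynomial expression in inversion itself, so each
  order of differentiability yields the next.\<close>

lemma Ck_on_ainv: "Ck_on k (Collect unit) ainv"
proof (induction k)
  case 0
  show ?case
    by (auto intro!: continuous_at_imp_continuous_on has_derivative_continuous[OF ainv_has_derivative])
next
  case (Suc k)
  have "Ck_on k (Collect unit) (\<lambda>x. - (ainv x \<odot> v \<odot> ainv x))" for v
    by (rule Ck_on_bounded_linear[OF bounded_linear_minus[OF bounded_linear_ident] open_units])
      (rule Ck_on_bilinear[OF bil open_units Ck_on_bilinear[OF bil open_units Suc Ck_on_const[OF open_units]] Suc])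
  then show ?case
    by (rule Ck_on_SucI[OF open_units, where f' = "\<lambda>x v. - (ainv x \<odot> v \<odot> ainv x)", rotated])
      (simp add: ainv_has_derivative)
qed

lemma smooth_on_ainv:
  assumes "smooth_on S f" "\<And>x. x \<in> S \<Longrightarrow> unit (f x)"
  shows "smooth_on S (\<lambda>x. ainv (f x))"
proof (rule smooth_on_compose[OF assms(1)])
  show "smooth_on (Collect unit) ainv"
    by (rule smooth_on_open[OF open_units Ck_on_ainv]) simp
qed (use assms(2) in auto)

lemmas smooth_on_mul = smooth_on_bilinear[OF bil]

lemmas smooth_intros = smooth_on_mul smooth_on_const smooth_on_ident smooth_on_add smooth_on_diff
  smooth_on_minus smooth_on_Pair smooth_on_fst smooth_on_snd smooth_on_ainv

end

section \<open>Lie groups of units\<close>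

locale unit_group = fd_algebra +
  fixes S :: "'a set" and G :: "'a monoid"
  assumes G_eq: "G = \<lparr>carrier = S, monoid.mult = mul, one = e\<rparr>"
    and e_S [simp]: "e \<in> S"
    and mul_S [simp]: "x \<in> S \<Longrightarrow> y \<in> S \<Longrightarrow> x \<odot> y \<in> S"
    and unit_S [simp]: "x \<in> S \<Longrightarrow> unit x"
    and ainv_S [simp]: "x \<in> S \<Longrightarrow> ainv x \<in> S"
begin

lemma carrier_G [simp]: "carrier G = S" and mult_G [simp]: "x \<otimes>\<^bsub>G\<^esub> y = x \<odot> y" and one_G [simp]: "\<one>\<^bsub>G\<^esub> = e"
  by (simp_all add: G_eq)

lemma group_G: "group G"
  by (rule groupI) (auto simp: assoc, metis ainv(2) ainv_S unit_S)

lemma inv_G [simp]: "x \<in> S \<Longrightarrow> inv\<^bsub>G\<^esub> x = ainv x"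
  using group.inv_equality[OF group_G, of "ainv x" x] by (simp add: ainv)

abbreviation liealg :: "'a set" ("\<gg>") where "\<gg> \<equiv> tangent_space S e"

lemma curve_left:
  fixes c :: "real \<Rightarrow> 'a"
  shows "(c has_vector_derivative v) F \<Longrightarrow> ((\<lambda>t. u \<odot> c t) has_vector_derivative u \<odot> v) F"
    and "(c has_vector_derivative v) F \<Longrightarrow> ((\<lambda>t. c t \<odot> u) has_vector_derivative v \<odot> u) F"
  by (rule bounded_linear.has_vector_derivative[OF bil.bounded_linear_right]
      bounded_linear.has_vector_derivative[OF bil.bounded_linear_left]; assumption)+

lemma tangent_translate:
  assumes "u \<in> S" "v \<in> tangent_space S x"
  shows "u \<odot> v \<in> tangent_space S (u \<odot> x)" and "v \<odot> u \<in> tangent_space S (x \<odot> u)"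
proof -
  from assms(2) obtain c e where c: "0 < e" "smooth_on {-e<..<e} c" "c ` {-e<..<e} \<subseteq> S" "c (0::real) = x"
    "(c has_vector_derivative v) (at 0)" by (rule tangent_spaceE)
  show "u \<odot> v \<in> tangent_space S (u \<odot> x)"
    using c assms(1) by (intro tangent_spaceI[of e "\<lambda>t. u \<odot> c t"] smooth_on_mul smooth_on_const curve_left) auto
  show "v \<odot> u \<in> tangent_space S (x \<odot> u)"
    using c assms(1) by (intro tangent_spaceI[of e "\<lambda>t. c t \<odot> u"] smooth_on_mul smooth_on_const curve_left) auto
qed

lemma tangent_iff: "u \<in> S \<Longrightarrow> v \<in> tangent_space S u \<longleftrightarrow> ainv u \<odot> v \<in> \<gg>"
  using tangent_translate(1)[of "ainv u" v u] tangent_translate(1)[of u "ainv u \<odot> v" e]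
  by (auto simp: ainv)

lemma tangent_left: "u \<in> S \<Longrightarrow> A \<in> \<gg> \<Longrightarrow> u \<odot> A \<in> tangent_space S u"
  using tangent_translate(1)[of u A e] by simp

lemma Ad_in: "g \<in> S \<Longrightarrow> A \<in> \<gg> \<Longrightarrow> g \<odot> A \<odot> ainv g \<in> \<gg>"
  using tangent_translate(2)[of "ainv g" "g \<odot> A" g] tangent_left[of g A] by (simp add: ainv)

text \<open>The pointwise product of two curves through \<open>e\<close> has the sum of their
  velocities, and the time change \<open>k * t\<close> multiplies a velocity by
  \<open>k\<close>.\<close>

lemma subspace_liealg: "subspace \<gg>"
proof (rule subspaceI)
  show "0 \<in> \<gg>"
    by (rule tangent_spaceI[of 1 "\<lambda>t. e"]) (auto intro: smooth_on_const)
next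
  fix A B assume "A \<in> \<gg>" "B \<in> \<gg>"
  from \<open>A \<in> \<gg>\<close> obtain c r where c: "0 < r" "smooth_on {-r<..<r} c" "c ` {-r<..<r} \<subseteq> S" "c (0::real) = e"
    "(c has_vector_derivative A) (at 0)" by (rule tangent_spaceE)
  from \<open>B \<in> \<gg>\<close> obtain d s where d: "0 < s" "smooth_on {-s<..<s} d" "d ` {-s<..<s} \<subseteq> S" "d (0::real) = e"
    "(d has_vector_derivative B) (at 0)" by (rule tangent_spaceE)
  let ?q = "min r s"
  have sub: "{-?q<..<?q} \<subseteq> {-r<..<r}" "{-?q<..<?q} \<subseteq> {-s<..<s}" by auto
  have "((\<lambda>t. c t \<odot> d t) has_vector_derivative A + B) (at 0)"
    using bil.has_vector_derivative[OF c(5) d(5)] by (simp add: c d add.commute)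
  then show "A + B \<in> \<gg>"
    using c d sub by (intro tangent_spaceI[of ?q "\<lambda>t. c t \<odot> d t"] smooth_on_mul
        smooth_on_subset[OF c(2) sub(1)] smooth_on_subset[OF d(2) sub(2)]) (auto simp: image_subset_iff)
next
  fix k A assume "A \<in> \<gg>"
  then obtain c r where c: "0 < r" "smooth_on {-r<..<r} c" "c ` {-r<..<r} \<subseteq> S" "c (0::real) = e"
    "(c has_vector_derivative A) (at 0)" by (rule tangent_spaceE)
  \<comment> \<open>The summand 1 covers \<open>k = 0\<close> and keeps \<open>k * t\<close>
    strictly inside the interval of \<open>c\<close>.\<close>
  let ?q = "r / (\<bar>k\<bar> + 1)"
  have q: "?q > 0" using c(1) by (intro divide_pos_pos) auto
  have sub: "k * t \<in> {-r<..<r}" if "t \<in> {-?q<..<?q}" for t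
  proof -
    have "\<bar>t\<bar> < ?q" using that by auto
    then have "\<bar>t\<bar> * (\<bar>k\<bar> + 1) < r" by (simp add: field_simps)
    moreover have "\<bar>k * t\<bar> \<le> \<bar>t\<bar> * (\<bar>k\<bar> + 1)" by (simp add: abs_mult algebra_simps)
    ultimately have "\<bar>k * t\<bar> < r" by linarith
    then show ?thesis by (auto simp: abs_less_iff)
  qed
  have sm: "smooth_on {-?q<..<?q} (\<lambda>t. k * t)"
    by (intro smooth_on_bilinear[OF bounded_bilinear_mult] smooth_on_const smooth_on_ident)
  have "((c \<circ> (\<lambda>t. k * t)) has_vector_derivative k *\<^sub>R A) (at 0)"
    by (rule vector_diff_chain_at) (auto intro!: derivative_eq_intros simp: c)
  moreover have "smooth_on {-?q<..<?q} (\<lambda>t. c (k * t))"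
    by (rule smooth_on_compose[OF sm c(2)]) (use sub in blast)
  ultimately show "k *\<^sub>R A \<in> \<gg>"
    using c sub by (intro tangent_spaceI[OF q, of "\<lambda>t. c (k * t)"]) (auto simp: o_def image_subset_iff)
qed

lemma bracket_curve:
  assumes "c 0 = e" "(c has_vector_derivative A) (at 0)"
  shows "((\<lambda>t. c t \<odot> B \<odot> ainv (c t)) has_vector_derivative A \<odot> B - B \<odot> A) (at (0::real))"
proof -
  have "((\<lambda>t. ainv (c t)) has_vector_derivative - A) (at 0)"
    using has_vector_derivative_chain_within[of ainv "\<lambda>v. - (ainv e \<odot> v \<odot> ainv e)" c UNIV 1 A]
      ainv_has_derivative[OF unit_e] assms by simp
  from bil.has_vector_derivative[OF curve_left(2)[OF assms(2), of B] this]
  show ?thesis using assms(1) by (simp add: bil.minus_right)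
qed

text \<open>The bracket is a limit of difference quotients of the curve \<open>Ad (c t) B\<close> in the closed set
  \<open>\<gg>\<close>.\<close>

lemma bracket_in:
  assumes "A \<in> \<gg>" "B \<in> \<gg>"
  shows "A \<odot> B - B \<odot> A \<in> \<gg>"
proof -
  from \<open>A \<in> \<gg>\<close> obtain c r where c: "0 < r" "smooth_on {-r<..<r} c" "c ` {-r<..<r} \<subseteq> S" "c (0::real) = e"
    "(c has_vector_derivative A) (at 0)" by (rule tangent_spaceE)
  \<comment> \<open>Membership is tested against each \<open>w\<close> orthogonal to the Lie
    algebra: the inner product of \<open>w\<close> with the curve vanishes near 0, hence so does its
    derivative.\<close>
  have "A \<odot> B - B \<odot> A \<in> \<gg>\<^sup>\<bottom>\<^sup>\<bottom>"
    unfolding orthogonal_comp_def orthogonal_def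
  proof (intro CollectI ballI)
    fix w assume w: "w \<in> {x. \<forall>y\<in>\<gg>. y \<bullet> x = 0}"
    have "((\<lambda>t. w \<bullet> (c t \<odot> B \<odot> ainv (c t))) has_vector_derivative w \<bullet> (A \<odot> B - B \<odot> A)) (at 0)"
      by (rule bounded_linear.has_vector_derivative[OF bounded_linear_inner_right bracket_curve[OF c(4,5)]])
    moreover have "((\<lambda>t. w \<bullet> (c t \<odot> B \<odot> ainv (c t))) has_vector_derivative 0) (at 0)"
    proof (rule has_vector_derivative_transform_within_open[of "\<lambda>t. 0" _ _ "{-r<..<r}"])
      fix t assume "t \<in> {-r<..<r}"
      then have "c t \<odot> B \<odot> ainv (c t) \<in> \<gg>" using c(3) assms(2) by (intro Ad_in) auto
      then show "0 = w \<bullet> (c t \<odot> B \<odot> ainv (c t))" using w by (auto simp: inner_commute)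
    qed (use c(1) in auto)
    ultimately show "w \<bullet> (A \<odot> B - B \<odot> A) = 0" by (rule vector_derivative_unique_at)
  qed
  then show ?thesis using orthogonal_comp_self[OF subspace_liealg] by simp
qed

lemma Ad_eq: 
  assumes "g \<in> S" "A \<in> \<gg>"
  shows "Ad G g A = g \<odot> A \<odot> ainv g"
proof -
  have "((\<lambda>h. g \<odot> h \<odot> ainv g) has_derivative (\<lambda>v. g \<odot> v \<odot> ainv g)) (at e within S)"
    by (intro bounded_linear.has_derivative[OF bil.bounded_linear_left]
        bounded_linear.has_derivative[OF bil.bounded_linear_right] has_derivative_ident)
  from differential_tangent[OF this assms(2)] show ?thesis
    using assms(1) by (simp add: Ad_def)
qed

lemma maurer_cartan_eq:
  assumes "g \<in> S" "v \<in> tangent_space S g"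
  shows "maurer_cartan G g v = ainv g \<odot> v"
proof -
  have "((\<lambda>h. ainv g \<odot> h) has_derivative (\<lambda>v. ainv g \<odot> v)) (at g within S)"
    by (intro bounded_linear.has_derivative[OF bil.bounded_linear_right] has_derivative_ident)
  from differential_tangent[OF this assms(2)] show ?thesis
    using assms(1) by (simp add: maurer_cartan_def)
qed

lemma lie_bracket_eq:
  assumes "A \<in> \<gg>" "B \<in> \<gg>"
  shows "lie_bracket G A B = A \<odot> B - B \<odot> A"
proof -
  have "lie_bracket G A B = differential S (\<lambda>g. g \<odot> B \<odot> ainv g) e A"
    unfolding lie_bracket_def using differential_cong[of e S "\<lambda>g. Ad G g B"] by (simp add: Ad_eq assms(2))
  also have "\<dots> = A \<odot> B - B \<odot> A"
    by (rule differential_eqI[OF _ assms(1) bracket_curve]) (intro smooth_intros, auto)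
  finally show ?thesis .
qed

end

section \<open>The flat model on a set of cosets\<close>

text \<open>\<open>P\<close> preserves the image of the idempotent \<open>E\<close>, and \<open>X \<mapsto> e + X\<close> embeds \<open>H\<close> as the opposite
  abelian unipotent group. The element \<open>g\<close> lies in the big cell \<open>(e + H) \<odot> P\<close> iff
  \<open>E \<odot> g \<odot> E + (e - E)\<close> is a unit.\<close>

locale flat_parabolic = unit_group +
  fixes E :: 'a and P H :: "'a set" and M :: "'a set set" and T :: "'a set"
  assumes idem [simp]: "E \<odot> E = E"
    and P_eq: "P = {g \<in> S. (e - E) \<odot> (g \<odot> E) = 0}"
    and P_inv: "p \<in> P \<Longrightarrow> ainv p \<in> P"
    and H_eq: "H = {X. (e - E) \<odot> (X \<odot> E) = X \<and> e + X \<in> S}"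
    and H_sub: "subspace H"
    and cell: "g \<in> S \<Longrightarrow> unit (E \<odot> (g \<odot> E) + (e - E)) \<Longrightarrow>
        e + (e - E) \<odot> (g \<odot> (E \<odot> ainv (E \<odot> (g \<odot> E) + (e - E)))) \<in> S"
    and M_sub: "M \<subseteq> lcosets\<^bsub>G\<^esub> P"
    and T_eq: "T = {g \<in> S. g <#\<^bsub>G\<^esub> P \<in> M}"
    and T_open: "openin (top_of_set S) T"
    and common_cell: "g1 \<in> T \<Longrightarrow> g2 \<in> T \<Longrightarrow>
        \<exists>u\<in>S. unit (E \<odot> ((ainv u \<odot> g1) \<odot> E) + (e - E)) \<and> unit (E \<odot> ((ainv u \<odot> g2) \<odot> E) + (e - E))
          \<and> connected {X \<in> H. u \<odot> (e + X) \<in> T}"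
begin

abbreviation \<X> :: "('a, 'a) geometry" where "\<X> \<equiv> flat_model_on G P M"

text \<open>In block form with respect to the image of \<open>E\<close> and its complement, with
  first column (a, c), \<open>k g\<close> is the diagonal matrix (a, 1) and \<open>\<xi> g\<close>
  has the single block \<open>c\<close> times the inverse of \<open>a\<close>. This is the
  coordinate of \<open>g\<close> in the big cell.\<close>

definition k :: "'a \<Rightarrow> 'a" where "k g = E \<odot> (g \<odot> E) + (e - E)"

definition \<xi> :: "'a \<Rightarrow> 'a" where "\<xi> g = (e - E) \<odot> (g \<odot> (E \<odot> ainv (k g)))"

lemma idem' [simp]: "E \<odot> (E \<odot> x) = E \<odot> x"
  by (simp flip: assoc)

lemma total_space_flat [simp]: "total_space \<X> = T" and right_act_flat [simp]: "right_act \<X> = mul"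
  and cartan_form_flat [simp]: "cartan_form \<X> = maurer_cartan G"
  by (auto simp: flat_model_on_def T_eq fun_eq_iff)

lemma T_S: "g \<in> T \<Longrightarrow> g \<in> S" and P_S: "p \<in> P \<Longrightarrow> p \<in> S"
  by (auto simp: T_eq P_eq)

lemma P_iff: "p \<in> S \<Longrightarrow> p \<in> P \<longleftrightarrow> p \<odot> E = E \<odot> (p \<odot> E)"
  by (auto simp: P_eq bil.diff_left)

lemma P_E: "p \<in> P \<Longrightarrow> E \<odot> (p \<odot> E) = p \<odot> E"
  using P_iff[OF P_S] by auto

lemma P_E': "p \<in> P \<Longrightarrow> E \<odot> (p \<odot> (E \<odot> x)) = p \<odot> (E \<odot> x)"
  using arg_cong[OF P_E, of p "\<lambda>y. y \<odot> x"] by (simp add: assoc)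

lemma e_P [simp]: "e \<in> P" by (simp add: P_eq bil.diff_left)

lemma mul_P [simp]: "p \<in> P \<Longrightarrow> q \<in> P \<Longrightarrow> p \<odot> q \<in> P"
  using P_E'[of p "q \<odot> E"] by (simp add: P_iff P_S assoc P_E)

lemma coset_eq_iff: "u \<in> S \<Longrightarrow> v \<in> S \<Longrightarrow> u <#\<^bsub>G\<^esub> P = v <#\<^bsub>G\<^esub> P \<longleftrightarrow> ainv u \<odot> v \<in> P"
proof
  assume u: "u \<in> S" and v: "v \<in> S"
  {
    assume "u <#\<^bsub>G\<^esub> P = v <#\<^bsub>G\<^esub> P"
    moreover have "v \<in> v <#\<^bsub>G\<^esub> P" using v by (auto simp: l_coset_def intro!: bexI[of _ e])
    ultimately have "v \<in> u <#\<^bsub>G\<^esub> P" by simp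
    then obtain p where "p \<in> P" "v = u \<odot> p" by (auto simp: l_coset_def)
    then show "ainv u \<odot> v \<in> P" using u by simp
  }
  assume p: "ainv u \<odot> v \<in> P"
  have "v \<odot> q \<in> u <#\<^bsub>G\<^esub> P" if "q \<in> P" for q
    using mul_P[OF p that] u by (force simp: l_coset_def assoc intro: bexI[of _ "ainv u \<odot> v \<odot> q"])
  moreover have "u \<odot> q \<in> v <#\<^bsub>G\<^esub> P" if "q \<in> P" for q
  proof -
    have "u \<odot> q = v \<odot> (ainv (ainv u \<odot> v) \<odot> q)"
      using u v by (simp add: ainv_mul unit_ainv ainv_ainv assoc)
    then show ?thesis using mul_P[OF P_inv[OF p] that] by (force simp: l_coset_def)
  qed
  ultimately show "u <#\<^bsub>G\<^esub> P = v <#\<^bsub>G\<^esub> P" by (auto simp: l_coset_def)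
qed

lemma T_P: "u \<in> T \<Longrightarrow> p \<in> P \<Longrightarrow> u \<odot> p \<in> T"
  using coset_eq_iff[of u "u \<odot> p"] by (auto simp: T_eq P_S)

lemma T_P_iff: "u \<in> S \<Longrightarrow> p \<in> P \<Longrightarrow> u \<odot> p \<in> T \<longleftrightarrow> u \<in> T"
  using T_P[of u p] T_P[of "u \<odot> p" "ainv p"] by (auto simp: P_inv P_S assoc ainv)

lemma H_S: "X \<in> H \<Longrightarrow> e + X \<in> S"
  by (simp add: H_eq)

lemma H_alg:
  assumes "X \<in> H"
  shows "E \<odot> X = 0" "X \<odot> E = X" "X \<odot> X = 0" "E \<odot> (X \<odot> y) = 0" "X \<odot> (E \<odot> y) = X \<odot> y" "X \<odot> (X \<odot> y) = 0"
proof -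
  have X: "X = (e - E) \<odot> (X \<odot> E)" using assms by (simp add: H_eq)
  show 1: "E \<odot> X = 0" by (subst X) (simp add: distribs flip: assoc)
  show 2: "X \<odot> E = X" by (subst (1 2) X) (simp add: assoc)
  show 3: "X \<odot> X = 0" using 1 2 by (metis assoc bil.zero_right)
  show "E \<odot> (X \<odot> y) = 0" "X \<odot> (E \<odot> y) = X \<odot> y" "X \<odot> (X \<odot> y) = 0"
    using 1 2 3 by (metis assoc bil.zero_left)+
qed

lemma ainv_H: "X \<in> H \<Longrightarrow> ainv (e + X) = e - X"
  by (rule ainv_eqI) (simp_all add: distribs H_alg)

lemma k_e [simp]: "k e = e" by (simp add: k_def)

text \<open>On block triangular elements the leading block is multiplicative.\<close>

lemma k_P: 
  assumes "p \<in> P"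
  shows "k p \<odot> k (ainv p) = e"
  using assms P_E'[OF assms] P_E[OF P_inv[OF assms]] P_E[OF assms]
  by (simp add: k_def distribs assoc P_S)

lemma unit_k_P: "p \<in> P \<Longrightarrow> unit (k p)"
  using k_P[of p] k_P[of "ainv p"] by (intro unitI[of _ "k (ainv p)"]) (simp_all add: P_inv ainv_ainv P_S)

lemma \<xi>_mul:
  assumes X: "X \<in> H" and p: "p \<in> P"
  shows "unit (k ((e + X) \<odot> p))" "\<xi> ((e + X) \<odot> p) = X"
proof -
  have k: "k ((e + X) \<odot> p) = k p" by (simp add: k_def distribs assoc H_alg[OF X])
  with unit_k_P[OF p] show u: "unit (k ((e + X) \<odot> p))" by simp
  have E: "E \<odot> k p = p \<odot> E" using P_E[OF p] by (simp add: k_def distribs assoc)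
  have "(e - E) \<odot> ((e + X) \<odot> p \<odot> (E \<odot> y)) = X \<odot> (k p \<odot> (E \<odot> y))" for y
  proof -
    have "X \<odot> (k p \<odot> (E \<odot> y)) = X \<odot> (E \<odot> (k p \<odot> (E \<odot> y)))" by (simp add: H_alg[OF X])
    also have "\<dots> = X \<odot> (p \<odot> (E \<odot> y))" using arg_cong[OF E, of "\<lambda>z. z \<odot> (E \<odot> y)"] by (simp add: assoc)
    finally show ?thesis by (simp add: distribs assoc H_alg[OF X] P_E'[OF p])
  qed
  moreover have "X \<odot> (k p \<odot> (E \<odot> ainv (k p))) = X"
  proof -
    have "k p \<odot> E = E \<odot> k p" by (simp add: k_def distribs assoc)
    then have "k p \<odot> (E \<odot> ainv (k p)) = E \<odot> (k p \<odot> ainv (k p))" by (simp flip: assoc)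
    then show ?thesis using unit_k_P[OF p] by (simp add: ainv H_alg[OF X])
  qed
  ultimately show "\<xi> ((e + X) \<odot> p) = X" by (simp add: \<xi>_def k)
qed

text \<open>This is block LU factorization: subtracting \<open>\<xi> g\<close> times the first block
  row clears the lower left block, which leaves an element of \<open>P\<close>.\<close>

lemma cell_decomp:
  assumes g: "g \<in> S" "unit (k g)"
  shows "\<xi> g \<in> H" "(e - \<xi> g) \<odot> g \<in> P" "g = (e + \<xi> g) \<odot> ((e - \<xi> g) \<odot> g)"
proof -
  \<comment> \<open>The inverse of \<open>k g\<close> must be shown to respect the blocks as well,
    because \<open>\<xi> g\<close> has to end in \<open>E\<close> to lie in
    \<open>H\<close>.\<close>
  have comm: "k g \<odot> E = E \<odot> k g" by (simp add: k_def distribs assoc)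
  have "ainv (k g) \<odot> E = ainv (k g) \<odot> (E \<odot> (k g \<odot> ainv (k g)))" using g(2) by (simp add: ainv)
  also have "\<dots> = ainv (k g) \<odot> (k g \<odot> (E \<odot> ainv (k g)))" using comm by (simp flip: assoc)
  also have "\<dots> = E \<odot> ainv (k g)" using g(2) by simp
  finally have comm': "ainv (k g) \<odot> E = E \<odot> ainv (k g)" .
  show \<xi>H: "\<xi> g \<in> H"
    unfolding H_eq using cell[OF g(1)] g(2)
    by (simp add: \<xi>_def k_def[symmetric] assoc comm') (simp add: distribs assoc)
  show dec: "g = (e + \<xi> g) \<odot> ((e - \<xi> g) \<odot> g)"
    by (simp add: distribs H_alg[OF \<xi>H])
  have S: "(e - \<xi> g) \<odot> g \<in> S"
    using ainv_H[OF \<xi>H] ainv_S[OF H_S[OF \<xi>H]] g(1) by simp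
  have "\<xi> g \<odot> (g \<odot> E) = \<xi> g \<odot> (E \<odot> (g \<odot> E))" by (simp add: H_alg[OF \<xi>H])
  also have "E \<odot> (g \<odot> E) = k g \<odot> E" by (simp add: k_def distribs assoc)
  also have "\<xi> g \<odot> (k g \<odot> E) = (e - E) \<odot> (g \<odot> E)"
    using g(2) by (simp add: \<xi>_def assoc)
  finally have "(e - E) \<odot> (((e - \<xi> g) \<odot> g) \<odot> E) = 0"
    by (simp add: distribs assoc H_alg[OF \<xi>H])
  then show "(e - \<xi> g) \<odot> g \<in> P" using S by (simp add: P_eq)
qed

section \<open>Orbits, local trivializations and the topology of the base\<close>

lemma orbit_eq: "orbit P \<X> g = g <#\<^bsub>G\<^esub> P"
  by (auto simp: orbit_def l_coset_def)

lemma orbit_iff: "u \<in> S \<Longrightarrow> v \<in> S \<Longrightarrow> orbit P \<X> u = orbit P \<X> v \<longleftrightarrow> ainv u \<odot> v \<in> P"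
  by (simp add: orbit_eq coset_eq_iff)

lemma orbit_P: "u \<in> S \<Longrightarrow> p \<in> P \<Longrightarrow> orbit P \<X> (u \<odot> p) = orbit P \<X> u"
  using orbit_iff[of u "u \<odot> p"] by (simp add: P_S)

lemma continuous_mul [continuous_intros]:
  "continuous_on A f \<Longrightarrow> continuous_on A g \<Longrightarrow> continuous_on A (\<lambda>x. f x \<odot> g x)"
  by (rule bil.continuous_on)

lemma continuous_ainv [continuous_intros]:
  "continuous_on A f \<Longrightarrow> (\<And>x. x \<in> A \<Longrightarrow> unit (f x)) \<Longrightarrow> continuous_on A (\<lambda>x. ainv (f x))"
  using Ck_on_ainv[of 0] by (auto intro!: continuous_on_compose2[of "Collect unit" ainv])

lemma cell_open: "u \<in> S \<Longrightarrow> openin (top_of_set H) {X \<in> H. u \<odot> (e + X) \<in> T}"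
proof -
  assume u: "u \<in> S"
  have "openin (top_of_set H) (H \<inter> (\<lambda>X. u \<odot> (e + X)) -` T)"
    using u H_S by (intro continuous_openin_preimage[OF _ _ T_open]) (auto intro!: continuous_intros)
  moreover have "H \<inter> (\<lambda>X. u \<odot> (e + X)) -` T = {X \<in> H. u \<odot> (e + X) \<in> T}" by auto
  ultimately show ?thesis by simp
qed

lemma smooth_\<xi>:
  assumes "smooth_on A f" "\<And>x. x \<in> A \<Longrightarrow> unit (k (f x))"
  shows "smooth_on A (\<lambda>x. \<xi> (f x))"
proof -
  have "smooth_on A (\<lambda>x. k (f x))" unfolding k_def by (intro smooth_intros assms(1))
  then show ?thesis unfolding \<xi>_def by (intro smooth_intros assms)
qed

text \<open>The block LU factorization of \<open>ainv u \<odot> g\<close> inverts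
  \<open>\<psi>\<close>, and both of its factors depend smoothly on \<open>g\<close> as long as the
  leading block is a unit.\<close>

lemma local_trivialization:
  assumes u: "u \<in> T"
  defines "V \<equiv> {X \<in> H. u \<odot> (e + X) \<in> T}" and "U \<equiv> {g \<in> T. unit (k (ainv u \<odot> g))}"
    and "\<psi> \<equiv> \<lambda>(X, p). u \<odot> ((e + X) \<odot> p)"
  shows "openin (top_of_set H) V" "openin (top_of_set T) U" "u \<in> U" "diffeomorphism (V \<times> P) U \<psi>"
    "x \<in> V \<Longrightarrow> p \<in> P \<Longrightarrow> q \<in> P \<Longrightarrow> \<psi> (x, p) \<odot> q = \<psi> (x, p \<odot> q)"
proof -
  have uS: "u \<in> S" using u T_S by blast
  show "openin (top_of_set H) V" unfolding V_def by (rule cell_open[OF uS])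
  show "u \<in> U" using u uS by (simp add: U_def ainv)
  have "openin (top_of_set T) (T \<inter> (\<lambda>g. k (ainv u \<odot> g)) -` Collect unit)"
    by (rule continuous_openin_preimage_gen[OF _ open_units]) (auto simp: k_def intro!: continuous_intros)
  moreover have "T \<inter> (\<lambda>g. k (ainv u \<odot> g)) -` Collect unit = U" by (auto simp: U_def)
  ultimately show "openin (top_of_set T) U" by simp
  define \<phi> where "\<phi> g = (\<xi> (ainv u \<odot> g), (e - \<xi> (ainv u \<odot> g)) \<odot> (ainv u \<odot> g))" for g
  have \<psi>: "\<psi> z \<in> U" "\<phi> (\<psi> z) = z" if "z \<in> V \<times> P" for z
  proof -
    obtain X p where z: "z = (X, p)" "X \<in> H" "u \<odot> (e + X) \<in> T" "p \<in> P" using \<open>z \<in> _\<close> by (auto simp: V_def)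
    have a: "ainv u \<odot> \<psi> z = (e + X) \<odot> p" using z uS by (simp add: \<psi>_def)
    show "\<psi> z \<in> U"
      using T_P[OF z(3,4)] \<xi>_mul[OF z(2,4)] a by (simp add: U_def z(1) \<psi>_def assoc)
    show "\<phi> (\<psi> z) = z"
      unfolding \<phi>_def a \<xi>_mul[OF z(2,4)] by (simp add: z(1) distribs H_alg[OF z(2)] flip: assoc)
  qed
  have \<phi>: "\<phi> g \<in> V \<times> P" "\<psi> (\<phi> g) = g" if "g \<in> U" for g
  proof -
    have g: "g \<in> T" "ainv u \<odot> g \<in> S" "unit (k (ainv u \<odot> g))" using that uS T_S by (auto simp: U_def)
    note d = cell_decomp[OF g(2,3)]
    show eq: "\<psi> (\<phi> g) = g" unfolding \<phi>_def \<psi>_def using d(3) uS by simp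
    then have "u \<odot> (e + \<xi> (ainv u \<odot> g)) \<odot> ((e - \<xi> (ainv u \<odot> g)) \<odot> (ainv u \<odot> g)) \<in> T"
      using g(1) by (simp add: \<phi>_def \<psi>_def assoc)
    then have "u \<odot> (e + \<xi> (ainv u \<odot> g)) \<in> T" using T_P_iff[OF _ d(2)] uS H_S[OF d(1)] by simp
    then show "\<phi> g \<in> V \<times> P" using d by (simp add: \<phi>_def V_def)
  qed
  have bij: "bij_betw \<psi> (V \<times> P) U"
    by (rule bij_betw_byWitness[where f' = \<phi>]) (use \<phi> \<psi> in \<open>simp_all add: image_subset_iff\<close>)
  have inv: "inv_into (V \<times> P) \<psi> g = \<phi> g" if "g \<in> U" for g
    using \<phi>[OF that] bij by (intro inv_into_f_eq) (auto simp: bij_betw_def)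
  have "smooth_on (V \<times> P) (\<lambda>z. u \<odot> ((e + fst z) \<odot> snd z))"
    by (intro smooth_intros)
  then have "smooth_on (V \<times> P) \<psi>" by (simp add: \<psi>_def case_prod_beta')
  moreover have "smooth_on U \<phi>" unfolding \<phi>_def
    by (intro smooth_intros smooth_\<xi>) (auto simp: U_def)
  then have "smooth_on U (inv_into (V \<times> P) \<psi>)" using smooth_on_cong[of U "inv_into (V \<times> P) \<psi>" \<phi>, OF inv] by simp
  ultimately show "diffeomorphism (V \<times> P) U \<psi>" using bij by (simp add: diffeomorphism_def)
  show "x \<in> V \<Longrightarrow> p \<in> P \<Longrightarrow> q \<in> P \<Longrightarrow> \<psi> (x, p) \<odot> q = \<psi> (x, p \<odot> q)" by (simp add: \<psi>_def assoc)
qed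

lemma topspace_base: "topspace (base_topology P \<X>) = base P \<X>"
proof -
  have "{u \<in> T. orbit P \<X> u \<in> base P \<X>} = T" by (auto simp: base_def)
  then have "openin (base_topology P \<X>) (base P \<X>)" by (simp add: openin_base_topology)
  then show ?thesis unfolding topspace_def by (auto simp: openin_base_topology)
qed

text \<open>The saturation of \<open>A\<close> is a union of preimages of \<open>A\<close> under
  right translations, so the projection to the base is an open map.\<close>

lemma openin_orbits:
  assumes "openin (top_of_set T) A"
  shows "openin (base_topology P \<X>) (orbit P \<X> ` A)"
proof -
  have AT: "A \<subseteq> T" using assms openin_imp_subset by blast
  have "{u \<in> T. orbit P \<X> u \<in> orbit P \<X> ` A} = (\<Union>p\<in>P. T \<inter> (\<lambda>w. w \<odot> p) -` A)"
  proof (intro equalityI subsetI)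
    fix u assume "u \<in> {u \<in> T. orbit P \<X> u \<in> orbit P \<X> ` A}"
    then obtain a where a: "u \<in> T" "a \<in> A" "orbit P \<X> u = orbit P \<X> a" by auto
    then have "ainv u \<odot> a \<in> P" using AT T_S orbit_iff by blast
    then show "u \<in> (\<Union>p\<in>P. T \<inter> (\<lambda>w. w \<odot> p) -` A)"
      using a T_S by (auto intro!: bexI[of _ "ainv u \<odot> a"])
  next
    fix u assume "u \<in> (\<Union>p\<in>P. T \<inter> (\<lambda>w. w \<odot> p) -` A)"
    then obtain p where p: "p \<in> P" "u \<in> T" "u \<odot> p \<in> A" by auto
    then have "orbit P \<X> u = orbit P \<X> (u \<odot> p)" using orbit_P T_S by simp
    then show "u \<in> {u \<in> T. orbit P \<X> u \<in> orbit P \<X> ` A}" using p by blast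
  qed
  moreover have "openin (top_of_set T) (T \<inter> (\<lambda>w. w \<odot> p) -` A)" if "p \<in> P" for p
    by (intro continuous_openin_preimage[OF _ _ assms]) (auto intro!: continuous_intros simp: T_P that)
  then have "openin (top_of_set T) (\<Union>p\<in>P. T \<inter> (\<lambda>w. w \<odot> p) -` A)" by (intro openin_Union) blast
  ultimately have "openin (top_of_set T) {u \<in> T. orbit P \<X> u \<in> orbit P \<X> ` A}" by (simp only:)
  moreover have "orbit P \<X> ` A \<subseteq> base P \<X>" using AT by (auto simp: base_def)
  ultimately show ?thesis by (simp only: openin_base_topology total_space_flat)
qed

text \<open>Lying in the same orbit is a closed relation, the zero set of the continuous function
  \<open>?f\<close>. A product neighbourhood on which \<open>?f\<close> does not vanish projects to
  two disjoint open sets, since the projection is open.\<close>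

lemma Hausdorff_base: "Hausdorff_space (base_topology P \<X>)"
  unfolding Hausdorff_space_def topspace_base
proof (intro allI impI, elim conjE)
  fix x y assume "x \<in> base P \<X>" "y \<in> base P \<X>" "x \<noteq> y"
  then obtain u v where uv: "u \<in> T" "v \<in> T" "x = orbit P \<X> u" "y = orbit P \<X> v" by (auto simp: base_def)
  let ?f = "\<lambda>z. (e - E) \<odot> (ainv (fst z) \<odot> snd z \<odot> E)"
  have Piff: "ainv a \<odot> b \<in> P \<longleftrightarrow> ?f (a, b) = 0" if "a \<in> T" "b \<in> T" for a b
    using that by (simp add: P_eq T_S)
  have "continuous_on (T \<times> T) ?f"
    by (intro continuous_intros) (auto dest: T_S)
  then have "openin (top_of_set (T \<times> T)) ((T \<times> T) \<inter> ?f -` (- {0}))"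
    by (intro continuous_openin_preimage_gen) auto
  then obtain W where W: "open W" "(T \<times> T) \<inter> ?f -` (- {0}) = (T \<times> T) \<inter> W" by (auto simp: openin_open)
  have "ainv u \<odot> v \<notin> P" using \<open>x \<noteq> y\<close> uv orbit_iff T_S by blast
  then have "(u, v) \<in> (T \<times> T) \<inter> ?f -` (- {0})" using uv(1,2) Piff[OF uv(1,2)] by blast
  then have "(u, v) \<in> W" unfolding W(2) by blast
  then obtain A B where AB: "open A" "open B" "u \<in> A" "v \<in> B" "A \<times> B \<subseteq> W"
    using W(1) by (metis mem_Sigma_iff open_prod_elim)
  have op: "openin (top_of_set T) (T \<inter> A)" "openin (top_of_set T) (T \<inter> B)"
    using AB by (auto simp: openin_open)
  have "orbit P \<X> a \<noteq> orbit P \<X> b" if "a \<in> T \<inter> A" "b \<in> T \<inter> B" for a b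
  proof -
    have "(a, b) \<in> (T \<times> T) \<inter> W" using that AB by auto
    then have "(a, b) \<in> (T \<times> T) \<inter> ?f -` (- {0})" by (simp only: W(2))
    then have "?f (a, b) \<noteq> 0" by blast
    then show ?thesis using Piff that orbit_iff T_S by (metis IntD1)
  qed
  then have "disjnt (orbit P \<X> ` (T \<inter> A)) (orbit P \<X> ` (T \<inter> B))"
    unfolding disjnt_iff by blast
  then show "\<exists>U V. openin (base_topology P \<X>) U \<and> openin (base_topology P \<X>) V \<and> x \<in> U \<and> y \<in> V \<and> disjnt U V"
    using openin_orbits[OF op(1)] openin_orbits[OF op(2)] uv AB by blast
qed

lemma principal: "principal_bundle G P \<X>"
proof -
  have "smooth_on (T \<times> P) (\<lambda>z. fst z \<odot> snd z)" by (intro smooth_intros)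
  then have "smooth_on (T \<times> P) (\<lambda>(u, p). u \<odot> p)" by (simp add: case_prod_beta')
  moreover have "\<exists>(H::'a set) V U \<psi>. subspace H \<and> openin (top_of_set H) V \<and>
        openin (top_of_set T) U \<and> u \<in> U \<and> diffeomorphism (V \<times> P) U \<psi> \<and>
        (\<forall>x\<in>V. \<forall>p\<in>P. \<forall>q\<in>P. \<psi> (x, p) \<odot> q = \<psi> (x, p \<odot> q))" if "u \<in> T" for u
    using H_sub local_trivialization[OF that] by blast
  ultimately show ?thesis
    unfolding principal_bundle_def using Hausdorff_base by (simp add: T_P assoc)
qed

lemma common_cell':
  assumes "g1 \<in> T" "g2 \<in> T"
  obtains u X1 X2 p1 p2 where "u \<in> S" "connected {X \<in> H. u \<odot> (e + X) \<in> T}"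
    "X1 \<in> H" "u \<odot> (e + X1) \<in> T" "p1 \<in> P" "g1 = u \<odot> (e + X1) \<odot> p1"
    "X2 \<in> H" "u \<odot> (e + X2) \<in> T" "p2 \<in> P" "g2 = u \<odot> (e + X2) \<odot> p2"
proof -
  obtain u where u: "u \<in> S" "unit (k (ainv u \<odot> g1))" "unit (k (ainv u \<odot> g2))"
    "connected {X \<in> H. u \<odot> (e + X) \<in> T}"
    using common_cell[OF assms] unfolding k_def by blast
  have *: "\<exists>X p. X \<in> H \<and> u \<odot> (e + X) \<in> T \<and> p \<in> P \<and> g = u \<odot> (e + X) \<odot> p" if "g \<in> T" "unit (k (ainv u \<odot> g))" for g
  proof -
    have gS: "ainv u \<odot> g \<in> S" using u(1) that T_S by simp
    note d = cell_decomp[OF gS that(2)]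
    let ?X = "\<xi> (ainv u \<odot> g)" and ?p = "(e - \<xi> (ainv u \<odot> g)) \<odot> (ainv u \<odot> g)"
    have "u \<odot> (ainv u \<odot> g) = u \<odot> ((e + ?X) \<odot> ?p)" by (rule arg_cong[OF d(3)])
    then have eq: "g = u \<odot> (e + ?X) \<odot> ?p" using u(1) by (simp add: assoc)
    moreover have "u \<odot> (e + ?X) \<in> T"
      using T_P_iff[OF _ d(2), of "u \<odot> (e + ?X)"] eq that(1) u(1) H_S[OF d(1)] by simp
    ultimately show ?thesis using d(1,2) by blast
  qed
  show ?thesis using *[OF assms(1) u(2)] *[OF assms(2) u(3)] u(1,4) that by blast
qed

text \<open>Points from the two halves of a separation lie in one cell, whose part over the base is
  connected; pulling the halves back would separate it.\<close>

lemma connected_base: "connected_space (base_topology P \<X>)"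
  unfolding connected_space_def topspace_base
proof clarify
  fix A B x y
  assume A: "openin (base_topology P \<X>) A" and B: "openin (base_topology P \<X>) B"
    and cov: "base P \<X> \<subseteq> A \<union> B" and dis: "A \<inter> B = {}" and x: "A \<noteq> {}" and y: "B \<noteq> {}"
  from x A obtain g1 where g1: "g1 \<in> T" "orbit P \<X> g1 \<in> A" by (auto simp: openin_base_topology base_def)
  from y B obtain g2 where g2: "g2 \<in> T" "orbit P \<X> g2 \<in> B" by (auto simp: openin_base_topology base_def)
  obtain u X1 X2 p1 p2 where u: "u \<in> S" "connected {X \<in> H. u \<odot> (e + X) \<in> T}"
    "X1 \<in> H" "u \<odot> (e + X1) \<in> T" "p1 \<in> P" "g1 = u \<odot> (e + X1) \<odot> p1"
    "X2 \<in> H" "u \<odot> (e + X2) \<in> T" "p2 \<in> P" "g2 = u \<odot> (e + X2) \<odot> p2"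
    by (rule common_cell'[OF g1(1) g2(1)])
  let ?D = "{X \<in> H. u \<odot> (e + X) \<in> T}"
  let ?q = "\<lambda>X. orbit P \<X> (u \<odot> (e + X))"
  have op: "openin (top_of_set ?D) {X \<in> ?D. ?q X \<in> C}" if C: "openin (base_topology P \<X>) C" for C
  proof -
    have "openin (top_of_set T) {w \<in> T. orbit P \<X> w \<in> C}" using C by (simp add: openin_base_topology)
    then have "openin (top_of_set ?D) (?D \<inter> (\<lambda>X. u \<odot> (e + X)) -` {w \<in> T. orbit P \<X> w \<in> C})"
      by (rule continuous_openin_preimage[rotated 2]) (auto intro!: continuous_intros)
    moreover have "?D \<inter> (\<lambda>X. u \<odot> (e + X)) -` {w \<in> T. orbit P \<X> w \<in> C} = {X \<in> ?D. ?q X \<in> C}" by auto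
    ultimately show ?thesis by simp
  qed
  have "?D \<subseteq> {X \<in> ?D. ?q X \<in> A} \<union> {X \<in> ?D. ?q X \<in> B}" using cov by (auto simp: base_def)
  moreover have "{X \<in> ?D. ?q X \<in> A} \<inter> {X \<in> ?D. ?q X \<in> B} = {}" using dis by auto
  moreover have "X1 \<in> {X \<in> ?D. ?q X \<in> A}" "X2 \<in> {X \<in> ?D. ?q X \<in> B}"
    using u g1 g2 orbit_P[OF T_S] by auto
  ultimately show False
    using u(2) op[OF A] op[OF B] unfolding connected_openin by blast
qed

section \<open>The Cartan connection and its curvature\<close>

lemma tangent_T: "u \<in> T \<Longrightarrow> tangent_space T u = tangent_space S u"
  by (rule tangent_space_openin[OF T_open])

lemma mc_eq: "u \<in> T \<Longrightarrow> v \<in> tangent_space T u \<Longrightarrow> maurer_cartan G u v = ainv u \<odot> v"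
  by (simp add: tangent_T maurer_cartan_eq T_S)

lemma tangent_T_iff: "u \<in> T \<Longrightarrow> v \<in> tangent_space T u \<longleftrightarrow> ainv u \<odot> v \<in> \<gg>"
  using tangent_iff[OF T_S, of u v] tangent_T[of u] by simp

lemma cartan: "cartan_connection G P \<X>"
  unfolding cartan_connection_def Let_def total_space_flat cartan_form_flat right_act_flat carrier_G one_G
proof (intro conjI ballI allI)
  have "smooth_on (SIGMA u:T. tangent_space T u) (\<lambda>z. ainv (fst z) \<odot> snd z)"
    by (intro smooth_intros) (auto dest: T_S)
  then show "smooth_on (SIGMA u:T. tangent_space T u) (\<lambda>(u, v). maurer_cartan G u v)"
    by (subst smooth_on_cong[where g = "\<lambda>z. ainv (fst z) \<odot> snd z"]) (auto simp: mc_eq)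
next
  fix u v w a b assume u: "u \<in> T" and vw: "v \<in> tangent_space T u" "w \<in> tangent_space T u"
  have "a *\<^sub>R v + b *\<^sub>R w \<in> tangent_space T u"
    using u vw subspace_liealg by (simp add: tangent_T_iff distribs bil.scaleR_right subspace_add subspace_scale)
  then show "maurer_cartan G u (a *\<^sub>R v + b *\<^sub>R w) = a *\<^sub>R maurer_cartan G u v + b *\<^sub>R maurer_cartan G u w"
    using u vw by (simp add: mc_eq distribs bil.scaleR_right)
next
  fix u assume u: "u \<in> T"
  show "bij_betw (maurer_cartan G u) (tangent_space T u) \<gg>"
    by (rule bij_betw_byWitness[where f' = "\<lambda>A. u \<odot> A"])
      (use T_S[OF u] tangent_T_iff[OF u] in \<open>simp_all add: mc_eq[OF u] image_subset_iff\<close>)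
next
  fix u p v assume u: "u \<in> T" and p: "p \<in> P" and v: "v \<in> tangent_space T u"
  have pS: "p \<in> S" using p P_S by blast
  have d: "differential T (\<lambda>w. w \<odot> p) u v = v \<odot> p"
    by (rule differential_tangent[OF _ v])
      (intro bounded_linear.has_derivative[OF bil.bounded_linear_left] has_derivative_ident)
  have "v \<odot> p \<in> tangent_space T (u \<odot> p)"
    using tangent_translate(2)[OF pS] v u T_P[OF u p] by (simp add: tangent_T)
  then show "maurer_cartan G (u \<odot> p) (differential T (\<lambda>w. w \<odot> p) u v) = Ad G (inv\<^bsub>G\<^esub> p) (maurer_cartan G u v)"
    using u p v pS T_S[OF u] by (simp add: d mc_eq T_P Ad_eq tangent_T_iff[symmetric] ainv_mul ainv_ainv assoc)
next
  fix u A assume u: "u \<in> T" and A: "A \<in> tangent_space P e"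
  have d: "differential P (mul u) e A = u \<odot> A"
    by (rule differential_tangent[OF _ A])
      (rule bounded_linear_imp_has_derivative[OF bil.bounded_linear_right])
  have "A \<in> \<gg>" using A tangent_space_mono[of P S] P_S by blast
  then show "maurer_cartan G u (differential P (mul u) e A) = A"
    using u T_S[OF u] by (simp add: d mc_eq tangent_T_iff)
qed

lemma constant_field_eq:
  assumes "u \<in> T" "A \<in> \<gg>"
  shows "constant_field \<X> A u = u \<odot> A"
proof -
  have uA: "u \<odot> A \<in> tangent_space T u" using assms T_S by (simp add: tangent_T_iff)
  have "inj_on (maurer_cartan G u) (tangent_space T u)"
    using cartan assms(1) unfolding cartan_connection_def Let_def by (auto simp: bij_betw_def)
  then show ?thesis
    unfolding constant_field_def
    by (simp, intro inv_into_f_eq) (use uA assms T_S in \<open>auto simp: mc_eq\<close>)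
qed

text \<open>The constant fields are the left-invariant fields \<open>w \<odot> A\<close>, and the
  commutator of two of them is the left-invariant field of the bracket. This is the Maurer-Cartan
  equation.\<close>

lemma curvature_zero:
  assumes u: "u \<in> T" and A: "A \<in> \<gg>" and B: "B \<in> \<gg>"
  shows "curvature G \<X> u A B = 0"
proof -
  have uS: "u \<in> S" using u T_S by blast
  have d: "differential T (constant_field \<X> B) u (u \<odot> A) = u \<odot> A \<odot> B" if "A \<in> \<gg>" "B \<in> \<gg>" for A B
  proof -
    have "differential T (constant_field \<X> B) u = differential T (\<lambda>w. w \<odot> B) u"
      by (rule differential_cong) (use u that in \<open>auto simp: constant_field_eq\<close>)
    moreover have "differential T (\<lambda>w. w \<odot> B) u (u \<odot> A) = u \<odot> A \<odot> B"
      by (rule differential_tangent)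
        (use u uS that in \<open>auto simp: tangent_T_iff intro: bounded_linear_imp_has_derivative[OF bil.bounded_linear_left]\<close>)
    ultimately show ?thesis by simp
  qed
  have "u \<odot> A \<odot> B - u \<odot> B \<odot> A = u \<odot> (A \<odot> B - B \<odot> A)" by (simp add: distribs assoc)
  moreover have "u \<odot> (A \<odot> B - B \<odot> A) \<in> tangent_space T u"
    using u uS bracket_in[OF A B] by (simp add: tangent_T_iff)
  ultimately show ?thesis
    using u uS A B by (simp add: curvature_def constant_field_eq d mc_eq lie_bracket_eq)
qed

lemma normal: "normal_geometry G P \<beta> \<X>"
  unfolding normal_geometry_def Let_def
proof (intro allI impI ballI, elim conjE)
  fix n :: nat and Y Z u A
  assume YZ: "\<forall>i<n. Y i \<in> lie_algebra G \<and> Z i \<in> {Z \<in> lie_algebra G. \<forall>B\<in>tangent_space P \<one>\<^bsub>G\<^esub>. \<beta> Z B = 0}"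
    and u: "u \<in> total_space \<X>" and A: "A \<in> lie_algebra G"
  have "2 *\<^sub>R lie_bracket G (Z i) (curvature G \<X> u A (Y i)) - curvature G \<X> u (lie_bracket G (Z i) A) (Y i) = 0"
    if "i < n" for i
  proof -
    have Y: "Y i \<in> \<gg>" and Z: "Z i \<in> \<gg>" using YZ that by auto
    \<comment> \<open>The bracket formula applies only to elements of the Lie algebra, and the
      bracket with the vanishing curvature has to be evaluated.\<close>
    have 0: "0 \<in> \<gg>" using subspace_liealg subspace_0 by blast
    show ?thesis
      using u A Y Z 0 by (simp add: curvature_zero lie_bracket_eq bracket_in)
  qed
  then show "(\<Sum>i<n. 2 *\<^sub>R lie_bracket G (Z i) (curvature G \<X> u A (Y i)) -
                      curvature G \<X> u (lie_bracket G (Z i) A) (Y i)) = 0"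
    by (intro sum.neutral) auto
qed

theorem parabolic: "parabolic_geometry G P \<beta> \<X>"
  using principal connected_base cartan normal by (simp add: parabolic_geometry_def)

end

section \<open>Automorphisms and symmetries of the flat model\<close>

context flat_parabolic
begin

lemma left_mult_automorphism:
  assumes b: "b \<in> S" and bT: "(\<lambda>g. b \<odot> g) ` T = T"
  shows "automorphism P \<X> (\<lambda>g. b \<odot> g)"
proof -
  have mem: "b \<odot> g \<in> T" if "g \<in> T" for g using bT that by blast
  have mem': "ainv b \<odot> g \<in> T" if g: "g \<in> T" for g
  proof -
    obtain h where "h \<in> T" "g = b \<odot> h" using bT g by blast
    then show ?thesis using b by simp
  qed
  have bij: "bij_betw (\<lambda>g. b \<odot> g) T T"
    by (rule bij_betw_byWitness[where f' = "\<lambda>g. ainv b \<odot> g"]) (use b mem mem' in auto)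
  have inv: "inv_into T (\<lambda>g. b \<odot> g) g = ainv b \<odot> g" if "g \<in> T" for g
    using bij mem' that b by (intro inv_into_f_eq) (auto simp: bij_betw_def)
  have "smooth_on T (inv_into T (\<lambda>g. b \<odot> g))"
    by (subst smooth_on_cong[OF inv]) (assumption, intro smooth_intros)
  then have "diffeomorphism T T (\<lambda>g. b \<odot> g)"
    using bij by (auto simp: diffeomorphism_def intro!: smooth_intros)
  moreover have "maurer_cartan G (b \<odot> u) (differential T (\<lambda>g. b \<odot> g) u v) = maurer_cartan G u v"
    if u: "u \<in> T" and v: "v \<in> tangent_space T u" for u v
  proof -
    have d: "differential T (\<lambda>g. b \<odot> g) u v = b \<odot> v"
      by (rule differential_tangent[OF _ v])
        (rule bounded_linear_imp_has_derivative[OF bil.bounded_linear_right])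
    have "b \<odot> v \<in> tangent_space T (b \<odot> u)"
      using tangent_translate(1)[OF b, of v u] v u mem by (simp add: tangent_T)
    then show ?thesis using u v b mem T_S[OF u] by (simp add: d mc_eq ainv_mul assoc)
  qed
  ultimately show ?thesis by (simp add: automorphism_def assoc)
qed

lemma line_in_cell:
  assumes u: "u \<in> S" and Z: "Z \<in> H" "u \<odot> (e + Z) \<in> T" and Y: "Y \<in> H"
  obtains r where "r > 0" "\<And>t. \<bar>t\<bar> < r \<Longrightarrow> u \<odot> (e + (Z + t *\<^sub>R Y)) \<in> T"
proof -
  have mem: "Z + t *\<^sub>R Y \<in> H" for t using H_sub Z Y by (simp add: subspace_add subspace_scale)
  have "openin (top_of_set UNIV) (UNIV \<inter> (\<lambda>t. u \<odot> (e + (Z + t *\<^sub>R Y))) -` T)"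
    using u mem H_S by (intro continuous_openin_preimage[OF _ _ T_open]) (auto intro!: continuous_intros)
  then have "open {t. u \<odot> (e + (Z + t *\<^sub>R Y)) \<in> T}" by (simp add: vimage_def)
  moreover have "0 \<in> {t. u \<odot> (e + (Z + t *\<^sub>R Y)) \<in> T}" using Z by simp
  ultimately obtain r where "r > 0" "ball 0 r \<subseteq> {t. u \<odot> (e + (Z + t *\<^sub>R Y)) \<in> T}" using openE by blast
  then show ?thesis using that[of r] by (auto simp: subset_iff)
qed

lemma line_smooth:
  "smooth_on A (\<lambda>t::real. u \<odot> (e + (Z + t *\<^sub>R Y)))"
  "((\<lambda>t. u \<odot> (e + (Z + t *\<^sub>R Y))) has_vector_derivative u \<odot> Y) (at t0)"
proof -
  show "smooth_on A (\<lambda>t::real. u \<odot> (e + (Z + t *\<^sub>R Y)))"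
    by (intro smooth_intros smooth_on_bilinear[OF bounded_bilinear_scaleR])
  have "((\<lambda>t. e + (Z + t *\<^sub>R Y)) has_vector_derivative Y) (at t0)"
    by (auto intro!: derivative_eq_intros)
  then show "((\<lambda>t. u \<odot> (e + (Z + t *\<^sub>R Y))) has_vector_derivative u \<odot> Y) (at t0)"
    by (rule curve_left)
qed

text \<open>Liouville's theorem: an automorphism \<open>\<Phi>\<close> preserves the Maurer--Cartan form, so
  \<open>\<Phi> g \<odot> ainv g\<close> has vanishing derivative along the lines in every cell; it is also invariant
  under \<open>P\<close>.\<close>

lemma automorphism_left_mult:
  assumes \<Phi>: "automorphism P \<X> \<Phi>"
  obtains b where "b \<in> S" "\<And>u. u \<in> T \<Longrightarrow> \<Phi> u = b \<odot> u" "(\<lambda>g. b \<odot> g) ` T = T"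
proof -
  have bij: "bij_betw \<Phi> T T" and sm: "smooth_on T \<Phi>"
    and eqv: "\<And>u p. u \<in> T \<Longrightarrow> p \<in> P \<Longrightarrow> \<Phi> (u \<odot> p) = \<Phi> u \<odot> p"
    and mc: "\<And>u v. u \<in> T \<Longrightarrow> v \<in> tangent_space T u \<Longrightarrow>
      maurer_cartan G (\<Phi> u) (differential T \<Phi> u v) = maurer_cartan G u v"
    using \<Phi> by (auto simp: automorphism_def diffeomorphism_def)
  have \<Phi>T: "\<Phi> g \<in> T" if "g \<in> T" for g using bij that by (auto simp: bij_betw_def)
  define \<Psi> where "\<Psi> g = \<Phi> g \<odot> ainv g" for g
  have \<Psi>P: "\<Psi> (g \<odot> p) = \<Psi> g" if "g \<in> T" "p \<in> P" for g p
    using that T_S P_S by (simp add: \<Psi>_def eqv ainv_mul assoc)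
  have zero: "((\<lambda>t. \<Psi> (u \<odot> (e + (Z + t *\<^sub>R Y)))) has_vector_derivative 0) (at t0)"
    if u: "u \<in> S" and Z: "Z \<in> H" and Y: "Y \<in> H" and Z': "u \<odot> (e + (Z + t0 *\<^sub>R Y)) \<in> T" for u Z Y t0
  proof -
    let ?Z = "Z + t0 *\<^sub>R Y"
    have ZH: "?Z \<in> H" using H_sub Z Y by (simp add: subspace_add subspace_scale)
    define c where "c t = u \<odot> (e + (?Z + t *\<^sub>R Y))" for t
    have c0: "c 0 \<in> T" using Z' by (simp add: c_def)
    obtain r where r: "r > 0" "\<And>t. \<bar>t\<bar> < r \<Longrightarrow> c t \<in> T"
      unfolding c_def using line_in_cell[OF u ZH Z' Y] by blast
    have c: "c ` {-r<..<r} \<subseteq> T" "smooth_on {-r<..<r} c" "(c has_vector_derivative u \<odot> Y) (at 0)"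
      using r(2) line_smooth unfolding c_def by (auto simp: abs_less_iff)
    let ?g = "c 0" and ?v = "u \<odot> Y"
    have v: "?v \<in> tangent_space T ?g"
      using tangent_spaceI[OF r(1) c(2,1) refl c(3)] .
    let ?w = "differential T \<Phi> ?g ?v"
    have w: "((\<lambda>t. \<Phi> (c t)) has_vector_derivative ?w) (at 0)"
      by (rule differential_curve[OF sm r(1) c])
    have wT: "?w \<in> tangent_space T (\<Phi> ?g)"
      by (rule differential_tangent_space[OF sm _ v]) (use \<Phi>T in blast)
    have gS: "?g \<in> S" "\<Phi> ?g \<in> S" using c0 \<Phi>T T_S by auto
    have "ainv (\<Phi> ?g) \<odot> ?w = ainv ?g \<odot> ?v" using mc[OF c0 v] mc_eq[OF \<Phi>T[OF c0] wT] mc_eq[OF c0 v] by simp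
    then have "\<Phi> ?g \<odot> (ainv (\<Phi> ?g) \<odot> ?w) = \<Phi> ?g \<odot> (ainv ?g \<odot> ?v)" by simp
    \<comment> \<open>Preservation of the form expresses the velocity of the image curve by that of
      the original curve; with this value the two terms in the product rule for
      \<open>\<Psi>\<close> cancel.\<close>
    then have w_eq: "?w = \<Phi> ?g \<odot> (ainv ?g \<odot> ?v)" using gS by simp
    have "((\<lambda>t. ainv (c t)) has_vector_derivative - (ainv ?g \<odot> ?v \<odot> ainv ?g)) (at 0)"
      using has_vector_derivative_chain_within[of ainv "\<lambda>v. - (ainv ?g \<odot> v \<odot> ainv ?g)" c UNIV 1 ?v]
        ainv_has_derivative[of ?g] gS c(3) by simp
    from bil.has_vector_derivative[OF w this]
    \<comment> \<open>The auxiliary curve starts at time 0; a time shift moves the result to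
      \<open>t0\<close>.\<close>
    have "((\<lambda>t. \<Psi> (c t)) has_vector_derivative 0) (at (t0 - t0))"
      by (simp add: \<Psi>_def w_eq bil.minus_right assoc)
    then have "((\<lambda>t. \<Psi> (c t)) has_vector_derivative 0) (at ((\<lambda>t. t - t0) t0))" by simp
    moreover have "((\<lambda>t. t - t0) has_vector_derivative 1) (at t0)"
      by (auto intro!: derivative_eq_intros)
    ultimately have "((\<lambda>t. \<Psi> (c t)) \<circ> (\<lambda>t. t - t0) has_vector_derivative 1 *\<^sub>R 0) (at t0)"
      by (intro vector_diff_chain_at)
    then show ?thesis by (simp add: o_def c_def algebra_simps)
  qed
  have loc: "\<Psi> (u \<odot> (e + X)) = \<Psi> (u \<odot> (e + Y))"
    if u: "u \<in> S" and con: "connected {X \<in> H. u \<odot> (e + X) \<in> T}"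
      and X: "X \<in> H" "u \<odot> (e + X) \<in> T" and Y: "Y \<in> H" "u \<odot> (e + Y) \<in> T" for u X Y
  proof (rule connected_local_const[OF con, where f = "\<lambda>X. \<Psi> (u \<odot> (e + X))"])
    let ?D = "{X \<in> H. u \<odot> (e + X) \<in> T}"
    show "\<forall>X\<in>?D. \<forall>\<^sub>F Y in at X within ?D. \<Psi> (u \<odot> (e + X)) = \<Psi> (u \<odot> (e + Y))"
    proof
      fix X assume X: "X \<in> ?D"
      obtain W where W: "open W" "?D = H \<inter> W" using cell_open[OF u] by (auto simp: openin_open)
      \<comment> \<open>A small ball in the linear space \<open>H\<close> is convex, so
        \<open>\<Psi>\<close> can be followed along the segment from \<open>X\<close> to
        \<open>Y\<close> without leaving \<open>T\<close>.\<close>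
      obtain r where r: "r > 0" "ball X r \<subseteq> W" using W X openE by blast
      have "\<Psi> (u \<odot> (e + X)) = \<Psi> (u \<odot> (e + Y))" if Y: "Y \<in> H" "dist Y X < r" for Y
      proof -
        have YX: "Y - X \<in> H" using Y X H_sub by (simp add: subspace_diff)
        have seg: "u \<odot> (e + (X + t *\<^sub>R (Y - X))) \<in> T" if "t \<in> {0..1}" for t
        proof -
          have "X + t *\<^sub>R (Y - X) \<in> H" using X YX H_sub by (simp add: subspace_add subspace_scale)
          moreover have "dist X (X + t *\<^sub>R (Y - X)) < r"
          proof -
            have "dist X (X + t *\<^sub>R (Y - X)) = \<bar>t\<bar> * dist Y X" by (simp add: dist_norm)
            also have "\<dots> \<le> 1 * dist Y X" using that by (intro mult_right_mono) auto
            finally show ?thesis using Y by simp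
          qed
          ultimately have "X + t *\<^sub>R (Y - X) \<in> ?D" using r(2) W(2) by auto
          then show ?thesis by simp
        qed
        have "\<exists>k. \<forall>t\<in>{0..1::real}. \<Psi> (u \<odot> (e + (X + t *\<^sub>R (Y - X)))) = k"
        proof (rule has_vector_derivative_zero_constant)
          fix t :: real assume t: "t \<in> {0..1}"
          have "X \<in> H" using X by simp
          from zero[OF u this YX seg[OF t]]
          show "((\<lambda>t. \<Psi> (u \<odot> (e + (X + t *\<^sub>R (Y - X))))) has_vector_derivative 0) (at t within {0..1})"
            by (rule has_vector_derivative_at_within)
        qed auto
        then obtain k where k: "\<And>t. t \<in> {0..1::real} \<Longrightarrow> \<Psi> (u \<odot> (e + (X + t *\<^sub>R (Y - X)))) = k" by blast
        from k[of 0] k[of 1] show ?thesis by simp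
      qed
      then show "\<forall>\<^sub>F Y in at X within ?D. \<Psi> (u \<odot> (e + X)) = \<Psi> (u \<odot> (e + Y))"
        unfolding eventually_at using r(1) by blast
    qed
  qed (use X Y in auto)
  have const: "\<Psi> g1 = \<Psi> g2" if g: "g1 \<in> T" "g2 \<in> T" for g1 g2
  proof -
    obtain u X1 X2 p1 p2 where u: "u \<in> S" "connected {X \<in> H. u \<odot> (e + X) \<in> T}"
      "X1 \<in> H" "u \<odot> (e + X1) \<in> T" "p1 \<in> P" "g1 = u \<odot> (e + X1) \<odot> p1"
      "X2 \<in> H" "u \<odot> (e + X2) \<in> T" "p2 \<in> P" "g2 = u \<odot> (e + X2) \<odot> p2"
      by (rule common_cell'[OF g])
    show ?thesis using loc[OF u(1-4,7,8)] u \<Psi>P by simp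
  qed
  have "\<exists>b\<in>S. \<forall>u\<in>T. \<Phi> u = b \<odot> u"
  proof (cases "T = {}")
    case False
    then obtain g0 where g0: "g0 \<in> T" by blast
    have "\<Phi> u = \<Psi> g0 \<odot> u" if "u \<in> T" for u
    proof -
      have "\<Phi> u = \<Psi> u \<odot> u" using that T_S by (simp add: \<Psi>_def assoc ainv)
      then show ?thesis using const[OF that g0] by simp
    qed
    moreover have "\<Psi> g0 \<in> S" using g0 \<Phi>T T_S by (simp add: \<Psi>_def)
    ultimately show ?thesis by blast
  qed (use e_S in blast)
  then obtain b where b: "b \<in> S" "\<forall>u\<in>T. \<Phi> u = b \<odot> u" by blast
  have "(\<lambda>g. b \<odot> g) ` T = \<Phi> ` T" using b by (intro image_cong) auto
  also have "\<dots> = T" using bij by (simp add: bij_betw_def)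
  finally show ?thesis using b that by blast
qed

lemma image_orbit:
  assumes "\<And>g. g \<in> T \<Longrightarrow> \<Phi> g = b \<odot> g" "u \<in> T"
  shows "\<Phi> ` orbit P \<X> u = orbit P \<X> (b \<odot> u)"
  using assms by (auto simp: orbit_def image_image T_P assoc intro!: image_cong)

text \<open>Since \<open>s \<odot> (e + X) = (e - X) \<odot> s\<close> and \<open>s\<close> lies in
  \<open>P\<close>, left multiplication by the conjugate of \<open>s\<close> is the map X to -X in
  the cell coordinate centred at \<open>u\<close>.\<close>

lemma reflection_symmetry:
  assumes u: "u \<in> T" and s: "s \<in> S" "s = E + E - e"
    and bT: "(\<lambda>g. (u \<odot> s \<odot> ainv u) \<odot> g) ` T = T"
  shows "symmetry_at P \<X> (orbit P \<X> u) (\<lambda>g. (u \<odot> s \<odot> ainv u) \<odot> g)"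
proof -
  define b where "b = u \<odot> s \<odot> ainv u"
  have uS: "u \<in> S" using u T_S by blast
  have bS: "b \<in> S" using uS s by (simp add: b_def)
  have bT: "(\<lambda>g. b \<odot> g) ` T = T" using bT by (simp add: b_def)
  have bmem: "b \<odot> g \<in> T" if "g \<in> T" for g using bT that by blast
  have auto: "automorphism P \<X> (\<lambda>g. b \<odot> g)" by (rule left_mult_automorphism[OF bS bT])
  have sP: "s \<in> P" using s by (simp add: P_eq distribs)
  have ss: "s \<odot> s = e" by (simp add: s(2) distribs)
  have bu: "b \<odot> u = u \<odot> s" using uS by (simp add: b_def assoc ainv)
  have orb: "(\<lambda>g. b \<odot> g) ` orbit P \<X> w = orbit P \<X> (b \<odot> w)" if "w \<in> T" for w
    by (rule image_orbit[OF refl that])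
  have fixed_orbit: "(\<lambda>g. b \<odot> g) ` orbit P \<X> u = orbit P \<X> u"
    using orb[OF u] orbit_P[OF uS sP] bu by simp
  have neg: "differential T (\<lambda>w. f ((\<lambda>g. b \<odot> g) ` orbit P \<X> w)) u' v = - differential T (\<lambda>w. f (orbit P \<X> w)) u' v"
    if f: "base_smooth P \<X> f" and u': "u' \<in> T" "orbit P \<X> u' = orbit P \<X> u" and v: "v \<in> tangent_space T u'"
    for f :: "'a set \<Rightarrow> real" and u' v
  proof -
    define F where "F w = f (orbit P \<X> w)" for w
    have FP: "F (w \<odot> p) = F w" if "w \<in> S" "p \<in> P" for w p using orbit_P that by (simp add: F_def)
    have smF: "smooth_on T F" using f by (simp add: base_smooth_def F_def[abs_def])
    have "smooth_on T (\<lambda>w. b \<odot> w)" by (intro smooth_intros)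
    then have smFb: "smooth_on T (\<lambda>w. F (b \<odot> w))" by (rule smooth_on_compose[OF _ smF]) (use bmem in auto)
    have u'S: "u' \<in> S" using u' T_S by blast
    \<comment> \<open>A tangent vector of the base may be represented at any \<open>u'\<close> in
      the orbit. Right translation by \<open>p\<close> brings its curve to \<open>u\<close>, and the
      invariant function \<open>F\<close> does not notice it.\<close>
    define p where "p = ainv u' \<odot> u"
    have p: "p \<in> P" using orbit_iff[OF u'S uS] u'(2) by (simp add: p_def)
    have pS: "p \<in> S" using p P_S by blast
    from v obtain c r where c: "0 < r" "smooth_on {-r<..<r} c" "c ` {-r<..<r} \<subseteq> T" "c (0::real) = u'"
      "(c has_vector_derivative v) (at 0)" by (rule tangent_spaceE)
    define c1 where "c1 t = ainv u \<odot> (c t \<odot> p)" for t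
    have c1_0: "c1 0 = e" using c(4) uS u'S by (simp add: c1_def p_def ainv)
    have sm1: "smooth_on {-r<..<r} c1" unfolding c1_def by (intro smooth_intros c(2))
    have o: "open ({-r<..<r} \<inter> (\<lambda>t. k (c1 t)) -` Collect unit)"
      unfolding k_def
      by (intro continuous_open_preimage open_units continuous_intros smooth_on_imp_continuous_on sm1)
    have "0 \<in> {-r<..<r} \<inter> (\<lambda>t. k (c1 t)) -` Collect unit" using c(1) c1_0 by simp
    then obtain d where d: "d > 0" "ball 0 d \<subseteq> {-r<..<r} \<inter> (\<lambda>t. k (c1 t)) -` Collect unit"
      using o openE by blast
    have ball: "ball (0::real) d = {-d<..<d}" by (auto simp: dist_real_def)
    \<comment> \<open>The cell coordinate of the curve: near 0 the points \<open>c t\<close> and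
      \<open>u \<odot> (e + X t)\<close> have the same orbit.\<close>
    define X where "X t = \<xi> (c1 t)" for t
    let ?I = "{-d<..<d}"
    have I: "c t \<in> T" "unit (k (c1 t))" "c1 t \<in> S" if "t \<in> ?I" for t
    proof -
      have "t \<in> {-r<..<r} \<inter> (\<lambda>t. k (c1 t)) -` Collect unit" using d(2) that unfolding ball by (rule subsetD)
      then show "c t \<in> T" "unit (k (c1 t))" using c(3) by blast+
      then show "c1 t \<in> S" using uS pS T_S by (simp add: c1_def)
    qed
    have "smooth_on ?I c1" by (rule smooth_on_subset[OF sm1]) (use d(2) in \<open>auto simp: ball\<close>)
    then have smX: "smooth_on ?I X" unfolding X_def by (rule smooth_\<xi>) (use I in auto)
    have X0: "X 0 = 0" by (simp add: X_def c1_0 \<xi>_def distribs)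
    have XH: "X t \<in> H" if "t \<in> ?I" for t
      using cell_decomp(1)[OF I(3,2)[OF that]] by (simp add: X_def)
    have X1: "\<exists>q\<in>P. c t = u \<odot> (e + X t) \<odot> q" if t: "t \<in> ?I" for t
    proof -
      let ?q = "(e - X t) \<odot> c1 t"
      have "u \<odot> c1 t = u \<odot> ((e + X t) \<odot> ?q)"
        using cell_decomp(3)[OF I(3,2)[OF t]] by (simp add: X_def)
      then have "c t \<odot> p = u \<odot> (e + X t) \<odot> ?q" using uS by (simp add: c1_def assoc)
      then have "c t \<odot> p \<odot> ainv p = u \<odot> (e + X t) \<odot> (?q \<odot> ainv p)" by (simp only: assoc)
      then have "c t = u \<odot> (e + X t) \<odot> (?q \<odot> ainv p)" using pS by (simp add: assoc ainv)
      moreover have "?q \<odot> ainv p \<in> P"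
        using cell_decomp(2)[OF I(3,2)[OF t]] p P_inv by (simp add: X_def)
      ultimately show ?thesis by blast
    qed
    have uX: "u \<odot> (e + X t) \<in> S" if "t \<in> ?I" for t using uS H_S[OF XH[OF that]] by simp
    have uX': "u \<odot> (e - X t) \<in> S" if "t \<in> ?I" for t
      using uS ainv_H[OF XH[OF that]] ainv_S[OF H_S[OF XH[OF that]]] by simp
    have Fc: "F (c t) = F (u \<odot> (e + X t))" "u \<odot> (e + X t) \<in> T" if t: "t \<in> ?I" for t
      using X1[OF t] FP[OF uX[OF t]] T_P_iff[OF uX[OF t]] I(1)[OF t] by auto
    have Fbc: "F (b \<odot> c t) = F (u \<odot> (e - X t))" "u \<odot> (e - X t) \<in> T" if t: "t \<in> ?I" for t
    proof -
      obtain q where q: "q \<in> P" "c t = u \<odot> (e + X t) \<odot> q" using X1[OF t] by blast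
      have "s \<odot> (e + X t) = (e - X t) \<odot> s" by (simp add: s(2) distribs H_alg[OF XH[OF t]])
      then have "b \<odot> (u \<odot> (e + X t)) = u \<odot> ((e - X t) \<odot> s)" using uS by (simp add: b_def assoc)
      then have "b \<odot> c t = u \<odot> ((e - X t) \<odot> s) \<odot> q" by (simp add: q(2) flip: assoc)
      then have eq: "b \<odot> c t = u \<odot> (e - X t) \<odot> (s \<odot> q)" by (simp add: assoc)
      show "F (b \<odot> c t) = F (u \<odot> (e - X t))" unfolding eq using FP[OF uX'[OF t]] sP q(1) by simp
      show "u \<odot> (e - X t) \<in> T"
        using bmem[OF I(1)[OF t]] T_P_iff[OF uX'[OF t] mul_P[OF sP q(1)]] by (simp add: eq)
    qed
    \<comment> \<open>A single derivative \<open>L\<close> of \<open>F\<close> in the cell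
      coordinate handles both curves, with velocities \<open>X' 1\<close> and \<open>- X' 1\<close>;
      linearity then gives the sign.\<close>
    define V where "V = {Y \<in> H. u \<odot> (e + Y) \<in> T}"
    have "smooth_on V (\<lambda>Y. u \<odot> (e + Y))" by (intro smooth_intros)
    then have "smooth_on V (\<lambda>Y. F (u \<odot> (e + Y)))" by (rule smooth_on_compose[OF _ smF]) (auto simp: V_def)
    moreover have "0 \<in> V" using u H_sub by (simp add: V_def subspace_0)
    ultimately obtain L where L: "((\<lambda>Y. F (u \<odot> (e + Y))) has_derivative L) (at 0 within V)"
      using smooth_on_imp_has_derivative by blast
    have "0 \<in> ?I" using d(1) by simp
    then obtain X' where "(X has_derivative X') (at 0 within ?I)"
      using smooth_on_imp_has_derivative[OF smX] by blast
    moreover have "at 0 within ?I = at 0" by (rule at_within_open) (use d(1) in auto)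
    ultimately have hd: "(X has_derivative X') (at 0)" by simp
    have "X' h = h *\<^sub>R X' 1" for h
      using linear_scale[OF has_derivative_linear[OF hd], of h 1] by simp
    then have "X' = (\<lambda>h. h *\<^sub>R X' 1)" by (rule ext)
    then have X': "(X has_vector_derivative X' 1) (at 0)"
      unfolding has_vector_derivative_def using hd by metis
    have 1: "((\<lambda>t. F (u \<odot> (e + X t))) has_vector_derivative L (X' 1)) (at 0)"
      by (rule has_vector_derivative_chain_within[of "\<lambda>Y. F (u \<odot> (e + Y))" L X V d])
        (use L X0 d(1) X' XH Fc(2) in \<open>auto simp: V_def\<close>)
    have XH': "- X t \<in> H" if "t \<in> ?I" for t using XH[OF that] H_sub by (simp add: subspace_neg)
    have 2: "((\<lambda>t. F (u \<odot> (e + - X t))) has_vector_derivative L (- X' 1)) (at 0)"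
      by (rule has_vector_derivative_chain_within[of "\<lambda>Y. F (u \<odot> (e + Y))" L "\<lambda>t. - X t" V d])
        (use L X0 d(1) has_vector_derivative_minus[OF X'] XH' Fbc(2) in \<open>auto simp: V_def\<close>)
    have "((\<lambda>t. F (c t)) has_vector_derivative L (X' 1)) (at 0)"
      by (rule has_vector_derivative_transform_within_open[OF 1, of ?I]) (use d(1) Fc(1) in auto)
    moreover have "((\<lambda>t. F (b \<odot> c t)) has_vector_derivative L (- X' 1)) (at 0)"
      by (rule has_vector_derivative_transform_within_open[OF 2, of ?I]) (use d(1) Fbc(1) in auto)
    moreover have "((\<lambda>t. F (c t)) has_vector_derivative differential T F u' v) (at 0)"
      "((\<lambda>t. F (b \<odot> c t)) has_vector_derivative differential T (\<lambda>w. F (b \<odot> w)) u' v) (at 0)"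
      using differential_curve[OF smF c(1,3,2,5)] differential_curve[OF smFb c(1,3,2,5)] c(4) by auto
    ultimately have "differential T F u' v = L (X' 1)" "differential T (\<lambda>w. F (b \<odot> w)) u' v = L (- X' 1)"
      using vector_derivative_unique_at by blast+
    then have "differential T (\<lambda>w. F (b \<odot> w)) u' v = - differential T F u' v"
      using linear_neg[OF has_derivative_linear[OF L]] by simp
    moreover have "differential T (\<lambda>w. f ((\<lambda>g. b \<odot> g) ` orbit P \<X> w)) u' = differential T (\<lambda>w. F (b \<odot> w)) u'"
      by (rule differential_cong[OF u'(1)]) (simp add: orb F_def)
    ultimately show ?thesis by (simp add: F_def[abs_def])
  qed
  show ?thesis
    unfolding symmetry_at_def b_def[symmetric]
    using auto fixed_orbit neg by (auto simp: base_tangent_def pushforward_def)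
qed

text \<open>Makes a symmetry testable: a smooth invariant function on the total space descends to
  the base, so the sign condition becomes a comparison of two derivatives in one variable along the
  lines of a cell.\<close>

lemma symmetry_derivative:
  assumes sym: "symmetry_at P \<X> (orbit P \<X> u) \<Phi>" and u: "u \<in> T"
    and b: "\<And>g. g \<in> T \<Longrightarrow> \<Phi> g = b \<odot> g" "(\<lambda>g. b \<odot> g) ` T = T"
    and F: "smooth_on T F" "\<And>g p. g \<in> T \<Longrightarrow> p \<in> P \<Longrightarrow> F (g \<odot> p) = F g" and X: "X \<in> H"
    and d1: "((\<lambda>t. F (u \<odot> (e + t *\<^sub>R X))) has_vector_derivative d1) (at 0)"
    and d2: "((\<lambda>t. F (b \<odot> (u \<odot> (e + t *\<^sub>R X)))) has_vector_derivative d2) (at 0)"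
  shows "d2 = - (d1::real)"
proof -
  have uS: "u \<in> S" using u T_S by blast
  have bmem: "b \<odot> g \<in> T" if "g \<in> T" for g using b(2) that by blast
  \<comment> \<open>The invariance of \<open>F\<close> under \<open>P\<close> makes the chosen
    representative immaterial.\<close>
  define f where "f A = F (SOME g. g \<in> A)" for A
  have f: "f (orbit P \<X> w) = F w" if "w \<in> T" for w
  proof -
    have "w \<odot> e \<in> orbit P \<X> w" unfolding orbit_def right_act_flat using e_P by blast
    then have "(SOME g. g \<in> orbit P \<X> w) \<in> orbit P \<X> w" by (rule someI)
    then obtain p where "p \<in> P" "(SOME g. g \<in> orbit P \<X> w) = w \<odot> p" by (auto simp: orbit_def)
    then show ?thesis using F(2)[OF that] by (simp add: f_def)
  qed
  have bs: "base_smooth P \<X> f"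
    using F(1) smooth_on_cong[of T "\<lambda>u. f (orbit P \<X> u)" F, OF f] by (simp add: base_smooth_def)
  have "0 \<in> H" "u \<odot> (e + 0) \<in> T" using u H_sub by (auto simp: subspace_0)
  from line_in_cell[OF uS this X] obtain r where r: "r > 0" "\<And>t. \<bar>t\<bar> < r \<Longrightarrow> u \<odot> (e + (0 + t *\<^sub>R X)) \<in> T"
    by blast
  let ?c = "\<lambda>t. u \<odot> (e + (0 + t *\<^sub>R X))"
  have c: "?c ` {-r<..<r} \<subseteq> T" "smooth_on {-r<..<r} ?c" "(?c has_vector_derivative u \<odot> X) (at 0)"
    using r(2) by (auto simp: abs_less_iff intro: line_smooth(1)[of _ u 0 X, simplified]
        line_smooth(2)[of u 0 X, simplified])
  have v: "u \<odot> X \<in> tangent_space T u" by (rule tangent_spaceI[OF r(1) c(2,1) _ c(3)]) simp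
  have "smooth_on T (\<lambda>w. b \<odot> w)" by (intro smooth_intros)
  then have smFb: "smooth_on T (\<lambda>w. F (b \<odot> w))" by (rule smooth_on_compose[OF _ F(1)]) (use bmem in auto)
  have "(\<lambda>f. differential T (\<lambda>w. f (orbit P \<X> w)) u (u \<odot> X)) \<in> base_tangent P \<X> (orbit P \<X> u)"
    unfolding base_tangent_def using u v by auto
  then have "pushforward ((`) \<Phi>) (\<lambda>f. differential T (\<lambda>w. f (orbit P \<X> w)) u (u \<odot> X)) f
      = - differential T (\<lambda>w. f (orbit P \<X> w)) u (u \<odot> X)"
    using sym bs unfolding symmetry_at_def by blast
  moreover have "differential T (\<lambda>w. f (\<Phi> ` orbit P \<X> w)) u = differential T (\<lambda>w. F (b \<odot> w)) u"
    by (rule differential_cong[OF u]) (simp add: image_orbit[OF b(1)] f bmem)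
  moreover have "differential T (\<lambda>w. f (orbit P \<X> w)) u = differential T F u"
    by (rule differential_cong[OF u]) (simp add: f)
  ultimately have "differential T (\<lambda>w. F (b \<odot> w)) u (u \<odot> X) = - differential T F u (u \<odot> X)"
    by (simp add: pushforward_def)
  moreover have "differential T F u (u \<odot> X) = d1"
    using differential_curve[OF F(1) r(1) c] d1 vector_derivative_unique_at by fastforce
  moreover have "differential T (\<lambda>w. F (b \<odot> w)) u (u \<odot> X) = d2"
    using differential_curve[OF smFb r(1) c] d2 vector_derivative_unique_at by fastforce
  ultimately show ?thesis by simp
qed

end

section \<open>Isotropic subspaces\<close>

abbreviation setsums :: "'v::real_vector set \<Rightarrow> 'v set \<Rightarrow> 'v set" where
  "setsums S T \<equiv> {x + y | x y. x \<in> S \<and> y \<in> T}"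

text \<open>A vector space is not the union of two proper subspaces: if \<open>a\<close> misses only
  \<open>A\<close> and \<open>b\<close> misses only \<open>A'\<close>, then \<open>a + b\<close>
  misses both.\<close>

lemma subspace_avoid_two:
  assumes "subspace S" "subspace A" "subspace A'" "\<not> S \<subseteq> A" "\<not> S \<subseteq> A'"
  obtains v where "v \<in> S" "v \<notin> A" "v \<notin> A'"
proof -
  obtain a b where ab: "a \<in> S" "a \<notin> A" "b \<in> S" "b \<notin> A'" using assms by blast
  show ?thesis
  proof (cases "a \<in> A'")
    case False then show ?thesis using ab that by blast
  next
    case aA': True
    show ?thesis
    proof (cases "b \<in> A")
      case False then show ?thesis using ab that by blast
    next
      case True
      have "a + b \<in> S" using ab assms(1) by (simp add: subspace_add)
      moreover have "a + b \<notin> A" using True ab(2) assms(2) by (metis add_diff_cancel_right' subspace_diff)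
      moreover have "a + b \<notin> A'" using aA' ab(4) assms(3) by (metis add_diff_cancel_left' subspace_diff)
      ultimately show ?thesis using that by blast
    qed
  qed
qed

lemma dim_span_insert:
  fixes S :: "'v::euclidean_space set"
  assumes "subspace S" "x \<notin> S"
  shows "dim (span (insert x S)) = dim S + 1"
proof -
  have "span S = S" using assms(1) by simp
  then show ?thesis using assms(2) by (simp only: dim_span dim_insert) simp
qed

lemma in_span_insert: "subspace S \<Longrightarrow> y \<in> span (insert x S) \<longleftrightarrow> (\<exists>c. \<exists>s\<in>S. y = s + c *\<^sub>R x)"
proof -
  assume S: "subspace S"
  have "y \<in> span (insert x S) \<longleftrightarrow> (\<exists>c. y - c *\<^sub>R x \<in> S)"
    unfolding span_breakdown_eq span_eq_iff[THEN iffD2, OF S] ..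
  also have "\<dots> \<longleftrightarrow> (\<exists>c. \<exists>s\<in>S. y = s + c *\<^sub>R x)"
    by (metis add_diff_cancel_right' diff_add_cancel)
  finally show ?thesis .
qed

lemma disjoint_insert:
  assumes z: "subspace z" and I: "subspace I" "z \<inter> I = {0}" and v: "v \<notin> setsums z I"
  shows "z \<inter> span (insert v I) = {0}"
proof -
  have "a = 0" if a: "a \<in> z" "a \<in> span (insert v I)" for a
  proof -
    obtain c i where ci: "i \<in> I" "a = i + c *\<^sub>R v" using a(2) unfolding in_span_insert[OF I(1)] by blast
    have "c = 0"
    proof (rule ccontr)
      assume c: "c \<noteq> 0"
      have "v = (1/c) *\<^sub>R a + (- (1/c)) *\<^sub>R i" using c ci(2) by (simp add: algebra_simps)
      moreover have "(1/c) *\<^sub>R a \<in> z" "(- (1/c)) *\<^sub>R i \<in> I"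
        using subspace_scale[OF z a(1)] subspace_scale[OF I(1) ci(1)] by blast+
      ultimately show False using v by blast
    qed
    then show "a = 0" using ci a(1) I(2) by auto
  qed
  moreover have "0 \<in> z" "0 \<in> span (insert v I)" using z by (simp_all add: subspace_0 span_zero)
  ultimately show ?thesis by (intro equalityI subsetI) simp_all
qed

lemma dim_disjoint_sums:
  fixes S T :: "'v::euclidean_space set"
  assumes "subspace S" "subspace T" "S \<inter> T = {0}"
  shows "dim (setsums S T) = dim S + dim T"
  using dim_sums_Int[OF assms(1,2)] assms(3) by simp

lemma hyperplane_span:
  fixes S :: "'v::euclidean_space set"
  assumes "subspace S" "subspace D" "D \<subseteq> S" "dim S = dim D + 1" "u \<in> S" "u \<notin> D"
  shows "S = span (insert u D)"
  using subspace_dim_equal[of "span (insert u D)" S] assms dim_span_insert[of D u]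
  by (simp add: span_minimal)

lemma hyperplane_kernel:
  fixes S :: "'v::euclidean_space set"
  assumes S: "subspace S" and \<psi>: "linear \<psi>" and u: "u \<in> S" "\<psi> u \<noteq> (0::real)"
  shows "subspace {h \<in> S. \<psi> h = 0}" "dim {h \<in> S. \<psi> h = 0} + 1 = dim S"
proof -
  let ?H = "{h \<in> S. \<psi> h = 0}"
  show H: "subspace ?H"
    using S by (auto simp: subspace_def linear_0[OF \<psi>] linear_add[OF \<psi>] linear_scale[OF \<psi>])
  have "S \<subseteq> span (insert u ?H)"
  proof
    fix s assume s: "s \<in> S"
    have "s - (\<psi> s / \<psi> u) *\<^sub>R u \<in> ?H"
      using s u S by (simp add: subspace_diff subspace_scale linear_diff[OF \<psi>] linear_scale[OF \<psi>])
    then have "\<exists>h\<in>?H. s = h + (\<psi> s / \<psi> u) *\<^sub>R u"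
      by (intro bexI[of _ "s - (\<psi> s / \<psi> u) *\<^sub>R u"]) simp_all
    then show "s \<in> span (insert u ?H)" unfolding in_span_insert[OF H] by blast
  qed
  moreover have "span (insert u ?H) \<subseteq> S" using S u by (intro span_minimal) auto
  ultimately have "S = span (insert u ?H)" by blast
  then show "dim ?H + 1 = dim S" using dim_span_insert[OF H, of u] u by simp
qed

text \<open>The reflection along the difference \<open>n\<close> of the two unit vectors exchanges
  them, and it preserves \<open>C\<close> because \<open>n\<close> lies in \<open>C\<close>. For
  \<open>n = 0\<close> the two lines already coincide.\<close>

lemma householder:
  fixes p q :: "'v::euclidean_space"
  assumes C: "subspace C" "p \<in> C" "q \<in> C" "p \<noteq> 0" "q \<noteq> 0"
  obtains r where "linear r" "inj r" "r ` C = C" "r p \<in> span {q}" "\<And>x y. r x \<bullet> r y = x \<bullet> y"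
proof -
  define n where "n = (1 / norm p) *\<^sub>R p - (1 / norm q) *\<^sub>R q"
  show ?thesis
  proof (cases "n = 0")
    case True
    then have "(1 / norm p) *\<^sub>R p = (1 / norm q) *\<^sub>R q" by (simp add: n_def)
    then have "norm p *\<^sub>R ((1 / norm p) *\<^sub>R p) = norm p *\<^sub>R ((1 / norm q) *\<^sub>R q)" by (simp only:)
    then have "p = (norm p * (1 / norm q)) *\<^sub>R q" using C(4) by simp
    then have "p \<in> span {q}" by (metis insertI1 span_base span_scale)
    then show ?thesis using that[of "\<lambda>v. v"] by (auto simp: linear_ident)
  next
    case False
    define r where "r v = v - (2 * (v \<bullet> n) / (n \<bullet> n)) *\<^sub>R n" for v
    have nn: "n \<bullet> n \<noteq> 0" using False by simp
    have lin: "linear r"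
      by (rule linearI) (simp_all add: r_def inner_add_left algebra_simps add_divide_distrib)
    have iso: "r x \<bullet> r y = x \<bullet> y" for x y
    proof -
      define a c N where "a = x \<bullet> n" and "c = y \<bullet> n" and "N = n \<bullet> n"
      have "r x \<bullet> r y = x \<bullet> y - (2 * c / N) * a - (2 * a / N) * c + (2 * a / N) * (2 * c / N) * N"
        unfolding r_def inner_diff_left inner_diff_right inner_scaleR_left inner_scaleR_right
          inner_commute[of n y] a_def[symmetric] c_def[symmetric] N_def[symmetric] by simp
      also have "\<dots> = x \<bullet> y" using nn unfolding N_def[symmetric] by (simp add: field_simps)
      finally show ?thesis .
    qed
    have inj: "inj r" unfolding linear_injective_0[OF lin] using iso by (metis inner_eq_zero_iff)
    have nC: "n \<in> C" unfolding n_def by (intro subspace_diff subspace_scale C)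
    have rC: "r ` C \<subseteq> C" using nC C(1) by (auto simp: r_def intro!: subspace_diff subspace_scale)
    have "r ` C = C"
    proof (rule subspace_dim_equal[OF linear_subspace_image[OF lin C(1)] C(1) rC])
      show "dim C \<le> dim (r ` C)" using dim_image_eq[OF lin, of C] inj inj_on_subset by (metis order_refl subset_UNIV)
    qed
    moreover have "r p \<in> span {q}"
    proof -
      let ?a = "(1 / norm p) *\<^sub>R p" and ?b = "(1 / norm q) *\<^sub>R q"
      have 1: "?a \<bullet> ?a = 1" "?b \<bullet> ?b = 1" using C by (simp_all add: dot_square_norm power2_eq_square)
      \<comment> \<open>Holds because both vectors have length 1; hence the coefficient in
        \<open>r ?a\<close> is 1 and \<open>r ?a = ?a - n = ?b\<close>.\<close>
      have "n \<bullet> n = 2 * (?a \<bullet> n)"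
        unfolding n_def using 1 by (simp add: inner_diff_left inner_diff_right inner_commute algebra_simps del: inner_scaleR_left inner_scaleR_right)
      then have "r ?a = ?a - n" using nn by (simp add: r_def)
      then have "r ?a = ?b" by (simp add: n_def)
      then have "norm p *\<^sub>R r ?a = norm p *\<^sub>R ?b" by simp
      then have "r p = (norm p * (1 / norm q)) *\<^sub>R q" using C(4) by (simp add: linear_scale[OF lin])
      then show ?thesis by (metis insertI1 span_base span_scale)
    qed
    ultimately show ?thesis using that lin inj iso by blast
  qed
qed

text \<open>A hyperplane of \<open>S\<close> is determined by its normal line inside
  \<open>S\<close>, so an isometry of \<open>S\<close> that matches the normals matches the
  hyperplanes.\<close>

lemma hyperplane_map:
  fixes S :: "'v::euclidean_space set"
  assumes S: "subspace S" and D: "subspace D" "D \<subseteq> S" "dim D + 1 = dim S"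
    and D': "subspace D'" "D' \<subseteq> S" "dim D' + 1 = dim S"
  obtains r where "linear r" "inj r" "r ` S = S" "r ` D = D'"
proof -
  have normal: "\<exists>n\<in>S. n \<noteq> 0 \<and> D = {v \<in> S. n \<bullet> v = 0}"
    if D: "subspace D" "D \<subseteq> S" "dim D + 1 = dim S" for D
  proof -
    have "span D \<subset> span S" using D S by (auto simp: span_eq_iff[THEN iffD2])
    then obtain n where n: "n \<noteq> 0" "n \<in> span S" "\<And>y. y \<in> span D \<Longrightarrow> orthogonal n y"
      by (rule orthogonal_to_subspace_exists_gen) blast
    have nS: "n \<in> S" using n(2) span_eq_iff[THEN iffD2, OF S] by simp
    have lin: "linear (\<lambda>v. n \<bullet> v)" by (simp add: bounded_linear.linear bounded_linear_inner_right)
    have "n \<bullet> n \<noteq> 0" using n(1) by simp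
    note h = hyperplane_kernel[OF S lin nS this]
    have "D = {v \<in> S. n \<bullet> v = 0}"
    proof (rule subspace_dim_equal[OF D(1) h(1)])
      show "D \<subseteq> {v \<in> S. n \<bullet> v = 0}" using D(2) n(3)[OF span_base] by (auto simp: orthogonal_def)
      show "dim {v \<in> S. n \<bullet> v = 0} \<le> dim D" using h(2) D(3) by simp
    qed
    then show ?thesis using nS n(1) by blast
  qed
  obtain n where n: "n \<in> S" "n \<noteq> 0" "D = {v \<in> S. n \<bullet> v = 0}" using normal[OF D] by blast
  obtain n' where n': "n' \<in> S" "n' \<noteq> 0" "D' = {v \<in> S. n' \<bullet> v = 0}" using normal[OF D'] by blast
  obtain r where r: "linear r" "inj r" "r ` S = S" "r n \<in> span {n'}" "\<And>x y. r x \<bullet> r y = x \<bullet> y"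
    by (rule householder[OF S n(1) n'(1) n(2) n'(2)]) blast
  obtain c where c: "r n = c *\<^sub>R n'" using r(4) by (auto simp: span_singleton)
  have c0: "c \<noteq> 0" using c r(5)[of n n] n(2) by auto
  have "r v \<in> D'" if "v \<in> D" for v
  proof -
    have "c * (n' \<bullet> r v) = 0" using r(5)[of n v] c that n(3) by simp
    then show ?thesis using c0 that n(3) n'(3) r(3) by auto
  qed
  then have sub: "r ` D \<subseteq> D'" by blast
  have "r ` D = D'"
  proof (rule subspace_dim_equal[OF linear_subspace_image[OF r(1) D(1)] D'(1) sub])
    have "inj_on r (span D)" using r(2) inj_on_subset by blast
    then show "dim D' \<le> dim (r ` D)" using dim_image_eq[OF r(1)] D D' by simp
  qed
  then show ?thesis using that r by blast
qed

text \<open>\<open>B = 0\<close> gives the Grassmannian of series (A), a nondegenerate \<open>B\<close> the Lagrangian Grassmannian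
  of series (C). \<open>E\<close> is the projection onto \<open>W\<close> along \<open>F\<close>.\<close>

locale isotropic_geometry =
  fixes B :: "'v::euclidean_space \<Rightarrow> 'v \<Rightarrow> real" and k :: nat and W F :: "'v set" and E :: "'v \<Rightarrow> 'v"
  assumes bilin: "bilinear B" and alt: "B x x = 0"
    and disj: "(\<forall>x y. B x y = 0) \<or> ((\<forall>x. (\<forall>y. B x y = 0) \<longrightarrow> x = 0) \<and> DIM('v) = 2 * k)"
    and W: "subspace W" "dim W = k" "\<And>u v. u \<in> W \<Longrightarrow> v \<in> W \<Longrightarrow> B u v = 0"
    and F: "subspace F" "dim F = DIM('v) - k" "\<And>u v. u \<in> F \<Longrightarrow> v \<in> F \<Longrightarrow> B u v = 0"
    and E: "linear E" "\<And>x. E x \<in> W" "\<And>x. x - E x \<in> F"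
    and orth: "\<And>w f. w \<in> W \<Longrightarrow> f \<in> F \<Longrightarrow> w \<bullet> f = 0"
    and k: "0 < k" "k < DIM('v)"
begin

lemmas B_simps = bilinear_ladd[OF bilin] bilinear_radd[OF bilin] bilinear_lmul[OF bilin]
  bilinear_rmul[OF bilin] bilinear_lneg[OF bilin] bilinear_rneg[OF bilin] bilinear_lzero[OF bilin]
  bilinear_rzero[OF bilin] bilinear_lsub[OF bilin] bilinear_rsub[OF bilin] alt

lemma B_sym: "B x y = - B y x"
  using alt[of "x + y"] alt[of x] alt[of y] by (simp add: B_simps del: alt)

lemma B_lin: "linear (B x)" "linear (\<lambda>x. B x y)"
  using bilin by (auto simp: bilinear_def)

definition iso :: "'v set \<Rightarrow> bool" where "iso S \<longleftrightarrow> (\<forall>u\<in>S. \<forall>v\<in>S. B u v = 0)"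

definition point :: "'v set \<Rightarrow> bool" where "point x \<longleftrightarrow> subspace x \<and> dim x = k \<and> iso x"

text \<open>The complements of points are taken from this family. For a nondegenerate
  \<open>B\<close> its dimension is again \<open>k\<close>, so copoints are themselves
  points.\<close>

definition copoint :: "'v set \<Rightarrow> bool" where
  "copoint C \<longleftrightarrow> subspace C \<and> dim C = DIM('v) - k \<and> iso C"

text \<open>With \<open>B = 0\<close> these are exactly the invertible linear maps, with a
  nondegenerate \<open>B\<close> the conformal symplectic ones.\<close>

definition similitude :: "('v \<Rightarrow> 'v) \<Rightarrow> bool" where
  "similitude g \<longleftrightarrow> linear g \<and> inj g \<and> (\<exists>c. c \<noteq> 0 \<and> (\<forall>x y. B (g x) (g y) = c * B x y))"

definition perp :: "'v set \<Rightarrow> 'v set" where "perp D = {v. \<forall>d\<in>D. B d v = 0}"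

abbreviation nondeg :: bool where
  "nondeg \<equiv> (\<forall>x. (\<forall>y. B x y = 0) \<longrightarrow> x = 0) \<and> DIM('v) = 2 * k"

lemma point_W: "point W" and copoint_F: "copoint F"
  using W F by (auto simp: point_def copoint_def iso_def)

lemma W_F: "x \<in> W \<Longrightarrow> x \<in> F \<Longrightarrow> x = 0"
  using orth[of x x] by simp

lemma E_W [simp]: "w \<in> W \<Longrightarrow> E w = w"
  using W_F[of "w - E w"] E(2)[of w] E(3)[of w] W(1) by (simp add: subspace_diff)

lemma E_F [simp]: "f \<in> F \<Longrightarrow> E f = 0"
  using W_F[of "E f"] E(2)[of f] E(3)[of f] F(1) by (metis diff_diff_eq2 diff_add_cancel add_diff_cancel_left' subspace_diff)

lemma subspace_perp: "subspace (perp D)"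
  by (auto simp: perp_def subspace_def B_simps)

lemma iso_span: "iso S \<Longrightarrow> iso (span S)"
proof -
  assume S: "iso S"
  have 1: "B u v = 0" if "u \<in> S" "v \<in> span S" for u v
    using that(2,1)
    by (induction rule: span_induct) (use S in \<open>auto simp: iso_def subspace_def B_simps\<close>)
  have "B u v = 0" if "u \<in> span S" "v \<in> span S" for u v
    using that(1)
    by (induction rule: span_induct) (use 1 that(2) in \<open>auto simp: subspace_def B_simps\<close>)
  then show ?thesis by (simp add: iso_def)
qed

lemma iso_insert: "iso S \<Longrightarrow> (\<And>s. s \<in> S \<Longrightarrow> B s v = 0) \<Longrightarrow> iso (insert v S)"
  using B_sym unfolding iso_def by (metis alt insert_iff neg_0_equal_iff_equal)

text \<open>The operator that represents \<open>B\<close> by the inner product; it translates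
  questions about \<open>perp\<close> into Euclidean orthogonality.\<close>

definition J :: "'v \<Rightarrow> 'v" where "J y = (\<Sum>b\<in>Basis. B b y *\<^sub>R b)"

lemma inner_J: "x \<bullet> J y = B x y"
proof -
  have "x \<bullet> J y = (\<Sum>b\<in>Basis. B ((x \<bullet> b) *\<^sub>R b) y)"
    by (simp add: J_def inner_sum_right B_simps mult.commute)
  also have "\<dots> = B (\<Sum>b\<in>Basis. (x \<bullet> b) *\<^sub>R b) y"
    using linear_sum[OF B_lin(2)] by metis
  also have "\<dots> = B x y" by (simp only: euclidean_representation)
  finally show ?thesis .
qed

lemma linear_J: "linear J"
  by (rule linearI) (simp_all add: J_def B_simps sum.distrib scaleR_sum_right algebra_simps)

text \<open>Nondegeneracy makes \<open>J\<close> bijective, and it carries \<open>perp D\<close>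
  onto the Euclidean orthogonal complement of \<open>D\<close>.\<close>

lemma dim_perp:
  assumes nd: nondeg and D: "subspace D"
  shows "dim (perp D) + dim D = DIM('v)"
proof -
  have inj: "inj J"
  proof -
    have "x = 0" if "J x = 0" for x
    proof -
      have "B x y = 0" for y using inner_J[of y x] B_sym[of x y] that by simp
      then show ?thesis using nd by blast
    qed
    then show ?thesis using linear_injective_0[OF linear_J] by blast
  qed
  then have surj: "surj J" using linear_injective_imp_surjective[OF linear_J] by blast
  have "J ` perp D = {y. \<forall>d\<in>D. orthogonal d y}"
  proof (intro equalityI subsetI)
    fix y assume "y \<in> {y. \<forall>d\<in>D. orthogonal d y}"
    moreover obtain x where "y = J x" using surj by blast
    ultimately show "y \<in> J ` perp D" by (auto simp: perp_def orthogonal_def inner_J)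
  qed (auto simp: perp_def orthogonal_def inner_J)
  moreover have "dim (J ` perp D) = dim (perp D)"
    by (rule dim_image_eq[OF linear_J]) (use inj inj_on_subset in blast)
  ultimately show ?thesis
    using dim_subspace_orthogonal_to_vectors[OF D subspace_UNIV] by simp
qed

lemma perp_point: "nondeg \<Longrightarrow> point x \<Longrightarrow> perp x = x"
proof -
  assume nd: nondeg and x: "point x"
  have "x \<subseteq> perp x" using x by (auto simp: point_def iso_def perp_def)
  moreover have "dim (perp x) \<le> dim x" using dim_perp[OF nd, of x] x nd by (auto simp: point_def)
  ultimately show ?thesis using subspace_dim_equal[of x "perp x"] x subspace_perp by (auto simp: point_def)
qed

lemma perp_sums: "subspace S \<Longrightarrow> subspace T \<Longrightarrow> perp (setsums S T) = perp S \<inter> perp T"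
proof (intro equalityI subsetI IntI)
  fix v assume S: "subspace S" and T: "subspace T" and v: "v \<in> perp (setsums S T)"
  have "B (s + t) v = 0" if "s \<in> S" "t \<in> T" for s t
    using v that unfolding perp_def by blast
  from this[OF _ subspace_0[OF T]] this[OF subspace_0[OF S]]
  show "v \<in> perp S" "v \<in> perp T" by (auto simp: perp_def)
qed (auto simp: perp_def B_simps)

text \<open>If \<open>perp I\<close> were contained in \<open>x + I\<close>, it would be the sum of \<open>I\<close> and
  \<open>x \<inter> perp I = perp (x + I)\<close>, which is too small.\<close>

lemma perp_not_subset:
  assumes x: "point x" and I: "subspace I" "iso I" "x \<inter> I = {0}" "dim I < DIM('v) - k"
  shows "\<not> perp I \<subseteq> setsums x I"
proof
  assume sub: "perp I \<subseteq> setsums x I"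
  have xs: "subspace x" "dim x = k" using x by (auto simp: point_def)
  have dxI: "dim (setsums x I) = k + dim I" using dim_disjoint_sums[OF xs(1) I(1,3)] xs(2) by simp
  show False
  proof (cases "\<forall>x y. B x y = 0")
    case True
    then have "perp I = UNIV" by (auto simp: perp_def)
    then have "DIM('v) \<le> k + dim I" using sub dim_subset[OF sub] dxI by simp
    then show False using I(4) by simp
  next
    case False
    then have nd: nondeg using disj by blast
    have IpI: "I \<subseteq> perp I" using I(2) by (auto simp: iso_def perp_def)
    have "perp I \<subseteq> setsums (x \<inter> perp I) I"
    proof
      fix v assume v: "v \<in> perp I"
      then obtain a i where ai: "v = a + i" "a \<in> x" "i \<in> I" using sub by blast
      have "a = v - i" using ai by simp
      then have "a \<in> perp I" using v ai(3) IpI subspace_perp subspace_diff by blast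
      then show "v \<in> setsums (x \<inter> perp I) I" using ai by blast
    qed
    then have "dim (perp I) \<le> dim (setsums (x \<inter> perp I) I)" by (rule dim_subset)
    also have "\<dots> \<le> dim (x \<inter> perp I) + dim I"
      using dim_sums_Int[OF subspace_inter[OF xs(1) subspace_perp[of I]] I(1)] by simp
    finally have 1: "dim (perp I) \<le> dim (x \<inter> perp I) + dim I" .
    have "perp (setsums x I) = x \<inter> perp I" using perp_sums[OF xs(1) I(1)] perp_point[OF nd x] by simp
    then have 2: "dim (x \<inter> perp I) + (k + dim I) = DIM('v)"
      using dim_perp[OF nd subspace_sums[OF xs(1) I(1)]] dxI by simp
    show False using 1 2 dim_perp[OF nd I(1)] nd I(4) by simp
  qed
qed

text \<open>As long as \<open>I\<close> is too small, \<open>perp I\<close> is contained neither in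
  \<open>x + I\<close> nor in \<open>y + I\<close>, so some vector of \<open>perp I\<close> avoids
  both sums. Adding it to \<open>I\<close> keeps isotropy and both trivial intersections; the
  induction is on the missing dimension.\<close>

lemma isotropic_extension:
  assumes x: "point x" and y: "point y"
  shows "subspace I \<Longrightarrow> iso I \<Longrightarrow> x \<inter> I = {0} \<Longrightarrow> y \<inter> I = {0} \<Longrightarrow>
    \<exists>C. copoint C \<and> I \<subseteq> C \<and> x \<inter> C = {0} \<and> y \<inter> C = {0}"
proof (induction "DIM('v) - k - dim I" arbitrary: I rule: less_induct)
  case less
  have xs: "subspace x" "dim x = k" and ys: "subspace y" using x y by (auto simp: point_def)
  have "dim (setsums x I) = k + dim I" using dim_disjoint_sums[OF xs(1) less.prems(1,3)] xs(2) by simp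
  then have le: "dim I \<le> DIM('v) - k" using dim_subset_UNIV[of "setsums x I"] by simp
  show ?case
  proof (cases "dim I = DIM('v) - k")
    case True
    then show ?thesis using less.prems by (intro exI[of _ I]) (auto simp: copoint_def)
  next
    case False
    then have lt: "dim I < DIM('v) - k" using le by simp
    obtain v where v: "v \<in> perp I" "v \<notin> setsums x I" "v \<notin> setsums y I"
      by (rule subspace_avoid_two[OF subspace_perp subspace_sums[OF xs(1) less.prems(1)]
            subspace_sums[OF ys less.prems(1)] perp_not_subset[OF x less.prems(1,2,3) lt]
            perp_not_subset[OF y less.prems(1,2,4) lt]])
    let ?I = "span (insert v I)"
    have vI: "v \<notin> I"
    proof
      assume "v \<in> I" then have "0 + v \<in> setsums x I" using xs(1) subspace_0 by blast
      then show False using v(2) by simp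
    qed
    have "iso ?I" by (intro iso_span iso_insert less.prems(2)) (use v(1) in \<open>auto simp: perp_def\<close>)
    moreover have "DIM('v) - k - dim ?I < DIM('v) - k - dim I"
      using dim_span_insert[OF less.prems(1) vI] lt by simp
    ultimately obtain C where "copoint C" "?I \<subseteq> C" "x \<inter> C = {0}" "y \<inter> C = {0}"
      using less.hyps[of ?I] disjoint_insert[OF xs(1) less.prems(1,3) v(2)]
        disjoint_insert[OF ys less.prems(1,4) v(3)] by auto
    moreover have "I \<subseteq> ?I" using span_superset by blast
    ultimately show ?thesis by blast
  qed
qed

lemma decomp: "v = E v + (v - E v)" by simp

text \<open>For a nondegenerate form the pairing identifies \<open>F\<close> with the dual of
  \<open>W\<close>, and \<open>C\<close> with the dual of \<open>a W\<close>. Realizing both duals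
  inside \<open>W\<close> by the inner product, \<open>h\<close> is \<open>?\<phi>F\<close> followed
  by the inverse of \<open>?\<phi>C\<close>. For \<open>B = 0\<close> any isomorphism from
  \<open>F\<close> to \<open>C\<close> serves.\<close>

lemma map_copoint:
  assumes a: "linear a" "inj_on a W" "point (a ` W)" and C: "copoint C" "(a ` W) \<inter> C = {0}"
  obtains h where "linear h" "inj_on h F" "h ` F = C" "\<And>w f. w \<in> W \<Longrightarrow> f \<in> F \<Longrightarrow> B (a w) (h f) = B w f"
proof (cases "\<forall>x y. B x y = 0")
  case True
  have "\<exists>h. linear h \<and> h ` F = C \<and> inj_on h F"
    by (rule subspace_isomorphism) (use F C in \<open>auto simp: copoint_def\<close>)
  then show ?thesis using that True by auto
next
  case False
  then have nd: nondeg using disj by blast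
  then have dimF: "dim F = k" and dimC: "dim C = k" "subspace C" using F C by (auto simp: copoint_def)
  let ?\<phi>F = "\<lambda>f. E (J f)" and ?\<phi>C = "\<lambda>c. E (adjoint a (J c))"
  \<comment> \<open>\<open>W\<close> and \<open>F\<close> are orthogonal, so \<open>E\<close> is the
    orthogonal projection onto \<open>W\<close> and disappears in inner products with vectors of
    \<open>W\<close>.\<close>
  have E_sym: "w \<bullet> E v = w \<bullet> v" if "w \<in> W" for w v
  proof -
    have "w \<bullet> v = w \<bullet> (E v + (v - E v))" by simp
    also have "\<dots> = w \<bullet> E v + w \<bullet> (v - E v)" by (rule inner_add_right)
    finally show ?thesis using orth[OF that E(3)[of v]] by simp
  qed
  have \<phi>F: "w \<bullet> ?\<phi>F f = B w f" if "w \<in> W" for w f by (simp add: E_sym that inner_J)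
  have \<phi>C: "w \<bullet> ?\<phi>C c = B (a w) c" if "w \<in> W" for w c
    by (simp add: E_sym that adjoint_works[OF a(1)] inner_J)
  have linF: "linear ?\<phi>F" using linear_compose[OF linear_J E(1)] by (simp add: o_def)
  have linC: "linear ?\<phi>C"
    using linear_compose[OF linear_compose[OF linear_J adjoint_linear[OF a(1)]] E(1)] by (simp add: o_def)
  have injF: "inj_on ?\<phi>F F"
    unfolding linear_inj_on_iff_eq_0[OF linF F(1)]
  proof (intro ballI impI)
    fix f assume f: "f \<in> F" "?\<phi>F f = 0"
    have "B w f = 0" if "w \<in> W" for w using \<phi>F[OF that, of f] f(2) by simp
    then have "f \<in> perp W" by (auto simp: perp_def)
    then show "f = 0" using perp_point[OF nd point_W] W_F f by simp
  qed
  have injC: "inj_on ?\<phi>C C"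
    unfolding linear_inj_on_iff_eq_0[OF linC dimC(2)]
  proof (intro ballI impI)
    fix c assume c: "c \<in> C" "?\<phi>C c = 0"
    have "B (a w) c = 0" if "w \<in> W" for w using \<phi>C[OF that, of c] c(2) by simp
    then have "c \<in> perp (a ` W)" by (auto simp: perp_def)
    then show "c = 0" using perp_point[OF nd a(3)] C(2) c by blast
  qed
  have imC: "?\<phi>C ` C = W"
  proof (rule subspace_dim_equal)
    show "subspace (?\<phi>C ` C)" using linear_subspace_image[OF linC dimC(2)] .
    show "dim W \<le> dim (?\<phi>C ` C)" using dim_image_eq[OF linC, of C] injC dimC W(2) by (simp add: span_eq_iff[THEN iffD2])
  qed (use W E in auto)
  obtain g where g: "linear g" "range g \<subseteq> C" "\<And>c. c \<in> C \<Longrightarrow> g (?\<phi>C c) = c"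
    using linear_exists_left_inverse_on[OF linC dimC(2) injC] by auto
  define h where "h f = g (?\<phi>F f)" for f
  have h: "linear h" unfolding h_def using linear_compose[OF linF g(1)] by (simp add: o_def)
  have hC: "h f \<in> C" for f using g(2) by (auto simp: h_def)
  have \<phi>Ch: "?\<phi>C (h f) = ?\<phi>F f" for f
  proof -
    have "?\<phi>F f \<in> ?\<phi>C ` C" unfolding imC by (rule E(2))
    then obtain c where "c \<in> C" "?\<phi>F f = ?\<phi>C c" by (rule imageE) auto
    then show ?thesis using g(3) by (simp add: h_def)
  qed
  have injh: "inj_on h F" using injF \<phi>Ch unfolding inj_on_def by metis
  have "h ` F = C"
  proof (rule subspace_dim_equal)
    show "subspace (h ` F)" using linear_subspace_image[OF h F(1)] .
    show "dim C \<le> dim (h ` F)" using dim_image_eq[OF h, of F] injh dimF dimC F(1) by (simp add: span_eq_iff[THEN iffD2])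
  qed (use dimC hC in auto)
  moreover have "B (a w) (h f) = B w f" if "w \<in> W" for w f
    using \<phi>C[OF that, of "h f"] \<phi>F[OF that, of f] \<phi>Ch by simp
  ultimately show ?thesis using that h injh by blast
qed

text \<open>\<open>W\<close>, \<open>F\<close> and their images are isotropic, so \<open>B\<close>
  is determined by the pairing between the two summands, which \<open>a\<close> and \<open>h\<close>
  respect by assumption. The factor of the resulting similitude is 1.\<close>

lemma similitude_extend:
  assumes a: "linear a" "inj_on a W" "point (a ` W)" and C: "copoint C" "(a ` W) \<inter> C = {0}"
    and h: "linear h" "inj_on h F" "h ` F = C" "\<And>w f. w \<in> W \<Longrightarrow> f \<in> F \<Longrightarrow> B (a w) (h f) = B w f"
  defines "g \<equiv> \<lambda>v. a (E v) + h (v - E v)"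
  shows "similitude g" "\<And>w. w \<in> W \<Longrightarrow> g w = a w" "\<And>f. f \<in> F \<Longrightarrow> g f = h f"
proof -
  show "g w = a w" if "w \<in> W" for w using that by (simp add: g_def linear_0[OF h(1)])
  show "g f = h f" if "f \<in> F" for f using that by (simp add: g_def linear_0[OF a(1)])
  have lin: "linear g"
    by (rule linearI)
      (simp_all add: g_def linear_add[OF a(1)] linear_add[OF h(1)] linear_scale[OF a(1)] linear_scale[OF h(1)]
        linear_add[OF E(1)] linear_scale[OF E(1)] linear_diff[OF h(1)] algebra_simps)
  have "v = 0" if "g v = 0" for v
  proof -
    have "a (E v) = - h (v - E v)" using that by (simp add: g_def eq_neg_iff_add_eq_0)
    also have "\<dots> = h (- (v - E v))" by (rule linear_neg[OF h(1), symmetric])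
    finally have 1: "a (E v) = h (- (v - E v))" .
    have "- (v - E v) \<in> F" using E(3)[of v] F(1) subspace_neg by blast
    then have "h (- (v - E v)) \<in> C" using h(3) by blast
    moreover have "a (E v) \<in> a ` W" using E(2) by blast
    ultimately have 0: "a (E v) = 0" using 1 C(2) by auto
    have "E v = 0" using 0 a(2) E(2)[of v] W(1) linear_0[OF a(1)] unfolding inj_on_def by (metis subspace_0)
    moreover have "v - E v = 0"
    proof -
      have "h (v - E v) = 0" using that 0 by (simp add: g_def)
      then show ?thesis using h(2) E(3)[of v] F(1) linear_0[OF h(1)] unfolding inj_on_def by (metis subspace_0)
    qed
    ultimately show "v = 0" by simp
  qed
  then have inj: "inj g" using linear_injective_0[OF lin] by blast
  have "B (g x) (g y) = 1 * B x y" for x y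
  proof -
    have z: "B (a (E x)) (a (E y)) = 0" "B (h (x - E x)) (h (y - E y)) = 0"
      using a(3) C(1) h(3) E(2,3) unfolding point_def copoint_def iso_def by blast+
    have z': "B (E x) (E y) = 0" "B (x - E x) (y - E y) = 0" using W(3) F(3) E by auto
    have "B (g x) (g y) = B (a (E x)) (h (y - E y)) + B (h (x - E x)) (a (E y))"
      by (simp add: g_def B_simps z del: )
    also have "B (h (x - E x)) (a (E y)) = B (x - E x) (E y)"
      using h(4)[OF E(2) E(3), of y x] B_sym[of "h (x - E x)"] B_sym[of "x - E x"] by simp
    also have "B (a (E x)) (h (y - E y)) = B (E x) (y - E y)" using h(4)[OF E(2) E(3)] by simp
    also have "B (E x) (y - E y) + B (x - E x) (E y) = B (E x + (x - E x)) (E y + (y - E y))"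
      using z' unfolding bilinear_ladd[OF bilin] bilinear_radd[OF bilin] by simp
    finally show ?thesis by simp
  qed
  then show "similitude g" using lin inj unfolding similitude_def by (metis zero_neq_one)
qed

lemma similitude_exists:
  assumes x: "point x" and C: "copoint C" "x \<inter> C = {0}"
  obtains g where "similitude g" "g ` W = x" "g ` F = C"
proof -
  have "\<exists>a. linear a \<and> a ` W = x \<and> inj_on a W"
    by (rule subspace_isomorphism) (use W x in \<open>auto simp: point_def\<close>)
  then obtain a where a: "linear a" "a ` W = x" "inj_on a W" by blast
  obtain h where h: "linear h" "inj_on h F" "h ` F = C" "\<And>w f. w \<in> W \<Longrightarrow> f \<in> F \<Longrightarrow> B (a w) (h f) = B w f"
    using map_copoint[OF a(1,3) _ C(1)] x C(2) a(2) by metis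
  note g = similitude_extend[OF a(1,3) _ C(1) _ h]
  have "point (a ` W)" "a ` W \<inter> C = {0}" using x C a(2) by auto
  note g = g[OF this]
  show ?thesis
    by (rule that[OF g(1)]) (use g(2,3) a(2) h(3) in \<open>auto simp: image_def\<close>)
qed


section \<open>Configurations of two points and reflections\<close>

lemma pointD: "point x \<Longrightarrow> subspace x" "point x \<Longrightarrow> dim x = k"
  "point x \<Longrightarrow> u \<in> x \<Longrightarrow> v \<in> x \<Longrightarrow> B u v = 0"
  by (auto simp: point_def iso_def)

lemma point_eqI: "point x \<Longrightarrow> point y \<Longrightarrow> x \<subseteq> y \<Longrightarrow> x = y"
  by (rule subspace_dim_equal) (auto simp: point_def)

lemma point_image_eq:
  assumes "linear b" "inj b" "point x" "point y" "b ` x \<subseteq> y"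
  shows "b ` x = y"
proof (rule subspace_dim_equal)
  show "subspace (b ` x)" using linear_subspace_image assms pointD by blast
  have "inj_on b (span x)" using assms(2) inj_on_subset by blast
  then show "dim y \<le> dim (b ` x)" using dim_image_eq[OF assms(1)] assms(3,4) by (simp add: point_def)
qed (use assms pointD in auto)

lemma point_insert:
  assumes "subspace D" "dim D + 1 = k" "iso D" "v \<notin> D" "\<And>d. d \<in> D \<Longrightarrow> B d v = 0"
  shows "point (span (insert v D))"
proof -
  have "dim (span (insert v D)) = k" using dim_span_insert[OF assms(1,4)] assms(2) by simp
  then show ?thesis using assms by (auto simp: point_def simp del: dim_span intro!: iso_span iso_insert)
qed

lemma meet_hyperplane:
  assumes x: "point x1" "point x2" and d: "dim (x1 \<inter> x2) + 1 = k" and u: "u \<in> x1" "u \<notin> x2"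
  shows "x1 = span (insert u (x1 \<inter> x2))"
  by (rule hyperplane_span) (use x d u in \<open>auto simp: point_def subspace_inter\<close>)

text \<open>The hyperplane is the kernel of a functional on \<open>x1\<close> that vanishes on
  \<open>x1 \<inter> x2\<close>. In the symplectic case it is pairing with \<open>u2\<close>, so
  that \<open>u1 - u2\<close> will be orthogonal to \<open>h\<close>; it is nonzero on
  \<open>x1\<close> because \<open>u2\<close> lies outside \<open>x1 = perp x1\<close>. For
  \<open>B = 0\<close> it is the inner product with the component of \<open>v1\<close> orthogonal to
  \<open>x1 \<inter> x2\<close>.\<close>

lemma separating_hyperplane:
  assumes x: "point x1" "point x2" "x1 \<noteq> x2"
  obtains h u1 u2 where "subspace h" "h \<subseteq> x1" "x1 \<inter> x2 \<subseteq> h" "dim h + 1 = k" "u1 \<in> x1" "u1 \<notin> h"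
    "u2 \<in> x2" "u2 \<notin> x1" "\<And>v. v \<in> h \<Longrightarrow> B v u2 = 0"
proof -
  have "\<not> x2 \<subseteq> x1" "\<not> x1 \<subseteq> x2" using point_eqI x by blast+
  then obtain u2 v1 where u2: "u2 \<in> x2" "u2 \<notin> x1" and v1: "v1 \<in> x1" "v1 \<notin> x2" by blast
  have "\<exists>\<psi>::'v \<Rightarrow> real. linear \<psi> \<and> (\<forall>v\<in>x1 \<inter> x2. \<psi> v = 0) \<and> (\<exists>u1\<in>x1. \<psi> u1 \<noteq> 0)
    \<and> (\<forall>v\<in>x1. \<psi> v = 0 \<longrightarrow> B v u2 = 0)"
  proof (cases "\<forall>x y. B x y = 0")
    case True
    have sub: "subspace (x1 \<inter> x2)" using x pointD by (simp add: subspace_inter)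
    obtain y z where yz: "y \<in> span (x1 \<inter> x2)" "\<And>w. w \<in> span (x1 \<inter> x2) \<Longrightarrow> orthogonal z w" "v1 = y + z"
      using orthogonal_subspace_decomp_exists[of "x1 \<inter> x2" v1] by blast
    have y: "y \<in> x1 \<inter> x2" using yz(1) span_eq_iff[THEN iffD2, OF sub] by simp
    have z0: "z \<noteq> 0" using yz(3) y v1 by auto
    have zx: "z \<in> x1"
    proof -
      have "z = v1 - y" using yz(3) by simp
      then show ?thesis using v1(1) y pointD(1)[OF x(1)] by (simp add: subspace_diff)
    qed
    show ?thesis
    proof (intro exI[of _ "\<lambda>v. z \<bullet> v"] conjI ballI)
      show "linear (\<lambda>v. z \<bullet> v)" by (simp add: bounded_linear.linear bounded_linear_inner_right)
      show "z \<bullet> v = 0" if "v \<in> x1 \<inter> x2" for v using yz(2)[OF span_base[OF that]] by (simp add: orthogonal_def)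
      show "\<exists>u1\<in>x1. z \<bullet> u1 \<noteq> 0" using zx z0 by (intro bexI[of _ z]) auto
    qed (use True in auto)
  next
    case False
    then have nd: nondeg using disj by blast
    show ?thesis
    proof (intro exI[of _ "\<lambda>v. B v u2"] conjI ballI impI)
      show "linear (\<lambda>v. B v u2)" by (rule B_lin)
      show "B v u2 = 0" if "v \<in> x1 \<inter> x2" for v using that u2 x(2) pointD by auto
      show "\<exists>u1\<in>x1. B u1 u2 \<noteq> 0"
        using u2(2) perp_point[OF nd x(1)] by (auto simp: perp_def)
    qed auto
  qed
  then obtain \<psi> :: "'v \<Rightarrow> real" and u1 where \<psi>: "linear \<psi>" "\<forall>v\<in>x1 \<inter> x2. \<psi> v = 0" "u1 \<in> x1" "\<psi> u1 \<noteq> 0"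
    "\<forall>v\<in>x1. \<psi> v = 0 \<longrightarrow> B v u2 = 0" by blast
  let ?h = "{v \<in> x1. \<psi> v = 0}"
  show ?thesis
    by (rule that[of ?h u1 u2])
      (use hyperplane_kernel[OF pointD(1)[OF x(1)] \<psi>(1,3,4)] \<psi> u2 pointD(2)[OF x(1)] in auto)
qed

text \<open>The point \<open>x\<close> consists of a hyperplane of \<open>x1\<close> containing \<open>x1 \<inter> x2\<close> and of \<open>u1 - u2\<close>. A
  symmetry at \<open>x\<close> exchanging \<open>x1\<close> and \<open>x2\<close> is excluded by dimension. If it fixes both, then
  \<open>b u1 - r u1 = b u2 - r u2\<close> lies in \<open>x1 \<inter> x2 \<subseteq> x\<close>, whereas \<open>b u1 + r u1\<close> lies in \<open>x\<close>.\<close>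

lemma no_symmetry_point:
  assumes x: "point x1" "point x2" "x1 \<noteq> x2" and far: "dim (x1 \<inter> x2) + 1 \<noteq> k"
  obtains x where "point x" "x \<noteq> x1" "x \<noteq> x2"
    "\<And>b r. linear b \<Longrightarrow> r \<noteq> 0 \<Longrightarrow> (\<And>v. v \<in> x \<Longrightarrow> b v = r *\<^sub>R v) \<Longrightarrow> (\<And>v. b v + r *\<^sub>R v \<in> x) \<Longrightarrow>
      \<not> ((b ` x1 = x1 \<and> b ` x2 = x2) \<or> (b ` x1 = x2 \<and> b ` x2 = x1))"
proof -
  obtain h u1 u2 where h: "subspace h" "h \<subseteq> x1" "x1 \<inter> x2 \<subseteq> h" "dim h + 1 = k" "u1 \<in> x1" "u1 \<notin> h"
    "u2 \<in> x2" "u2 \<notin> x1" "\<And>v. v \<in> h \<Longrightarrow> B v u2 = 0" by (rule separating_hyperplane[OF x]) blast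
  note s1 = pointD(1)[OF x(1)] and s2 = pointD(1)[OF x(2)]
  let ?x = "span (insert (u1 - u2) h)"
  have d1: "u1 - u2 \<notin> x1"
  proof
    assume "u1 - u2 \<in> x1"
    then have "u1 - (u1 - u2) \<in> x1" using h(5) s1 subspace_diff by blast
    then show False using h(8) by simp
  qed
  \<comment> \<open>Here the dimension of \<open>x1 \<inter> x2\<close> enters. A symmetry
    exchanging the two points would scale \<open>h\<close> and send it into \<open>x2\<close>,
    contrary to this.\<close>
  have hx2: "\<not> h \<subseteq> x2"
  proof
    assume "h \<subseteq> x2"
    then have "h = x1 \<inter> x2" using h(2,3) by blast
    then show False using far h(4) by simp
  qed
  have "u1 - u2 \<notin> h" using d1 h(2) by blast
  moreover have "iso h" using x(1) h(2) by (auto simp: point_def iso_def)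
  moreover have "B v (u1 - u2) = 0" if "v \<in> h" for v
    using h(9)[OF that] that h(2,5) pointD(3)[OF x(1)] by (simp add: B_simps subset_iff)
  ultimately have px: "point ?x" by (intro point_insert h)
  have hx: "h \<subseteq> ?x" by (auto intro: span_base)
  have dx: "u1 - u2 \<in> ?x" by (auto intro: span_base)
  have u1x: "u1 \<notin> ?x"
  proof
    assume "u1 \<in> ?x"
    then obtain c s where cs: "s \<in> h" "u1 = s + c *\<^sub>R (u1 - u2)" unfolding in_span_insert[OF h(1)] by blast
    have "c = 0"
    proof (rule ccontr)
      assume c: "c \<noteq> 0"
      have "c *\<^sub>R (u1 - u2) = u1 - s" using cs(2) by (metis add_diff_cancel_left')
      then have "(1/c) *\<^sub>R (c *\<^sub>R (u1 - u2)) = (1/c) *\<^sub>R (u1 - s)" by (simp only:)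
      then have "u1 - u2 = (1/c) *\<^sub>R (u1 - s)" using c by simp
      moreover have "(1/c) *\<^sub>R (u1 - s) \<in> x1" using s1 h(2,5) cs(1) by (intro subspace_scale subspace_diff) auto
      ultimately show False using d1 by simp
    qed
    then show False using cs h(6) by simp
  qed
  have no: "\<not> ((b ` x1 = x1 \<and> b ` x2 = x2) \<or> (b ` x1 = x2 \<and> b ` x2 = x1))"
    if b: "linear b" "r \<noteq> 0" "\<And>v. v \<in> ?x \<Longrightarrow> b v = r *\<^sub>R v" "\<And>v. b v + r *\<^sub>R v \<in> ?x" for b r
  proof
    assume "(b ` x1 = x1 \<and> b ` x2 = x2) \<or> (b ` x1 = x2 \<and> b ` x2 = x1)"
    then show False
    proof
      assume f: "b ` x1 = x1 \<and> b ` x2 = x2"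
      have "b (u1 - u2) = r *\<^sub>R (u1 - u2)" using b(3)[OF dx] .
      then have eq: "b u1 - r *\<^sub>R u1 = b u2 - r *\<^sub>R u2" by (simp add: linear_diff[OF b(1)] algebra_simps)
      have "b u1 - r *\<^sub>R u1 \<in> x1" "b u2 - r *\<^sub>R u2 \<in> x2"
        using f h(5,7) s1 s2 by (auto intro!: subspace_diff subspace_scale)
      then have "b u1 - r *\<^sub>R u1 \<in> x1 \<inter> x2" using eq by simp
      then have "b u1 - r *\<^sub>R u1 \<in> ?x" using h(3) hx by blast
      from span_diff[OF b(4)[of u1] this]
      have "(b u1 + r *\<^sub>R u1) - (b u1 - r *\<^sub>R u1) \<in> ?x" .
      moreover have "(b u1 + r *\<^sub>R u1) - (b u1 - r *\<^sub>R u1) = (2 * r) *\<^sub>R u1"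
        unfolding mult_2 scaleR_add_left by (simp only: diff_diff_eq2 add_diff_cancel_left add.commute add.left_commute add_diff_cancel_left' add_diff_eq)
      ultimately have "(2 * r) *\<^sub>R u1 \<in> ?x" by (simp only:)
      then have "(1 / (2 * r)) *\<^sub>R ((2 * r) *\<^sub>R u1) \<in> ?x" by (rule span_scale)
      then show False using u1x b(2) by simp
    next
      assume f: "b ` x1 = x2 \<and> b ` x2 = x1"
      have "h \<subseteq> x2"
      proof
        fix v assume v: "v \<in> h"
        have "b v = r *\<^sub>R v" using b(3) v hx by blast
        moreover have "b v \<in> x2" using f v h(2) by blast
        ultimately have "(1/r) *\<^sub>R (r *\<^sub>R v) \<in> x2" using s2 by (simp only: subspace_scale)
        then show "v \<in> x2" using b(2) by simp
      qed
      then show False using hx2 by simp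
    qed
  qed
  show ?thesis
    by (rule that[OF px _ _ no]) (use dx d1 hx hx2 in auto)
qed

text \<open>In the nondegenerate case \<open>x \<inter> perp D\<close> projects to a line in the two-dimensional space
  \<open>perp D / D\<close>, where \<open>D = x1 \<inter> x2\<close> and \<open>perp D\<close> is spanned by \<open>D\<close>, \<open>u1\<close> and \<open>u2\<close>.\<close>

lemma pencil_meets:
  assumes nd: nondeg and x: "point x1" "point x2" "point x" and d: "dim (x1 \<inter> x2) + 1 = k"
    and u: "u1 \<in> x1" "u1 \<notin> x2" "u2 \<in> x2" "u2 \<notin> x1"
  obtains \<alpha> \<beta> where "\<alpha> \<noteq> 0 \<or> \<beta> \<noteq> 0" "\<alpha> *\<^sub>R u1 + \<beta> *\<^sub>R u2 \<in> setsums (x1 \<inter> x2) x"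
proof -
  let ?D = "x1 \<inter> x2"
  have D: "subspace ?D" using x pointD by (simp add: subspace_inter)
  note xs = pointD(1)[OF x(3)]
  have u2: "u2 \<notin> span (insert u1 ?D)"
  proof -
    have "span (insert u1 ?D) \<subseteq> x1" using u(1) pointD(1)[OF x(1)] by (intro span_minimal) auto
    then show ?thesis using u(4) by blast
  qed
  have dim2: "dim (span (insert u2 (span (insert u1 ?D)))) = k + 1"
    using dim_span_insert[OF subspace_span u2] dim_span_insert[OF D, of u1] u d by simp
  have "span (insert u2 (span (insert u1 ?D))) = perp ?D"
  proof (rule subspace_dim_equal[OF subspace_span subspace_perp])
    have "insert u1 ?D \<subseteq> perp ?D" "u2 \<in> perp ?D"
      using u x pointD(3) by (auto simp: perp_def)
    then show "span (insert u2 (span (insert u1 ?D))) \<subseteq> perp ?D"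
      by (simp add: span_minimal subspace_perp)
    show "dim (perp ?D) \<le> dim (span (insert u2 (span (insert u1 ?D))))"
      using dim2 dim_perp[OF nd D] d nd by simp
  qed
  \<comment> \<open>The space \<open>x \<inter> perp ?D\<close> is \<open>perp (x + ?D)\<close>, of
    dimension one more than that of \<open>x \<inter> ?D\<close>.\<close>
  moreover have "\<not> x \<inter> perp ?D \<subseteq> ?D"
  proof
    assume "x \<inter> perp ?D \<subseteq> ?D"
    then have "dim (x \<inter> perp ?D) \<le> dim (x \<inter> ?D)" by (intro dim_subset) blast
    moreover have "perp (setsums x ?D) = x \<inter> perp ?D" using perp_sums[OF xs D] perp_point[OF nd x(3)] by simp
    moreover have "dim (perp (setsums x ?D)) + dim (setsums x ?D) = 2 * k"
      using dim_perp[OF nd subspace_sums[OF xs D]] nd by simp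
    moreover have "dim (setsums x ?D) + dim (x \<inter> ?D) = k + dim ?D"
      using dim_sums_Int[OF xs D] pointD(2)[OF x(3)] by simp
    ultimately show False using d by simp
  qed
  ultimately obtain y where y: "y \<in> x" "y \<notin> ?D" "y \<in> span (insert u2 (span (insert u1 ?D)))" by blast
  from y(3) obtain \<beta> s where s: "s \<in> span (insert u1 ?D)" "y = s + \<beta> *\<^sub>R u2"
    unfolding in_span_insert[OF subspace_span] by blast
  from s(1) obtain \<alpha> d where d: "d \<in> ?D" "s = d + \<alpha> *\<^sub>R u1" unfolding in_span_insert[OF D] by blast
  have "\<alpha> *\<^sub>R u1 + \<beta> *\<^sub>R u2 = (- d) + y" using s d by simp
  moreover have "- d \<in> ?D" using d(1) D subspace_neg by blast
  ultimately have "\<alpha> *\<^sub>R u1 + \<beta> *\<^sub>R u2 \<in> setsums ?D x" using y(1) by blast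
  moreover have "\<alpha> \<noteq> 0 \<or> \<beta> \<noteq> 0" using y(2) s d by auto
  ultimately show ?thesis using that by blast
qed

text \<open>\<open>I\<close> is the part of the complement of \<open>x\<close> that decides whether the reflection permutes
  \<open>x1\<close> and \<open>x2\<close>.\<close>

lemma reflection_complement:
  assumes x: "point x1" "point x2" "point x" "x1 \<noteq> x2" and d: "dim (x1 \<inter> x2) + 1 = k"
  obtains C where "copoint C" "x \<inter> C = {0}"
    "\<And>b. linear b \<Longrightarrow> inj b \<Longrightarrow> (\<And>v. v \<in> x \<Longrightarrow> b v = v) \<Longrightarrow> (\<And>v. v \<in> C \<Longrightarrow> b v = - v) \<Longrightarrow>
      (b ` x1 = x1 \<and> b ` x2 = x2) \<or> (b ` x1 = x2 \<and> b ` x2 = x1)"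
proof -
  let ?D = "x1 \<inter> x2"
  note s1 = pointD(1)[OF x(1)] and s2 = pointD(1)[OF x(2)] and xs = pointD(1)[OF x(3)]
  have D: "subspace ?D" using s1 s2 by (rule subspace_inter)
  have Dx: "subspace (?D \<inter> x)" using D xs by (rule subspace_inter)
  \<comment> \<open>A complement of \<open>?D \<inter> x\<close> in \<open>?D\<close>. A map that
    fixes \<open>x\<close> and negates \<open>K\<close> preserves \<open>?D\<close>, so it remains
    to control one vector of each \<open>xi\<close> outside \<open>?D\<close>.\<close>
  define K where "K = {i \<in> ?D. \<forall>y\<in>?D \<inter> x. orthogonal y i}"
  have K: "subspace K" "K \<subseteq> ?D"
    using D by (auto simp: K_def subspace_def orthogonal_def inner_add_right)
  have Kx: "x \<inter> K = {0}"
  proof -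
    have "v = 0" if "v \<in> x" "v \<in> K" for v
    proof -
      have "orthogonal v v" using that unfolding K_def by blast
      then show ?thesis by (simp add: orthogonal_self)
    qed
    moreover have "0 \<in> x" "0 \<in> K" using xs K(1) subspace_0 by auto
    ultimately show ?thesis by blast
  qed
  have isoK: "iso K" using K(2) pointD(3)[OF x(1)] by (auto simp: iso_def)
  have dec: "\<exists>y\<in>?D \<inter> x. \<exists>i\<in>K. v = y + i" if v: "v \<in> ?D" for v
  proof -
    obtain y z where yz: "y \<in> span (?D \<inter> x)" "\<And>w. w \<in> span (?D \<inter> x) \<Longrightarrow> orthogonal z w" "v = y + z"
      using orthogonal_subspace_decomp_exists[of "?D \<inter> x" v] by blast
    have y: "y \<in> ?D \<inter> x" using yz(1) span_eq_iff[THEN iffD2, OF Dx] by simp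
    have "z = v - y" using yz(3) by simp
    then have "z \<in> ?D" using v y D subspace_diff by blast
    moreover have "orthogonal w z" if "w \<in> ?D \<inter> x" for w
      using yz(2)[OF span_base[OF that]] by (rule orthogonal_commute[THEN iffD1])
    ultimately have "z \<in> K" unfolding K_def by blast
    then show ?thesis using y yz(3) by blast
  qed
  have bD: "b v \<in> ?D"
    if b: "linear b" "\<And>v. v \<in> x \<Longrightarrow> b v = v" "\<And>v. v \<in> K \<Longrightarrow> b v = - v" and v: "v \<in> ?D" for b v
  proof -
    obtain y i where yi: "y \<in> ?D \<inter> x" "i \<in> K" "v = y + i" using dec[OF v] by blast
    then have "b v = y - i" using b by (simp add: linear_add[OF b(1)])
    moreover have "y \<in> ?D" "i \<in> ?D" using yi K(2) by auto
    ultimately show ?thesis using subspace_diff[OF D] by simp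
  qed
  \<comment> \<open>Vectors of \<open>?D + x\<close> need no further condition: if u = v + y with v
    in \<open>?D\<close> and y in \<open>x\<close>, then b u = b v + (u - v) stays in every subspace
    that contains \<open>?D\<close> and \<open>u\<close>.\<close>
  have bDx: "b u \<in> S"
    if b: "linear b" "\<And>v. v \<in> x \<Longrightarrow> b v = v" "\<And>v. v \<in> K \<Longrightarrow> b v = - v"
      and u: "u \<in> setsums ?D x" "u \<in> S" and S: "subspace S" "?D \<subseteq> S" for b u S
  proof -
    obtain v y where vy: "v \<in> ?D" "y \<in> x" "u = v + y" using u(1) by blast
    have "b u = b v + (u - v)" using vy b(2)[OF vy(2)] by (simp add: linear_add[OF b(1)])
    moreover have "b v \<in> S" using bD[OF b vy(1)] S(2) by blast
    moreover have "v \<in> S" using vy(1) S(2) by blast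
    ultimately show ?thesis using u(2) S(1) by (simp add: subspace_add subspace_diff)
  qed
  have img: "b ` S \<subseteq> S'"
    if b: "linear b" "\<And>v. v \<in> x \<Longrightarrow> b v = v" "\<And>v. v \<in> K \<Longrightarrow> b v = - v"
      and S: "S = span (insert u ?D)" and S': "b u \<in> S'" "subspace S'" "?D \<subseteq> S'" for b S S' u
  proof
    fix w assume "w \<in> b ` S"
    then obtain t where t: "t \<in> S" "w = b t" by blast
    obtain c s where s: "s \<in> ?D" "t = s + c *\<^sub>R u" using t(1) unfolding S in_span_insert[OF D] by blast
    have "w = b s + c *\<^sub>R b u" using t(2) s(2) by (simp add: linear_add[OF b(1)] linear_scale[OF b(1)])
    moreover have "b s \<in> S'" using bD[OF b s(1)] S'(3) by blast
    ultimately show "w \<in> S'" using S'(1,2) by (simp add: subspace_add subspace_scale)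
  qed
  have "\<not> x1 \<subseteq> x2" "\<not> x2 \<subseteq> x1" using point_eqI x by blast+
  then obtain u1 u2 where u: "u1 \<in> x1" "u1 \<notin> x2" "u2 \<in> x2" "u2 \<notin> x1" by blast
  have d': "dim (x2 \<inter> x1) + 1 = k" using d by (simp add: Int_commute)
  have x1: "x1 = span (insert v ?D)" if "v \<in> x1" "v \<notin> x2" for v using meet_hyperplane[OF x(1,2) d that] .
  have x2: "x2 = span (insert v ?D)" if "v \<in> x2" "v \<notin> x1" for v
    using meet_hyperplane[OF x(2,1) d' that] by (simp add: Int_commute)
  have Kadd: "subspace (span (insert v K))" "iso (span (insert v K))" "x \<inter> span (insert v K) = {0}"
    if "v \<notin> setsums ?D x" "\<And>i. i \<in> K \<Longrightarrow> B i v = 0" for v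
  proof -
    have "v \<notin> setsums x K" using that(1) K(2) by (auto simp: add.commute)
    then show "x \<inter> span (insert v K) = {0}" by (rule disjoint_insert[OF xs K(1) Kx])
    show "iso (span (insert v K))" by (intro iso_span iso_insert isoK that(2))
  qed simp
  have Kb: "B i v = 0" if "i \<in> K" "v \<in> x1 \<or> v \<in> x2" for i v
    using that K(2) pointD(3)[OF x(1)] pointD(3)[OF x(2)] by blast
  have "\<exists>I. subspace I \<and> iso I \<and> x \<inter> I = {0} \<and> (\<forall>b. linear b \<and> (\<forall>v\<in>x. b v = v) \<and> (\<forall>v\<in>I. b v = - v) \<longrightarrow>
      (b ` x1 \<subseteq> x1 \<and> b ` x2 \<subseteq> x2) \<or> (b ` x1 \<subseteq> x2 \<and> b ` x2 \<subseteq> x1))"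
    (is "\<exists>I. ?good I")
  proof -
    have Dsub: "?D \<subseteq> x1" "?D \<subseteq> x2" by auto
    \<comment> \<open>The cases record which combinations of \<open>u1\<close> and \<open>u2\<close>
      lie in \<open>?D + x\<close>. A generator outside this sum may be put into the complement,
      where it is negated; in case \<open>swap\<close> only one combination may be added, and the
      reflection exchanges the points.\<close>
    consider (both) "u1 \<in> setsums ?D x" "u2 \<in> setsums ?D x" | (one) "u1 \<in> setsums ?D x" "u2 \<notin> setsums ?D x"
      | (two) "u1 \<notin> setsums ?D x" "u2 \<in> setsums ?D x" | (swap) c where "u1 \<notin> setsums ?D x" "u2 \<notin> setsums ?D x" "u1 + c *\<^sub>R u2 \<in> setsums ?D x"
      | (neither) "u2 \<notin> setsums ?D x" "\<And>c. u1 + c *\<^sub>R u2 \<notin> setsums ?D x"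
      by blast
    then show ?thesis
    proof cases
      case both
      have "?good K"
      proof (intro conjI allI impI; (elim conjE)?)
        fix b :: "'v \<Rightarrow> 'v" assume b: "linear b" "\<forall>v\<in>x. b v = v" "\<forall>v\<in>K. b v = - v"
        note b' = b(1) b(2)[rule_format] b(3)[rule_format]
        show "(b ` x1 \<subseteq> x1 \<and> b ` x2 \<subseteq> x2) \<or> (b ` x1 \<subseteq> x2 \<and> b ` x2 \<subseteq> x1)"
          using img[OF b' x1[OF u(1,2)] bDx[OF b' both(1) u(1) s1 Dsub(1)] s1 Dsub(1)]
            img[OF b' x2[OF u(3,4)] bDx[OF b' both(2) u(3) s2 Dsub(2)] s2 Dsub(2)] by blast
      qed (use K isoK Kx in auto)
      then show ?thesis by (rule exI)
    next
      case one
      let ?I = "span (insert u2 K)"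
      have KI: "K \<subseteq> ?I" "u2 \<in> ?I" by (auto intro: span_base)
      have "?good ?I"
      proof (intro conjI allI impI; (elim conjE)?)
        fix b :: "'v \<Rightarrow> 'v" assume b: "linear b" "\<forall>v\<in>x. b v = v" "\<forall>v\<in>?I. b v = - v"
        have b': "linear b" "\<And>v. v \<in> x \<Longrightarrow> b v = v" "\<And>v. v \<in> K \<Longrightarrow> b v = - v"
          by (rule b(1), erule b(2)[rule_format], erule b(3)[rule_format, OF subsetD[OF KI(1)]])
        have "b u2 \<in> x2" using b(3)[rule_format, OF KI(2)] subspace_neg[OF s2 u(3)] by simp
        then show "(b ` x1 \<subseteq> x1 \<and> b ` x2 \<subseteq> x2) \<or> (b ` x1 \<subseteq> x2 \<and> b ` x2 \<subseteq> x1)"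
          using img[OF b' x1[OF u(1,2)] bDx[OF b' one(1) u(1) s1 Dsub(1)] s1 Dsub(1)]
            img[OF b' x2[OF u(3,4)] _ s2 Dsub(2)] by blast
      qed (use Kadd[OF one(2) Kb[OF _ disjI2[OF u(3)]]] in simp_all)
      then show ?thesis by (rule exI)
    next
      case two
      let ?I = "span (insert u1 K)"
      have KI: "K \<subseteq> ?I" "u1 \<in> ?I" by (auto intro: span_base)
      have "?good ?I"
      proof (intro conjI allI impI; (elim conjE)?)
        fix b :: "'v \<Rightarrow> 'v" assume b: "linear b" "\<forall>v\<in>x. b v = v" "\<forall>v\<in>?I. b v = - v"
        have b': "linear b" "\<And>v. v \<in> x \<Longrightarrow> b v = v" "\<And>v. v \<in> K \<Longrightarrow> b v = - v"
          by (rule b(1), erule b(2)[rule_format], erule b(3)[rule_format, OF subsetD[OF KI(1)]])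
        have "b u1 \<in> x1" using b(3)[rule_format, OF KI(2)] subspace_neg[OF s1 u(1)] by simp
        then show "(b ` x1 \<subseteq> x1 \<and> b ` x2 \<subseteq> x2) \<or> (b ` x1 \<subseteq> x2 \<and> b ` x2 \<subseteq> x1)"
          using img[OF b' x2[OF u(3,4)] bDx[OF b' two(2) u(3) s2 Dsub(2)] s2 Dsub(2)]
            img[OF b' x1[OF u(1,2)] _ s1 Dsub(1)] by blast
      qed (use Kadd[OF two(1) Kb[OF _ disjI1[OF u(1)]]] in simp_all)
      then show ?thesis by (rule exI)
    next
      case swap
      then obtain v y where vy: "v \<in> ?D" "y \<in> x" "u1 + c *\<^sub>R u2 = v + y" by blast
      \<comment> \<open>Representatives are rescaled so that \<open>v1 - v2\<close> lies in
        \<open>x\<close>. Putting \<open>v1 + v2\<close> into the complement makes the reflection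
        fix the difference and negate the sum, whence \<open>v1\<close> goes to \<open>- v2\<close>
        and \<open>v2\<close> to \<open>- v1\<close>.\<close>
      define v1 where "v1 = u1 - v"
      define v2 where "v2 = - c *\<^sub>R u2"
      have v12: "v1 - v2 = y" using vy(3) by (simp add: v1_def v2_def algebra_simps)
      have DxS: "subspace (setsums ?D x)" by (rule subspace_sums[OF D xs])
      have inDx: "w \<in> setsums ?D x" if "w \<in> ?D" for w using that xs subspace_0 by force
      have inDx': "w \<in> setsums ?D x" if "w \<in> x" for w using that D subspace_0 by force
      have v1: "v1 \<in> x1" "v1 \<notin> x2" "v1 \<notin> setsums ?D x"
      proof -
        show "v1 \<in> x1" using u(1) vy(1) s1 by (simp add: v1_def subspace_diff)
        have "u1 = v1 + v" by (simp add: v1_def)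
        then show "v1 \<notin> setsums ?D x" using swap(1) subspace_add[OF DxS _ inDx[OF vy(1)], of v1] by auto
        show "v1 \<notin> x2" using \<open>u1 = v1 + v\<close> u(2) vy(1) subspace_add[OF s2, of v1 v] by auto
      qed
      have v2: "v2 \<in> x2" "v2 \<notin> x1"
      proof -
        show "v2 \<in> x2" using u(3) s2 by (simp add: v2_def subspace_scale subspace_neg)
        show "v2 \<notin> x1"
        proof
          assume "v2 \<in> x1"
          then have "v2 \<in> setsums ?D x" using \<open>v2 \<in> x2\<close> inDx by blast
          then have "v2 + y \<in> setsums ?D x" by (rule subspace_add[OF DxS _ inDx'[OF vy(2)]])
          moreover have "v2 + y = v1" using v12 by (simp add: algebra_simps)
          ultimately show False using v1(3) by (simp only:)
        qed
      qed
      let ?I = "span (insert (v1 + v2) K)"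
      have n: "v1 + v2 \<notin> setsums ?D x"
      proof
        assume "v1 + v2 \<in> setsums ?D x"
        then have "(v1 + v2) + (v1 - v2) \<in> setsums ?D x"
          unfolding v12 by (rule subspace_add[OF DxS _ inDx'[OF vy(2)]])
        then have "(1/2) *\<^sub>R ((v1 + v2) + (v1 - v2)) \<in> setsums ?D x" by (rule subspace_scale[OF DxS])
        moreover have "(1/2) *\<^sub>R ((v1 + v2) + (v1 - v2)) = v1" by (simp flip: scaleR_2)
        ultimately show False using v1(3) by simp
      qed
      have KI: "K \<subseteq> ?I" "v1 + v2 \<in> ?I" by (auto intro: span_base)
      have "?good ?I"
      proof (intro conjI allI impI; (elim conjE)?)
        fix b :: "'v \<Rightarrow> 'v" assume b: "linear b" "\<forall>v\<in>x. b v = v" "\<forall>v\<in>?I. b v = - v"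
        have b': "linear b" "\<And>v. v \<in> x \<Longrightarrow> b v = v" "\<And>v. v \<in> K \<Longrightarrow> b v = - v"
          by (rule b(1), erule b(2)[rule_format], erule b(3)[rule_format, OF subsetD[OF KI(1)]])
        have 1: "b v1 + b v2 = - (v1 + v2)" "b v1 - b v2 = v1 - v2"
          using b(3) KI(2) b(2) vy(2) unfolding v12
          by (simp_all flip: linear_diff[OF b(1)] linear_add[OF b(1)] add: v12)
        have "2 *\<^sub>R b v1 = (b v1 + b v2) + (b v1 - b v2)" "2 *\<^sub>R b v2 = (b v1 + b v2) - (b v1 - b v2)"
          by (simp_all add: scaleR_2)
        then have "2 *\<^sub>R b v1 = 2 *\<^sub>R (- v2)" "2 *\<^sub>R b v2 = 2 *\<^sub>R (- v1)"
          unfolding 1 by (simp_all add: scaleR_2)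
        then have "b v1 = - v2" "b v2 = - v1" by (simp_all only: scaleR_cancel_left) simp_all
        then have "b v1 \<in> x2" "b v2 \<in> x1" using subspace_neg[OF s2 v2(1)] subspace_neg[OF s1 v1(1)] by simp_all
        then show "(b ` x1 \<subseteq> x1 \<and> b ` x2 \<subseteq> x2) \<or> (b ` x1 \<subseteq> x2 \<and> b ` x2 \<subseteq> x1)"
          using img[OF b' x1[OF v1(1,2)] _ s2 Dsub(2)] img[OF b' x2[OF v2] _ s1 Dsub(1)] by blast
      next
        have "B i (v1 + v2) = 0" if "i \<in> K" for i using Kb[OF that] v1 v2 by (simp add: B_simps)
        note Kadd = Kadd[OF n this]
        show "subspace ?I" "iso ?I" "x \<inter> ?I = {0}" by (simp_all add: Kadd)
      qed
      then show ?thesis by (rule exI)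
    next
      case neither
      \<comment> \<open>For a nondegenerate form some nonzero combination of \<open>u1\<close> and
        \<open>u2\<close> always lies in \<open>?D + x\<close>, so this case belongs to
        \<open>B = 0\<close>. There isotropy is free and both vectors may be added to
        \<open>K\<close>.\<close>
      have B0: "\<forall>x y. B x y = 0"
      proof (rule ccontr)
        assume "\<not> (\<forall>x y. B x y = 0)"
        then have nd: nondeg using disj by blast
        obtain \<alpha> \<beta> where ab: "\<alpha> \<noteq> 0 \<or> \<beta> \<noteq> 0" "\<alpha> *\<^sub>R u1 + \<beta> *\<^sub>R u2 \<in> setsums ?D x"
          by (rule pencil_meets[OF nd x(1-3) d u])
        have DxS: "subspace (setsums ?D x)" by (rule subspace_sums[OF D xs])
        show False
        proof (cases "\<alpha> = 0")
          case True
          have "\<beta> *\<^sub>R u2 \<in> setsums ?D x" using ab(2) unfolding True scaleR_zero_left add_0_left .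
          then have "(1/\<beta>) *\<^sub>R (\<beta> *\<^sub>R u2) \<in> setsums ?D x" by (rule subspace_scale[OF DxS])
          moreover have "(1/\<beta>) *\<^sub>R (\<beta> *\<^sub>R u2) = u2" using True ab(1) by simp
          ultimately show False using neither(1) by (simp only:)
        next
          case False
          have "(1/\<alpha>) *\<^sub>R (\<alpha> *\<^sub>R u1 + \<beta> *\<^sub>R u2) \<in> setsums ?D x" by (rule subspace_scale[OF DxS ab(2)])
          moreover have "(1/\<alpha>) *\<^sub>R (\<alpha> *\<^sub>R u1 + \<beta> *\<^sub>R u2) = u1 + (\<beta>/\<alpha>) *\<^sub>R u2"
            using False by (simp add: scaleR_add_right)
          ultimately show False using neither(2)[of "\<beta>/\<alpha>"] by (simp only:)
        qed
      qed
      let ?J = "span (insert u2 K)" and ?I = "span (insert u1 (span (insert u2 K)))"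
      note J = Kadd[OF neither(1) B0[rule_format]]
      have "u1 \<notin> setsums x ?J"
      proof
        assume "u1 \<in> setsums x ?J"
        then obtain y j where yj: "y \<in> x" "j \<in> ?J" "u1 = y + j" by blast
        then obtain c i where ci: "i \<in> K" "j = i + c *\<^sub>R u2" unfolding in_span_insert[OF K(1)] by blast
        have "u1 + (- c) *\<^sub>R u2 = i + y" using yj ci by (simp add: algebra_simps)
        then show False using neither(2)[of "- c"] ci(1) yj(1) K(2) by blast
      qed
      then have dI: "x \<inter> ?I = {0}" by (rule disjoint_insert[OF xs subspace_span J(3)])
      have KI: "K \<subseteq> ?I" "u1 \<in> ?I" "u2 \<in> ?I" by (auto intro: span_base)
      have "?good ?I"
      proof (intro conjI allI impI; (elim conjE)?)
        fix b :: "'v \<Rightarrow> 'v" assume b: "linear b" "\<forall>v\<in>x. b v = v" "\<forall>v\<in>?I. b v = - v"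
        have b': "linear b" "\<And>v. v \<in> x \<Longrightarrow> b v = v" "\<And>v. v \<in> K \<Longrightarrow> b v = - v"
          by (rule b(1), erule b(2)[rule_format], erule b(3)[rule_format, OF subsetD[OF KI(1)]])
        have "b u1 \<in> x1" "b u2 \<in> x2"
          using b(3)[rule_format, OF KI(2)] b(3)[rule_format, OF KI(3)] subspace_neg[OF s1 u(1)]
            subspace_neg[OF s2 u(3)] by simp_all
        then show "(b ` x1 \<subseteq> x1 \<and> b ` x2 \<subseteq> x2) \<or> (b ` x1 \<subseteq> x2 \<and> b ` x2 \<subseteq> x1)"
          using img[OF b' x2[OF u(3,4)] _ s2 Dsub(2)] img[OF b' x1[OF u(1,2)] _ s1 Dsub(1)] by blast
      qed (use B0 dI in \<open>simp_all add: iso_def\<close>)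
      then show ?thesis by (rule exI)
    qed
  qed
  then obtain I where I: "subspace I" "iso I" "x \<inter> I = {0}"
    "\<And>b. linear b \<Longrightarrow> \<forall>v\<in>x. b v = v \<Longrightarrow> \<forall>v\<in>I. b v = - v \<Longrightarrow>
      (b ` x1 \<subseteq> x1 \<and> b ` x2 \<subseteq> x2) \<or> (b ` x1 \<subseteq> x2 \<and> b ` x2 \<subseteq> x1)"
    by (elim exE conjE) metis
  \<comment> \<open>Enlarging \<open>I\<close> is harmless, since a map that negates
    \<open>C\<close> negates \<open>I\<close>. One point is to be avoided, so it takes both roles in
    the extension.\<close>
  then obtain C where C: "copoint C" "I \<subseteq> C" "x \<inter> C = {0}" using isotropic_extension[OF x(3,3) I(1,2,3,3)] by blast
  show ?thesis
  proof (rule that[OF C(1,3)])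
    fix b :: "'v \<Rightarrow> 'v" assume b: "linear b" "inj b" "\<And>v. v \<in> x \<Longrightarrow> b v = v" "\<And>v. v \<in> C \<Longrightarrow> b v = - v"
    have "\<forall>v\<in>x. b v = v" "\<forall>v\<in>I. b v = - v" using b(3,4) C(2) by blast+
    then have "(b ` x1 \<subseteq> x1 \<and> b ` x2 \<subseteq> x2) \<or> (b ` x1 \<subseteq> x2 \<and> b ` x2 \<subseteq> x1)" by (rule I(4)[OF b(1)])
    then show "(b ` x1 = x1 \<and> b ` x2 = x2) \<or> (b ` x1 = x2 \<and> b ` x2 = x1)"
      using point_image_eq[OF b(1,2)] x by blast
  qed
qed

text \<open>The sum of one vector from each point, both outside the intersection, spans with the
  intersection a third member of the pencil.\<close>

lemma pencil_point:
  assumes x: "point x1" "point x2" "x1 \<noteq> x2" and d: "dim (x1 \<inter> x2) + 1 = k"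
  obtains z where "point z" "z \<noteq> x1" "z \<noteq> x2" "z \<subseteq> setsums x1 x2"
proof -
  let ?D = "x1 \<inter> x2"
  note s1 = pointD(1)[OF x(1)] and s2 = pointD(1)[OF x(2)]
  have D: "subspace ?D" using s1 s2 by (rule subspace_inter)
  have "\<not> x1 \<subseteq> x2" "\<not> x2 \<subseteq> x1" using point_eqI x by blast+
  then obtain u1 u2 where u: "u1 \<in> x1" "u1 \<notin> x2" "u2 \<in> x2" "u2 \<notin> x1" by blast
  let ?z = "span (insert (u1 + u2) ?D)"
  have n1: "u1 + u2 \<notin> x1" using u s1 by (metis add_diff_cancel_left' subspace_diff)
  have n2: "u1 + u2 \<notin> x2" using u s2 by (metis add_diff_cancel_right' subspace_diff)
  have "point ?z"
  proof (rule point_insert[OF D d])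
    show "iso ?D" using pointD(3)[OF x(1)] by (auto simp: iso_def)
    show "u1 + u2 \<notin> ?D" using n1 by blast
    show "B v (u1 + u2) = 0" if "v \<in> ?D" for v
      using that u pointD(3)[OF x(1)] pointD(3)[OF x(2)] by (auto simp: B_simps)
  qed
  moreover have "u1 + u2 \<in> ?z" by (auto intro: span_base)
  moreover have "?z \<subseteq> setsums x1 x2"
  proof (rule span_minimal[OF _ subspace_sums[OF s1 s2]])
    have "v \<in> setsums x1 x2" if "v \<in> x1" for v using that s2 subspace_0 by force
    then show "insert (u1 + u2) ?D \<subseteq> setsums x1 x2" using u by blast
  qed
  ultimately show ?thesis using that n1 n2 by blast
qed


text \<open>The abelian Lie algebra opposite to the stabilizer of \<open>W\<close>, which models the
  tangent space at \<open>W\<close>: all maps from \<open>W\<close> to \<open>F\<close>, extended by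
  0 on \<open>F\<close>, for which \<open>B (X w) w'\<close> is symmetric in \<open>w\<close> and
  \<open>w'\<close>.\<close>

definition nil :: "('v \<Rightarrow> 'v) \<Rightarrow> bool" where
  "nil X \<longleftrightarrow> linear X \<and> (\<forall>v. X v \<in> F) \<and> (\<forall>f\<in>F. X f = 0) \<and>
    (\<forall>w\<in>W. \<forall>w'\<in>W. B (X w) w' + B w (X w') = 0)"

lemma nil_E: "linear X \<Longrightarrow> (\<And>f. f \<in> F \<Longrightarrow> X f = 0) \<Longrightarrow> X (E v) = X v"
  using linear_diff[of X v "E v"] E(3)[of v] by simp

text \<open>In \<open>B (x + X x) (y + X y)\<close> the cross terms depend only on the components in
  \<open>W\<close> and cancel by the infinitesimal condition; the quadratic term vanishes because
  \<open>F\<close> is isotropic.\<close>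

lemma nil_similitude:
  assumes "nil X"
  shows "similitude (\<lambda>v. v + X v)"
proof -
  have X: "linear X" "\<And>v. X v \<in> F" "\<And>f. f \<in> F \<Longrightarrow> X f = 0" "\<And>w w'. w \<in> W \<Longrightarrow> w' \<in> W \<Longrightarrow> B (X w) w' + B w (X w') = 0"
    using assms by (auto simp: nil_def)
  have lin: "linear (\<lambda>v. v + X v)" using X(1) by (intro linear_compose_add linear_ident)
  have "inj (\<lambda>v. v + X v)"
    unfolding linear_injective_0[OF lin]
  proof (intro allI impI)
    fix v assume 0: "v + X v = 0"
    then have "X (v + X v) = 0" using linear_0[OF X(1)] by simp
    then have "X v = 0" using X(2,3) by (simp add: linear_add[OF X(1)])
    then show "v = 0" using 0 by simp
  qed
  moreover have "B (x + X x) (y + X y) = 1 * B x y" for x y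
  proof -
    have F0: "B f f' = 0" if "f \<in> F" "f' \<in> F" for f f' using F(3) that .
    have XE: "X (E v) = X v" for v by (rule nil_E[OF X(1,3)])
    have 1: "B (X x) y = B (X x) (E y)"
    proof -
      have "B (X x) (y - E y) = 0" by (rule F0[OF X(2) E(3)])
      then show ?thesis by (simp add: B_simps)
    qed
    have 2: "B x (X y) = B (E x) (X y)"
    proof -
      have "B (x - E x) (X y) = 0" by (rule F0[OF E(3) X(2)])
      then show ?thesis by (simp add: B_simps)
    qed
    have "B (X x) y + B x (X y) = 0" using X(4)[OF E(2) E(2), of x y] 1 2 by (simp add: XE)
    then show ?thesis using F0[OF X(2) X(2), of x y] by (simp add: B_simps)
  qed
  ultimately show ?thesis unfolding similitude_def using lin by (metis zero_neq_one)
qed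

text \<open>The graph of \<open>X\<close> over \<open>W\<close> lies in the image of
  \<open>W\<close> under a similitude and is therefore isotropic. As \<open>W\<close> and
  \<open>F\<close> are isotropic too, this is exactly the infinitesimal condition.\<close>

lemma nilI:
  assumes X: "linear X" "\<And>v. X v \<in> F" "\<And>f. f \<in> F \<Longrightarrow> X f = 0" and g: "similitude g"
    and cov: "\<And>w. w \<in> W \<Longrightarrow> \<exists>w'\<in>W. w + X w = g w'"
  shows "nil X"
proof -
  have "B (X w) w' + B w (X w') = 0" if w: "w \<in> W" "w' \<in> W" for w w'
  proof -
    obtain v v' where v: "v \<in> W" "w + X w = g v" "v' \<in> W" "w' + X w' = g v'" using cov w by blast
    obtain c where "B (g v) (g v') = c * B v v'" using g unfolding similitude_def by blast
    then have "B (w + X w) (w' + X w') = 0" using v W(3) by simp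
    then show ?thesis using W(3)[OF w] F(3)[OF X(2) X(2), of w w'] by (simp add: B_simps)
  qed
  then show ?thesis using X by (simp add: nil_def)
qed

lemma nil_combine: "nil X \<Longrightarrow> nil Y \<Longrightarrow> nil (\<lambda>v. a *\<^sub>R X v + b *\<^sub>R Y v)"
proof -
  assume XY: "nil X" "nil Y"
  then have "linear (\<lambda>v. a *\<^sub>R X v + b *\<^sub>R Y v)"
    by (intro linear_compose_add linear_compose_scale_right) (auto simp: nil_def)
  moreover have "B (a *\<^sub>R X w + b *\<^sub>R Y w) w' + B w (a *\<^sub>R X w' + b *\<^sub>R Y w') = 0" if "w \<in> W" "w' \<in> W" for w w'
  proof -
    have "B (a *\<^sub>R X w + b *\<^sub>R Y w) w' + B w (a *\<^sub>R X w' + b *\<^sub>R Y w')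
      = a * (B (X w) w' + B w (X w')) + b * (B (Y w) w' + B w (Y w'))"
      by (simp add: B_simps algebra_simps)
    then show ?thesis using XY that by (simp add: nil_def)
  qed
  ultimately show ?thesis
    using XY F(1) unfolding nil_def by (auto intro!: subspace_add subspace_scale)
qed

text \<open>Rank-one tangent vectors are the test maps of the following arguments: they exist in
  both series and isolate one vector of \<open>F\<close> and one covector on
  \<open>W\<close>.\<close>

definition rank_one :: "('v \<Rightarrow> real) \<Rightarrow> 'v \<Rightarrow> bool" where
  "rank_one \<phi> f \<longleftrightarrow> f \<in> F \<and> f \<noteq> 0 \<and> nil (\<lambda>v. \<phi> v *\<^sub>R f)"

lemma rank_one_inner: "\<forall>x y. B x y = 0 \<Longrightarrow> f \<in> F \<Longrightarrow> f \<noteq> 0 \<Longrightarrow> rank_one (\<lambda>v. w \<bullet> E v) f"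
  using F(1) unfolding rank_one_def nil_def
  by (auto intro!: linearI subspace_scale simp: linear_add[OF E(1)] linear_scale[OF E(1)] inner_add_right algebra_simps)

text \<open>In the symplectic case the symmetry condition ties the covector to the vector: it has to
  be pairing with \<open>f\<close> itself, up to scale, which corresponds to the square of
  \<open>f\<close>.\<close>

lemma rank_one_B: "f \<in> F \<Longrightarrow> f \<noteq> 0 \<Longrightarrow> rank_one (\<lambda>v. B f (E v)) f"
proof -
  assume f: "f \<in> F" "f \<noteq> 0"
  have "B f w * B f w' + B f w' * B w f = 0" for w w' using B_sym[of w f] by simp
  then show ?thesis
    using f F(1) unfolding rank_one_def nil_def
    by (auto intro!: linearI subspace_scale simp: linear_add[OF E(1)] linear_scale[OF E(1)] B_simps algebra_simps)
qed

lemma W_nonzero: "\<exists>w\<in>W. w \<noteq> 0" and F_nonzero: "\<exists>f\<in>F. f \<noteq> 0"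
proof -
  have "\<not> W \<subseteq> {0}" using W(2) k(1) dim_eq_0[of W] by auto
  then show "\<exists>w\<in>W. w \<noteq> 0" by blast
  have "\<not> F \<subseteq> {0}" using F(2) k(2) dim_eq_0[of F] by auto
  then show "\<exists>f\<in>F. f \<noteq> 0" by blast
qed

lemma rank_one_covector:
  assumes "f \<in> F" "f \<noteq> 0"
  obtains \<phi> w where "rank_one \<phi> f" "w \<in> W" "\<phi> w \<noteq> 0"
proof (cases "\<forall>x y. B x y = 0")
  case True
  obtain w where "w \<in> W" "w \<noteq> 0" using W_nonzero by blast
  then show ?thesis using that[OF rank_one_inner[OF True assms, of w], of w] by simp
next
  case False
  then have nd: nondeg using disj by blast
  have "f \<notin> perp W" using perp_point[OF nd point_W] W_F assms by auto
  then obtain w where "w \<in> W" "B w f \<noteq> 0" by (auto simp: perp_def)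
  then show ?thesis using that[OF rank_one_B[OF assms], of w] B_sym[of f w] by simp
qed

lemma rank_one_vector:
  assumes w: "w \<in> W" "w \<noteq> 0"
  obtains \<phi> f where "rank_one \<phi> f" "\<phi> w \<noteq> 0"
proof (cases "\<forall>x y. B x y = 0")
  case True
  obtain f where "f \<in> F" "f \<noteq> 0" using F_nonzero by blast
  then show ?thesis using that[OF rank_one_inner[OF True, of f w]] w by simp
next
  case False
  then have nd: nondeg using disj by blast
  have "\<exists>f\<in>F. B w f \<noteq> 0"
  proof (rule ccontr)
    assume "\<not> ?thesis"
    then have "B w (v - E v) = 0" for v using E(3) by blast
    moreover have "B w (E v) = 0" for v by (rule W(3)[OF w(1) E(2)])
    ultimately have "B w v = 0" for v using bilinear_rsub[OF bilin, of w v "E v"] by simp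
    then show False using nd w(2) by blast
  qed
  then obtain f where f: "f \<in> F" "B w f \<noteq> 0" by blast
  then have "f \<noteq> 0" by (auto simp: B_simps)
  then show ?thesis using that[OF rank_one_B[OF f(1)]] f(2) w(1) B_sym[of f w] by simp
qed

text \<open>Every vector of \<open>F\<close> is an eigenvector of \<open>p\<close> modulo \<open>W\<close>, so \<open>p\<close> is a scalar on the
  quotient by \<open>W\<close>; the rank-one maps then determine \<open>p\<close> on \<open>W\<close>.\<close>

lemma anticommuting_scalar:
  assumes p: "linear p" "\<And>w. w \<in> W \<Longrightarrow> p w \<in> W"
    and anti: "\<And>X w. nil X \<Longrightarrow> w \<in> W \<Longrightarrow> p (X w) + X (p w) \<in> W"
  obtains r where "\<And>w. w \<in> W \<Longrightarrow> p w = r *\<^sub>R w" "\<And>f. f \<in> F \<Longrightarrow> p f + r *\<^sub>R f \<in> W"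
proof -
  \<comment> \<open>For a rank-one map with image the line of \<open>f\<close>, the hypothesis says
    that \<open>\<phi> w\<close> times \<open>p f\<close> is a multiple of \<open>f\<close> modulo
    \<open>W\<close>.\<close>
  have eig: "\<exists>r. p f + r *\<^sub>R f \<in> W" if f: "f \<in> F" "f \<noteq> 0" for f
  proof -
    obtain \<phi> w where \<phi>: "rank_one \<phi> f" "w \<in> W" "\<phi> w \<noteq> 0" by (rule rank_one_covector[OF f])
    have "p (\<phi> w *\<^sub>R f) + \<phi> (p w) *\<^sub>R f \<in> W" using anti \<phi>(1,2) unfolding rank_one_def by blast
    then have "(1 / \<phi> w) *\<^sub>R (\<phi> w *\<^sub>R p f + \<phi> (p w) *\<^sub>R f) \<in> W"
      using W(1) by (simp only: linear_scale[OF p(1)] subspace_scale)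
    then show ?thesis using \<phi>(3) by (auto simp: scaleR_add_right)
  qed
  have FW: "f = 0" if "f \<in> F" "f \<in> W" for f using W_F that by blast
  obtain f0 where f0: "f0 \<in> F" "f0 \<noteq> 0" using F_nonzero by blast
  obtain r where r: "p f0 + r *\<^sub>R f0 \<in> W" using eig[OF f0] by blast
  \<comment> \<open>All eigenvalues agree by comparing \<open>f\<close>, \<open>f0\<close> and
    \<open>f + f0\<close>; the comparison modulo \<open>W\<close> is exact because \<open>F\<close>
    meets \<open>W\<close> only in 0.\<close>
  have F': "p f + r *\<^sub>R f \<in> W" if f: "f \<in> F" for f
  proof (cases "f \<in> span {f0}")
    case True
    then obtain c where "f = c *\<^sub>R f0" by (auto simp: span_singleton)
    then have "p f + r *\<^sub>R f = c *\<^sub>R (p f0 + r *\<^sub>R f0)" by (simp add: linear_scale[OF p(1)] algebra_simps)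
    then show ?thesis using r W(1) by (simp add: subspace_scale)
  next
    case False
    have ne: "f \<noteq> 0" using False span_zero by auto
    have ne2: "f + f0 \<noteq> 0"
    proof
      assume "f + f0 = 0"
      then have "f = - f0" by (simp add: eq_neg_iff_add_eq_0)
      then show False using False span_neg[OF span_base, of f0 "{f0}"] by simp
    qed
    obtain s where s: "p f + s *\<^sub>R f \<in> W" using eig[OF f ne] by blast
    have "f + f0 \<in> F" using f f0 F(1) subspace_add by blast
    then obtain t where t: "p (f + f0) + t *\<^sub>R (f + f0) \<in> W" using eig[OF _ ne2] by blast
    have "(t - s) *\<^sub>R f + (t - r) *\<^sub>R f0 = (p (f + f0) + t *\<^sub>R (f + f0)) - (p f + s *\<^sub>R f) - (p f0 + r *\<^sub>R f0)"
      by (simp add: linear_add[OF p(1)] algebra_simps)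
    also have "\<dots> \<in> W" using s t r W(1) by (intro subspace_diff)
    finally have "(t - s) *\<^sub>R f + (t - r) *\<^sub>R f0 \<in> W" .
    moreover have "(t - s) *\<^sub>R f + (t - r) *\<^sub>R f0 \<in> F" using f f0 F(1) by (intro subspace_add subspace_scale)
    ultimately have 0: "(t - s) *\<^sub>R f + (t - r) *\<^sub>R f0 = 0" using FW by blast
    have "t = s"
    proof (rule ccontr)
      assume "t \<noteq> s"
      have "(t - s) *\<^sub>R f = (- (t - r)) *\<^sub>R f0"
        using 0 unfolding scaleR_minus_left eq_neg_iff_add_eq_0 .
      then have "(1 / (t - s)) *\<^sub>R ((t - s) *\<^sub>R f) = (1 / (t - s)) *\<^sub>R ((- (t - r)) *\<^sub>R f0)" by (simp only:)
      then have "f = ((1 / (t - s)) * (- (t - r))) *\<^sub>R f0" using \<open>t \<noteq> s\<close> by (simp only: scaleR_scaleR) simp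
      moreover have "((1 / (t - s)) * (- (t - r))) *\<^sub>R f0 \<in> span {f0}" by (intro span_scale span_base) simp
      ultimately show False using False by simp
    qed
    with 0 have "t = r" using f0 by simp
    then show ?thesis using s \<open>t = s\<close> by simp
  qed
  have "p w = r *\<^sub>R w" if w: "w \<in> W" for w
  proof (rule ccontr)
    \<comment> \<open>A nonzero defect would be detected by a rank-one map with
      \<open>\<phi> ?d \<noteq> 0\<close>: the hypothesis for it, corrected by the known values on
      \<open>F\<close>, puts a nonzero multiple of \<open>f\<close> into \<open>W\<close>.\<close>
    let ?d = "p w - r *\<^sub>R w"
    assume "p w \<noteq> r *\<^sub>R w"
    then have d: "?d \<in> W" "?d \<noteq> 0" using w p(2) W(1) by (auto intro: subspace_diff subspace_scale)
    obtain \<phi> f where \<phi>: "rank_one \<phi> f" "\<phi> ?d \<noteq> 0" by (rule rank_one_vector[OF d])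
    then have f: "f \<in> F" "f \<noteq> 0" and X: "nil (\<lambda>v. \<phi> v *\<^sub>R f)" by (auto simp: rank_one_def)
    have "p (\<phi> w *\<^sub>R f) + \<phi> (p w) *\<^sub>R f \<in> W" using anti[OF X w] .
    moreover have "\<phi> w *\<^sub>R (p f + r *\<^sub>R f) \<in> W" using F'[OF f(1)] W(1) subspace_scale by blast
    ultimately have "(p (\<phi> w *\<^sub>R f) + \<phi> (p w) *\<^sub>R f) - \<phi> w *\<^sub>R (p f + r *\<^sub>R f) \<in> W"
      using W(1) subspace_diff by blast
    moreover have "(p (\<phi> w *\<^sub>R f) + \<phi> (p w) *\<^sub>R f) - \<phi> w *\<^sub>R (p f + r *\<^sub>R f) = \<phi> ?d *\<^sub>R f"
    proof -
      have l: "linear (\<lambda>v. \<phi> v *\<^sub>R f)" using X by (simp add: nil_def)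
      have "\<phi> ?d *\<^sub>R f = \<phi> (p w) *\<^sub>R f - r *\<^sub>R (\<phi> w *\<^sub>R f)" using linear_diff[OF l] linear_scale[OF l] by simp
      then show ?thesis by (simp add: linear_scale[OF p(1)] algebra_simps)
    qed
    ultimately have "\<phi> ?d *\<^sub>R f \<in> W" by simp
    moreover have "\<phi> ?d *\<^sub>R f \<in> F" using f F(1) subspace_scale by blast
    ultimately show False using FW \<phi>(2) f by fastforce
  qed
  then show ?thesis using that F' by blast
qed

lemma similitude_point:
  assumes g: "similitude g" and x: "point x"
  shows "point (g ` x)"
proof -
  have lin: "linear g" and inj: "inj_on g (span x)" using g inj_on_subset by (auto simp: similitude_def)
  have "iso (g ` x)" using g x unfolding similitude_def point_def iso_def by (metis imageE mult_zero_right)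
  then show ?thesis
    using x dim_image_eq[OF lin inj] linear_subspace_image[OF lin] by (simp add: point_def)
qed

text \<open>The zero map contributes \<open>W\<close>, and a rank-one map then contributes its image
  line, which may be any line of \<open>F\<close>. Consequently some graph is not contained in a
  given proper subspace.\<close>

lemma graph_points_span:
  assumes T: "subspace T" and all: "\<And>X. nil X \<Longrightarrow> (\<lambda>v. v + X v) ` W \<subseteq> T"
  shows "T = UNIV"
proof -
  have "nil (\<lambda>v. 0)" using F(1) by (auto simp: nil_def linear_zero subspace_0 B_simps)
  from all[OF this] have WT: "W \<subseteq> T" by simp
  have "f \<in> T" if f: "f \<in> F" for f
  proof (cases "f = 0")
    case True then show ?thesis using T subspace_0 by blast
  next
    case False
    obtain \<phi> w where \<phi>: "rank_one \<phi> f" "w \<in> W" "\<phi> w \<noteq> 0" by (rule rank_one_covector[OF f False])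
    then have "w + \<phi> w *\<^sub>R f \<in> T" using all unfolding rank_one_def by blast
    then have "(w + \<phi> w *\<^sub>R f) - w \<in> T" using WT \<phi>(2) T subspace_diff by blast
    then have "(1 / \<phi> w) *\<^sub>R (\<phi> w *\<^sub>R f) \<in> T" using T subspace_scale by (metis add_diff_cancel_left')
    then show ?thesis using \<phi>(3) by simp
  qed
  then have "v \<in> T" for v using decomp[of v] WT E(2,3) T subspace_add by (metis subsetD)
  then show ?thesis by blast
qed

text \<open>A map \<open>r\<close> of \<open>W\<close> takes \<open>D\<close> to
  \<open>W \<inter> y\<close>, and \<open>C\<close> is a complement of \<open>W\<close> containing
  some \<open>u\<close> in \<open>y\<close> outside \<open>W\<close>. A compatible map from
  \<open>F\<close> to \<open>C\<close> must still send \<open>f\<close> into the line of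
  \<open>u\<close>: for a nondegenerate form this is automatic, because
  \<open>C \<inter> perp (W \<inter> y)\<close> is a line containing both, and for
  \<open>B = 0\<close> an isometry of \<open>C\<close> corrects it.\<close>

lemma transitive_on_pairs:
  assumes y: "point y" "y \<noteq> W" "dim (W \<inter> y) + 1 = k"
    and W': "subspace D" "D \<subseteq> W" "dim D + 1 = k" "f \<in> F" "f \<noteq> 0" "point (span (insert f D))"
  obtains g where "similitude g" "g ` W = W" "g ` span (insert f D) = y"
proof -
  note sW = W(1) and sy = pointD(1)[OF y(1)]
  have sM: "subspace (W \<inter> y)" using sW sy by (rule subspace_inter)
  obtain r where r: "linear r" "inj r" "r ` W = W" "r ` D = W \<inter> y"
    by (rule hyperplane_map[OF sW W'(1,2) _ sM]) (use W'(3) W(2) y(3) in auto)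
  have rW: "inj_on r W" using r(2) inj_on_subset by blast
  have "\<not> y \<subseteq> W" using point_eqI[OF y(1) point_W] y(2) by blast
  then obtain u where u: "u \<in> y" "u \<notin> W" by blast
  have sI: "subspace (span {u})" by simp
  have "iso {u}" by (simp add: iso_def alt)
  then have isoI: "iso (span {u})" by (rule iso_span)
  have "W \<inter> span (insert u {0}) = {0}"
  proof (rule disjoint_insert[OF sW])
    show "u \<notin> setsums W {0}" using u(2) by simp
    show "W \<inter> {0} = {0}" using sW subspace_0 by blast
  qed simp
  then have dis: "W \<inter> span {u} = {0}" by (simp add: insert_commute)
  obtain C where C: "copoint C" "span {u} \<subseteq> C" "W \<inter> C = {0}"
    using isotropic_extension[OF point_W point_W sI isoI dis dis] by blast
  have uC: "u \<in> C" "u \<noteq> 0" using C(2) span_base u(2) sW subspace_0 by auto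
  have pr: "point (r ` W)" "r ` W \<inter> C = {0}" using r(3) point_W C(3) by auto
  obtain h where h: "linear h" "inj_on h F" "h ` F = C" "\<And>w f. w \<in> W \<Longrightarrow> f \<in> F \<Longrightarrow> B (r w) (h f) = B w f"
    by (rule map_copoint[OF r(1) rW pr(1) C(1) pr(2)]) blast
  have hf0: "h f \<noteq> 0"
    using h(2) W'(4,5) F(1) linear_0[OF h(1)] unfolding inj_on_def by (metis subspace_0)
  have "\<exists>h. linear h \<and> inj_on h F \<and> h ` F = C \<and> (\<forall>w\<in>W. \<forall>f\<in>F. B (r w) (h f) = B w f) \<and> h f \<in> y"
  proof (cases "\<forall>x y. B x y = 0")
    case True
    have "h f \<in> C" using h(3) W'(4) by blast
    then obtain s where s: "linear s" "inj s" "s ` C = C" "s (h f) \<in> span {u}"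
      using householder[of C "h f" u] C(1) uC hf0 by (metis copoint_def)
    have "linear (s \<circ> h)" by (rule linear_compose[OF h(1) s(1)])
    moreover have "inj_on (s \<circ> h) F" using h(2) s(2) by (meson comp_inj_on inj_on_subset subset_UNIV)
    moreover have "(s \<circ> h) ` F = C" using h(3) s(3) by (metis image_comp)
    moreover have "(s \<circ> h) f \<in> y" using s(4) u(1) sy by (auto simp: span_singleton subspace_scale)
    ultimately show ?thesis using True by (intro exI[of _ "s \<circ> h"]) auto
  next
    case False
    then have nd: nondeg using disj by blast
    have sC: "subspace C" using C(1) by (simp add: copoint_def)
    have "h f \<in> perp (W \<inter> y)"
      unfolding perp_def
    proof (intro CollectI ballI)
      fix d assume "d \<in> W \<inter> y"
      then obtain d' where d': "d' \<in> D" "d = r d'" using r(4) by blast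
      have "B d' f = 0" using pointD(3)[OF W'(6) span_base span_base, of d' f] d'(1) by simp
      then show "B d (h f) = 0" using h(4)[of d' f] d' W'(2,4) by auto
    qed
    moreover have "u \<in> perp (W \<inter> y)" using u(1) pointD(3)[OF y(1)] by (auto simp: perp_def)
    moreover have "h f \<in> C" using h(3) W'(4) by blast
    ultimately have hu: "h f \<in> C \<inter> perp (W \<inter> y)" "u \<in> C \<inter> perp (W \<inter> y)" using uC by auto
    \<comment> \<open>\<open>C\<close> is Lagrangian, so this is the \<open>perp\<close> of
      \<open>C + (W \<inter> y)\<close>, a sum of dimension 2k - 1.\<close>
    have Cp: "C \<inter> perp (W \<inter> y) = perp (setsums C (W \<inter> y))"
    proof -
      have "point C" using C(1) nd by (simp add: copoint_def point_def)
      then show ?thesis using perp_sums[OF sC sM] perp_point[OF nd] by simp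
    qed
    have "C \<inter> (W \<inter> y) = {0}" using C(3) sM subspace_0 sC by blast
    then have "dim (setsums C (W \<inter> y)) = k + (k - 1)"
      using dim_disjoint_sums[OF sC sM] C(1) nd y(3) by (simp add: copoint_def)
    then have d1: "dim (C \<inter> perp (W \<inter> y)) = 1"
      unfolding Cp using dim_perp[OF nd subspace_sums[OF sC sM]] nd k(1) by simp
    have "span {u} = C \<inter> perp (W \<inter> y)"
    proof (rule subspace_dim_equal[OF subspace_span])
      show "subspace (C \<inter> perp (W \<inter> y))" using sC subspace_perp by (rule subspace_inter)
      show "span {u} \<subseteq> C \<inter> perp (W \<inter> y)" using hu(2) \<open>subspace (C \<inter> perp (W \<inter> y))\<close> by (intro span_minimal) auto
      show "dim (C \<inter> perp (W \<inter> y)) \<le> dim (span {u})" using d1 uC(2) by (simp add: dim_insert)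
    qed
    then have "h f \<in> span {u}" using hu(1) by simp
    then have "h f \<in> y" using u(1) sy by (auto simp: span_singleton subspace_scale)
    then show ?thesis using h by blast
  qed
  then obtain h where h: "linear h" "inj_on h F" "h ` F = C" "\<And>w f. w \<in> W \<Longrightarrow> f \<in> F \<Longrightarrow> B (r w) (h f) = B w f" "h f \<in> y"
    by blast
  define g where "g v = r (E v) + h (v - E v)" for v
  have g: "similitude g" "\<And>w. w \<in> W \<Longrightarrow> g w = r w" "\<And>f. f \<in> F \<Longrightarrow> g f = h f"
    unfolding g_def by (rule similitude_extend[OF r(1) rW pr(1) C(1) pr(2) h(1-4)]; assumption)+
  have lin: "linear g" "inj g" using g(1) by (auto simp: similitude_def)
  have "g ` insert f D \<subseteq> y" using g(2,3) W'(2,4) h(5) r(4) by fastforce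
  then have "g ` span (insert f D) \<subseteq> y"
    using linear_span_image[OF lin(1)] sy by (metis span_minimal)
  then have "g ` span (insert f D) = y" by (rule point_image_eq[OF lin W'(6) y(1)])
  moreover have "g ` W = W" using g(2) r(3) by (auto simp: image_def)
  ultimately show ?thesis using that g(1) by blast
qed

end

section \<open>Groups of similitudes\<close>

lemma bounded_bilinearI_linear:
  fixes h :: "'a::euclidean_space \<Rightarrow> 'b::euclidean_space \<Rightarrow> 'c::real_normed_vector"
  assumes "\<And>x. linear (h x)" "\<And>y. linear (\<lambda>x. h x y)"
  shows "bounded_bilinear h"
  using assms by (simp add: bilinear_def flip: bilinear_conv_bounded_bilinear)

lemmas mv_simps = matrix_vector_mul_assoc[symmetric] matrix_vector_mult_add_rdistrib
  matrix_vector_mult_diff_rdistrib matrix_vector_mult_diff_distrib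
  matrix_vector_right_distrib matrix_vector_mul_lid

lemma bounded_bilinear_matrix_mul: "bounded_bilinear ((**) :: real^'n^'n \<Rightarrow> real^'n^'n \<Rightarrow> real^'n^'n)"
  by (rule bounded_bilinearI_linear; rule linearI)
    (simp_all add: matrix_eq mv_simps matrix_vector_mult_scaleR scaleR_matrix_vector_assoc[symmetric])

global_interpretation mat: fd_algebra "(**)" "mat 1 :: real^'n^'n"
  by (rule fd_algebra.intro[OF bounded_bilinear_matrix_mul]) (simp_all add: matrix_mul_assoc)

lemma bounded_bilinear_mv: "bounded_bilinear ((*v) :: real^'n^'m \<Rightarrow> real^'n \<Rightarrow> real^'m)"
  by (rule bounded_bilinearI_linear; rule linearI)
    (simp_all add: mv_simps matrix_vector_mult_scaleR scaleR_matrix_vector_assoc[symmetric])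

lemma mat_unit_iff: "mat.unit A \<longleftrightarrow> invertible A"
  by (simp add: mat.unit_def invertible_def)

lemma mat_unitI: "(\<And>v. A *v v = 0 \<Longrightarrow> v = 0) \<Longrightarrow> mat.unit (A :: real^'n^'n)"
  unfolding mat_unit_iff invertible_left_inverse matrix_left_invertible_injective
  using linear_injective_0[of "(*v) A"] matrix_vector_mul_linear by blast

lemma mat_ainv_v [simp]:
  "mat.unit A \<Longrightarrow> mat.ainv A *v (A *v v) = v" "mat.unit A \<Longrightarrow> A *v (mat.ainv A *v v) = (v :: real^'n)"
  by (simp_all add: matrix_vector_mul_assoc mat.ainv)

lemma mat_unit_inj: "mat.unit A \<Longrightarrow> inj ((*v) (A :: real^'n^'n))"
  by (metis injI mat_ainv_v(1))

lemma mv_fun: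
  fixes X Y :: "real^'n^'n"
  shows "(*v) (mat 1 + X) = (\<lambda>v. v + X *v v)" "(*v) (X + Y) = (\<lambda>v. X *v v + Y *v v)"
    "(*v) (c *\<^sub>R X) = (\<lambda>v. c *\<^sub>R (X *v v))"
  by (simp_all add: fun_eq_iff mv_simps scaleR_matrix_vector_assoc[symmetric])

lemma inner_transpose: "w \<bullet> (transpose A *v z) = (A *v w) \<bullet> z" for A :: "real^'n^'n"
  by (metis dot_lmul_matrix inner_commute transpose_matrix_vector)

locale matrix_geometry = isotropic_geometry B k W F E
  for B :: "real^'n \<Rightarrow> real^'n \<Rightarrow> real" and k W F E +
  fixes L :: "(real^'n^'n) monoid"
  assumes L_eq: "L = \<lparr>carrier = {A. similitude ((*v) A)}, monoid.mult = (**), one = mat 1\<rparr>"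
begin

abbreviation Em :: "real^'n^'n" where "Em \<equiv> matrix E"

lemma Em_v [simp]: "Em *v x = E x"
  by (rule fun_cong[OF matrix_vector_mul(2)[OF E(1)]])

lemma E_E [simp]: "E (E x) = E x"
  by (simp add: E(2))

lemma Em_idem [simp]: "Em ** Em = Em"
  by (simp add: matrix_eq mv_simps)

abbreviation LC :: "(real^'n^'n) set" where "LC \<equiv> carrier L"

lemma L_iff: "A \<in> LC \<longleftrightarrow> similitude ((*v) A)"
  by (simp add: L_eq)

lemma L_mult [simp]: "x \<otimes>\<^bsub>L\<^esub> y = x ** y" and L_one [simp]: "\<one>\<^bsub>L\<^esub> = mat 1"
  by (simp_all add: L_eq)

lemma L_unit: "A \<in> LC \<Longrightarrow> mat.unit A"
proof (rule mat_unitI)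
  fix v assume "A \<in> LC" "A *v v = 0"
  then show "v = 0" unfolding L_iff similitude_def inj_def by (metis matrix_vector_mult_0_right)
qed

lemma one_L: "mat 1 \<in> LC"
  by (auto simp: L_iff similitude_def inj_def matrix_vector_mul_linear intro!: exI[of _ 1])

lemma mul_L: "A \<in> LC \<Longrightarrow> A' \<in> LC \<Longrightarrow> A ** A' \<in> LC"
proof -
  assume A: "A \<in> LC" and A': "A' \<in> LC"
  obtain c where c: "c \<noteq> 0" "\<And>x y. B (A *v x) (A *v y) = c * B x y" using A by (auto simp: L_iff similitude_def)
  obtain c' where c': "c' \<noteq> 0" "\<And>x y. B (A' *v x) (A' *v y) = c' * B x y" using A' by (auto simp: L_iff similitude_def)
  have "\<exists>d. d \<noteq> 0 \<and> (\<forall>x y. B ((A ** A') *v x) ((A ** A') *v y) = d * B x y)"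
    using c c' by (intro exI[of _ "c * c'"]) (simp add: mv_simps)
  moreover have "inj ((*v) (A ** A'))" by (intro mat_unit_inj mat.unit_mul L_unit A A')
  ultimately show ?thesis by (simp add: L_iff similitude_def matrix_vector_mul_linear)
qed

lemma ainv_L: "A \<in> LC \<Longrightarrow> mat.ainv A \<in> LC"
proof -
  assume A: "A \<in> LC"
  obtain c where c: "c \<noteq> 0" "\<And>x y. B (A *v x) (A *v y) = c * B x y" using A by (auto simp: L_iff similitude_def)
  have "B (mat.ainv A *v x) (mat.ainv A *v y) = (1 / c) * B x y" for x y
    using c(2)[of "mat.ainv A *v x" "mat.ainv A *v y"] c(1) L_unit[OF A] by simp
  then have "\<exists>d. d \<noteq> 0 \<and> (\<forall>x y. B (mat.ainv A *v x) (mat.ainv A *v y) = d * B x y)"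
    using c(1) by (intro exI[of _ "1 / c"]) simp
  moreover have "inj ((*v) (mat.ainv A))" by (intro mat_unit_inj mat.unit_ainv L_unit A)
  ultimately show ?thesis by (simp add: L_iff similitude_def matrix_vector_mul_linear)
qed

lemma matrix_similitude: "similitude g \<Longrightarrow> matrix g \<in> LC" "similitude g \<Longrightarrow> (*v) (matrix g) = g"
proof -
  assume g: "similitude g"
  then have lin: "linear g" by (simp add: similitude_def)
  have eq: "(*v) (matrix g) = g" by (rule matrix_vector_mul(2)[OF lin])
  then show "matrix g \<in> LC" "(*v) (matrix g) = g" using g by (simp_all add: L_iff)
qed

sublocale L: unit_group "(**)" "mat 1" LC L
  by unfold_locales (use L_eq one_L mul_L ainv_L L_unit in auto)

declare L.carrier_G [simp del] \<comment> \<open>the reflexive equation would loop\<close>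

abbreviation act :: "real^'n^'n \<Rightarrow> (real^'n) set" where "act g \<equiv> (*v) g ` W"

abbreviation Q :: "(real^'n^'n) set" where "Q \<equiv> stab L W"

lemma point_act: "g \<in> LC \<Longrightarrow> point (act g)"
  unfolding L_iff by (rule similitude_point[OF _ point_W])

lemma act_mul: "act (g ** h) = (*v) g ` act h"
  by (simp add: image_image matrix_vector_mul_assoc)

lemma Q_iff: "g \<in> Q \<longleftrightarrow> g \<in> LC \<and> (\<forall>w\<in>W. g *v w \<in> W)"
proof
  assume g: "g \<in> LC \<and> (\<forall>w\<in>W. g *v w \<in> W)"
  then have "act g = W"
    by (intro point_image_eq[OF matrix_vector_mul_linear mat_unit_inj[OF L_unit] point_W point_W]) blast+
  then show "g \<in> Q" using g unfolding stab_def by blast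
next
  assume "g \<in> Q"
  then have "g \<in> LC" "act g = W" unfolding stab_def by blast+
  then show "g \<in> LC \<and> (\<forall>w\<in>W. g *v w \<in> W)" by (metis imageI)
qed

lemma Q_alg: "Q = {g \<in> LC. (mat 1 - Em) ** (g ** Em) = 0}"
proof -
  have "(\<forall>w\<in>W. g *v w \<in> W) \<longleftrightarrow> (mat 1 - Em) ** (g ** Em) = 0" for g
  proof
    assume "\<forall>w\<in>W. g *v w \<in> W"
    then have "E (g *v E x) = g *v E x" for x using E(2) by simp
    then show "(mat 1 - Em) ** (g ** Em) = 0" by (simp add: matrix_eq mv_simps)
  next
    assume *: "(mat 1 - Em) ** (g ** Em) = 0"
    show "\<forall>w\<in>W. g *v w \<in> W"
    proof
      fix w assume w: "w \<in> W"
      have "((mat 1 - Em) ** (g ** Em)) *v w = 0" by (simp add: *)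
      then have "g *v w = E (g *v w)" using w by (simp add: mv_simps)
      then show "g *v w \<in> W" using E(2) by metis
    qed
  qed
  then show ?thesis unfolding set_eq_iff mem_Collect_eq Q_iff by blast
qed

lemma act_eq_iff: "g \<in> LC \<Longrightarrow> h \<in> LC \<Longrightarrow> act g = act h \<longleftrightarrow> mat.ainv g ** h \<in> Q"
proof
  assume g: "g \<in> LC" and h: "h \<in> LC"
  {
    assume eq: "act g = act h"
    have "(mat.ainv g ** h) *v w \<in> W" if w: "w \<in> W" for w
    proof -
      have "h *v w \<in> act g" unfolding eq using w by (rule imageI)
      then obtain w' where w': "h *v w = g *v w'" "w' \<in> W" by (rule imageE)
      have "(mat.ainv g ** h) *v w = mat.ainv g *v (h *v w)" by (rule matrix_vector_mul_assoc[symmetric])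
      also have "\<dots> = w'" unfolding w'(1) by (rule mat_ainv_v(1)[OF L_unit[OF g]])
      finally show ?thesis using w'(2) by simp
    qed
    then show "mat.ainv g ** h \<in> Q" unfolding Q_iff using mul_L[OF ainv_L[OF g] h] by blast
  }
  assume q: "mat.ainv g ** h \<in> Q"
  then have "act (mat.ainv g ** h) = W" unfolding stab_def by blast
  then have "act (g ** (mat.ainv g ** h)) = act g" by (simp only: act_mul)
  then show "act g = act h" unfolding mat.ainv_cancel(1)[OF L_unit[OF g]] by (rule sym)
qed

lemma ainv_Q: "q \<in> Q \<Longrightarrow> mat.ainv q \<in> Q"
proof -
  assume "q \<in> Q"
  then have q: "q \<in> LC" "act q = W" unfolding stab_def by blast+
  then have "act q = act (mat 1)" by simp
  then show ?thesis using act_eq_iff[OF q(1) one_L] by simp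
qed

text \<open>Written in the shape that \<open>flat_parabolic\<close> demands of \<open>H\<close>.
  Linearity is hidden in the condition \<open>mat 1 + X \<in> LC\<close>; it emerges from the
  identification with \<open>nil\<close>.\<close>

definition HH :: "(real^'n^'n) set" where
  "HH = {X. (mat 1 - Em) ** (X ** Em) = X \<and> mat 1 + X \<in> LC}"

lemma HH_iff: "X \<in> HH \<longleftrightarrow> nil ((*v) X)"
proof
  assume X: "X \<in> HH"
  then have eq: "X *v v = X *v E v - E (X *v E v)" for v
  proof -
    have "((mat 1 - Em) ** (X ** Em)) *v v = X *v v" using X by (simp add: HH_def)
    then show ?thesis
      unfolding matrix_vector_mul_assoc[symmetric] matrix_vector_mult_diff_rdistrib matrix_vector_mul_lid Em_v
      by (rule sym)
  qed
  have s: "similitude ((*v) (mat 1 + X))" using X by (simp add: HH_def L_iff)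
  show "nil ((*v) X)"
  proof (rule nilI[OF _ _ _ s])
    show "X *v v \<in> F" for v by (subst eq) (rule E(3))
    show "X *v f = 0" if "f \<in> F" for f by (subst eq) (simp add: that linear_0[OF E(1)])
    show "\<exists>w'\<in>W. w + X *v w = (mat 1 + X) *v w'" if "w \<in> W" for w
      using that by (intro bexI[of _ w]) (simp_all add: mv_simps)
  qed (rule matrix_vector_mul_linear)
next
  assume X: "nil ((*v) X)"
  then have "X *v (E v) = X *v v" "E (X *v v) = 0" for v
    using nil_E[of "(*v) X"] by (auto simp: nil_def)
  then have "(mat 1 - Em) ** (X ** Em) = X" by (simp add: matrix_eq mv_simps)
  moreover have "mat 1 + X \<in> LC" using nil_similitude[OF X] by (simp add: L_iff mv_fun)
  ultimately show "X \<in> HH" by (simp add: HH_def)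
qed

lemma subspace_HH: "subspace HH"
proof (rule subspaceI)
  show "0 \<in> HH" by (simp add: HH_def one_L)
  fix X Y :: "real^'n^'n" and c assume X: "X \<in> HH"
  show "X + Y \<in> HH" if Y: "Y \<in> HH"
    using nil_combine[of "(*v) X" "(*v) Y" 1 1] X Y by (simp add: HH_iff mv_fun(2))
  show "c *\<^sub>R X \<in> HH"
    using nil_combine[of "(*v) X" "(*v) X" c 0] X by (simp add: HH_iff mv_fun(3))
qed

text \<open>The matrix \<open>X\<close> is the slope of \<open>act g\<close> as a graph over
  \<open>W\<close> in the direction of \<open>F\<close>, so \<open>nilI\<close> applies with the
  similitude \<open>g\<close>.\<close>

lemma cell_L:
  assumes g: "g \<in> LC" and u: "mat.unit (Em ** (g ** Em) + (mat 1 - Em))"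
  shows "mat 1 + (mat 1 - Em) ** (g ** (Em ** mat.ainv (Em ** (g ** Em) + (mat 1 - Em)))) \<in> LC"
proof -
  let ?K = "Em ** (g ** Em) + (mat 1 - Em)"
  define Y where "Y = mat.ainv ?K"
  define X where "X = (mat 1 - Em) ** (g ** (Em ** Y))"
  have K: "?K *v v = E (g *v E v) + (v - E v)" for v by (simp add: mv_simps)
  have KY: "E (g *v E (Y *v v)) + (Y *v v - E (Y *v v)) = v" for v
    using mat_ainv_v(2)[OF u, of v] unfolding K Y_def .
  have X_v: "X *v v = g *v E (Y *v v) - E (g *v E (Y *v v))" for v by (simp add: X_def mv_simps)
  have "nil ((*v) X)"
  proof (rule nilI)
    show "linear ((*v) X)" by (rule matrix_vector_mul_linear)
    show "X *v v \<in> F" for v unfolding X_v by (rule E(3))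
    show "X *v f = 0" if f: "f \<in> F" for f
    proof -
      have "?K *v f = f" using f by (simp add: K linear_0[OF E(1)])
      then have "Y *v f = f" using mat_ainv_v(1)[OF u, of f] by (simp add: Y_def)
      then show ?thesis using f by (simp add: X_v linear_0[OF E(1)])
    qed
    show "similitude ((*v) g)" using g by (simp add: L_iff)
    show "\<exists>w'\<in>W. w + X *v w = g *v w'" if w: "w \<in> W" for w
    proof -
      have "Y *v w - E (Y *v w) = w - E (g *v E (Y *v w))" using KY[of w] by (simp add: algebra_simps)
      moreover have "w - E (g *v E (Y *v w)) \<in> W" using w E(2) W(1) subspace_diff by blast
      ultimately have "Y *v w - E (Y *v w) = 0" using W_F E(3) by metis
      then have "E (g *v E (Y *v w)) = w" using KY[of w] by simp
      then have "w + X *v w = g *v E (Y *v w)" by (simp add: X_v)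
      then show ?thesis using E(2) by blast
    qed
  qed
  then show ?thesis using nil_similitude by (simp add: L_iff mv_fun(1) flip: X_def Y_def)
qed

text \<open>If \<open>act g\<close> avoids \<open>F\<close>, its projection along \<open>F\<close>
  to \<open>W\<close> is injective, which says that the leading block of \<open>g\<close> is
  invertible.\<close>

lemma transverse_unit:
  assumes g: "g \<in> LC" and t: "act g \<inter> F = {0}"
  shows "mat.unit (Em ** (g ** Em) + (mat 1 - Em))"
proof (rule mat_unitI)
  fix v assume "(Em ** (g ** Em) + (mat 1 - Em)) *v v = 0"
  then have 0: "E (g *v E v) + (v - E v) = 0" by (simp add: mv_simps)
  then have "E (g *v E v) = - (v - E v)" by (simp only: eq_neg_iff_add_eq_0)
  moreover have "- (v - E v) \<in> F" using E(3) F(1) subspace_neg by blast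
  ultimately have 1: "E (g *v E v) = 0" using W_F E(2) by metis
  then have "g *v E v \<in> F" using E(3)[of "g *v E v"] by simp
  then have "g *v E v = 0" using t E(2) by blast
  then have "E v = 0" using mat_ainv_v(1)[OF L_unit[OF g], of "E v"] by simp
  then show "v = 0" using 0 1 by simp
qed

lemma point_exists:
  assumes "point x"
  obtains g where "g \<in> LC" "act g = x"
proof -
  have s0: "subspace {0 :: real^'n}" "iso {0}" by (auto simp: iso_def alt)
  have z: "x \<inter> {0} = {0}" using pointD(1)[OF assms] subspace_0 by blast
  obtain C where C: "copoint C" "x \<inter> C = {0}" using isotropic_extension[OF assms assms s0 z z] by blast
  obtain g where g: "similitude g" "g ` W = x" "g ` F = C" by (rule similitude_exists[OF assms C])
  have "act (matrix g) = x" unfolding matrix_similitude(2)[OF g(1)] by (rule g(2))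
  then show ?thesis using that matrix_similitude(1)[OF g(1)] by blast
qed

text \<open>The frame \<open>u\<close> is chosen with \<open>u F\<close> equal to a common
  complement of both points; pulled back by \<open>u\<close>, both points become transverse to
  \<open>F\<close>.\<close>

lemma common_complement:
  assumes g: "g1 \<in> LC" "g2 \<in> LC"
  obtains u where "u \<in> LC" "mat.unit (Em ** ((mat.ainv u ** g1) ** Em) + (mat 1 - Em))"
    "mat.unit (Em ** ((mat.ainv u ** g2) ** Em) + (mat 1 - Em))"
proof -
  have s0: "subspace {0 :: real^'n}" "iso {0}" by (auto simp: iso_def alt)
  have z: "act g1 \<inter> {0} = {0}" "act g2 \<inter> {0} = {0}"
    using pointD(1)[OF point_act] g subspace_0 by blast+
  obtain C where C: "copoint C" "act g1 \<inter> C = {0}" "act g2 \<inter> C = {0}"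
    using isotropic_extension[OF point_act[OF g(1)] point_act[OF g(2)] s0 z] by blast
  obtain h where h: "similitude h" "h ` W = act g1" "h ` F = C"
    by (rule similitude_exists[OF point_act[OF g(1)] C(1,2)])
  define u where "u = matrix h"
  have u: "u \<in> LC" "\<And>x. u *v x = h x"
    unfolding u_def by (rule matrix_similitude(1)[OF h(1)], rule fun_cong[OF matrix_similitude(2)[OF h(1)]])
  have tr: "act (mat.ainv u ** g) \<inter> F = {0}" if gL: "g \<in> LC" and gC: "act g \<inter> C = {0}" for g
  proof -
    have "f = 0" if f: "f \<in> act (mat.ainv u ** g)" "f \<in> F" for f
    proof -
      obtain w where w: "w \<in> W" "f = (mat.ainv u ** g) *v w" using f(1) by (elim imageE)
      have eq: "u *v f = g *v w"
        unfolding w(2) matrix_vector_mul_assoc mat.ainv_cancel(1)[OF L_unit[OF u(1)]] by (rule refl)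
      have "u *v f \<in> C" unfolding u(2) h(3)[symmetric] using f(2) by (rule imageI)
      moreover have "u *v f \<in> act g" unfolding eq using w(1) by (rule imageI)
      ultimately have "u *v f = 0" using gC by blast
      then show "f = 0" using mat_ainv_v(1)[OF L_unit[OF u(1)], of f] by simp
    qed
    moreover have "0 \<in> act (mat.ainv u ** g)" "0 \<in> F"
      using subspace_0[OF pointD(1)[OF point_act[OF mul_L[OF ainv_L[OF u(1)] gL]]]] subspace_0[OF F(1)] by blast+
    ultimately show ?thesis by blast
  qed
  show ?thesis
    by (rule that[OF u(1)]) (intro transverse_unit tr mul_L ainv_L u(1) g C)+
qed

lemma reflection_v: "(Em + Em - mat 1) *v v = E v - (v - E v)"
  by (simp only: mv_simps Em_v) simp

text \<open>The reflection multiplies \<open>B\<close> by -1. In series (C) it is anti-symplectic,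
  so the conformal group contains it while the symplectic group does not.\<close>

lemma reflection_L: "Em + Em - mat 1 \<in> LC"
proof -
  have "B (E x - (x - E x)) (E y - (y - E y)) = - 1 * B x y" for x y
  proof -
    have z: "B (E x) (E y) = 0" "B (x - E x) (y - E y) = 0" using W(3) F(3) E by auto
    have "B (E x - (x - E x)) (E y - (y - E y)) = - (B (E x) (y - E y) + B (x - E x) (E y))"
      unfolding bilinear_lsub[OF bilin, of "E x" "x - E x"] bilinear_rsub[OF bilin, of _ "E y" "y - E y"] using z by simp
    also have "B (E x) (y - E y) + B (x - E x) (E y) = B (E x + (x - E x)) (E y + (y - E y))"
      using z unfolding bilinear_ladd[OF bilin] bilinear_radd[OF bilin] by simp
    finally show ?thesis by simp
  qed
  then have "\<exists>c. c \<noteq> 0 \<and> (\<forall>x y. B ((Em + Em - mat 1) *v x) ((Em + Em - mat 1) *v y) = c * B x y)"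
    unfolding reflection_v by (intro exI[of _ "-1"]) simp
  moreover have "mat.unit (Em + Em - mat 1)"
  proof (rule mat_unitI)
    fix v assume "(Em + Em - mat 1) *v v = 0"
    then have eq: "E v = v - E v" by (simp only: reflection_v) simp
    then have "E v = 0" using W_F[of "E v"] E(2,3) by metis
    then show "v = 0" using eq by simp
  qed
  ultimately show ?thesis using mat_unit_inj by (simp add: L_iff similitude_def matrix_vector_mul_linear)
qed

lemma graph_unique:
  assumes X: "X \<in> HH" and Y: "Y \<in> HH" and eq: "act (mat 1 + X) = act (mat 1 + Y)"
  shows "X = Y"
proof -
  note nX = X[unfolded HH_iff nil_def] and nY = Y[unfolded HH_iff nil_def]
  have W: "X *v w = Y *v w" if w: "w \<in> W" for w
  proof -
    have "(mat 1 + X) *v w \<in> act (mat 1 + Y)" using eq w by blast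
    then obtain w' where w': "w' \<in> W" "w + X *v w = w' + Y *v w'" by (auto simp: mv_simps)
    have "E (w + X *v w) = E (w' + Y *v w')" using w'(2) by simp
    then have "w = w'" using w w'(1) nX nY by (simp add: linear_add[OF E(1)])
    then show ?thesis using w'(2) by simp
  qed
  have "X *v v = Y *v v" for v
    using W[OF E(2)] nil_E[of "(*v) X" v] nil_E[of "(*v) Y" v] nX nY by simp
  then show ?thesis by (simp add: matrix_eq)
qed

text \<open>\<open>F\<close> has dimension at least 2, and rank-one maps with independent image
  lines are independent.\<close>

lemma HH_not_collinear:
  assumes "k + 1 < CARD('n)"
  shows "\<not> collinear HH"
proof
  assume col: "collinear HH"
  obtain f1 where f1: "f1 \<in> F" "f1 \<noteq> 0" using F_nonzero by blast
  have "\<not> F \<subseteq> span {f1}"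
  proof
    assume "F \<subseteq> span {f1}"
    then have "dim F \<le> card {f1}" by (rule dim_le_card) simp
    then show False using F(2) assms by simp
  qed
  then obtain f2 where f2: "f2 \<in> F" "f2 \<notin> span {f1}" by blast
  then have f20: "f2 \<noteq> 0" using span_zero by auto
  obtain \<phi> w where \<phi>: "rank_one \<phi> f1" "w \<in> W" "\<phi> w \<noteq> 0" by (rule rank_one_covector[OF f1])
  obtain \<phi>' w' where \<phi>': "rank_one \<phi>' f2" "w' \<in> W" "\<phi>' w' \<noteq> 0" by (rule rank_one_covector[OF f2(1) f20])
  define X where "X = matrix (\<lambda>v. \<phi> v *\<^sub>R f1)"
  define Y where "Y = matrix (\<lambda>v. \<phi>' v *\<^sub>R f2)"
  have X': "(*v) X = (\<lambda>v. \<phi> v *\<^sub>R f1)" and Y': "(*v) Y = (\<lambda>v. \<phi>' v *\<^sub>R f2)"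
    unfolding X_def Y_def using \<phi>(1) \<phi>'(1) by (auto simp: rank_one_def nil_def intro!: matrix_vector_mul(2))
  have X: "X *v v = \<phi> v *\<^sub>R f1" and Y: "Y *v v = \<phi>' v *\<^sub>R f2" for v
    using fun_cong[OF X'] fun_cong[OF Y'] by auto
  have XY: "X \<in> HH" "Y \<in> HH" using \<phi>(1) \<phi>'(1) by (auto simp: HH_iff X' Y' rank_one_def)
  have "collinear {0, X, Y}" using col by (rule collinear_subset) (use XY subspace_HH subspace_0 in auto)
  then have "X = 0 \<or> Y = 0 \<or> (\<exists>c. Y = c *\<^sub>R X)" by (simp add: collinear_lemma)
  moreover have "X \<noteq> 0" using X[of w] \<phi>(3) f1 by auto
  moreover have "Y \<noteq> 0" using Y[of w'] \<phi>'(3) f20 by auto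
  moreover have "Y \<noteq> c *\<^sub>R X" for c
  proof
    assume "Y = c *\<^sub>R X"
    then have "\<phi>' w' *\<^sub>R f2 = c *\<^sub>R (\<phi> w' *\<^sub>R f1)" using X[of w'] Y[of w'] by (simp add: scaleR_matrix_vector_assoc[symmetric])
    then have "(1 / \<phi>' w') *\<^sub>R (\<phi>' w' *\<^sub>R f2) = (1 / \<phi>' w') *\<^sub>R (c *\<^sub>R (\<phi> w' *\<^sub>R f1))" by (simp only:)
    then have "f2 = (1 / \<phi>' w' * c * \<phi> w') *\<^sub>R f1" using \<phi>'(3) by simp
    then show False using f2(2) span_scale[OF span_base, of f1 "{f1}"] by simp
  qed
  ultimately show False by blast
qed

end

context matrix_geometry
begin

section \<open>Orthogonal projections as test functions\<close>

lemma inner_E: "w \<in> W \<Longrightarrow> w \<bullet> E v = w \<bullet> v"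
proof -
  assume w: "w \<in> W"
  have "w \<bullet> (v - E v) = 0" by (rule orth[OF w E(3)])
  then show ?thesis by (simp add: inner_diff_right)
qed

text \<open>The orthogonal projection onto \<open>b W\<close>. Its entries are globally smooth functions of the
  coset of \<open>b\<close> that detect all tangent directions.\<close>

definition gram :: "real^'n^'n \<Rightarrow> real^'n^'n" where
  "gram b = Em ** (transpose b ** (b ** Em)) + (mat 1 - Em)"

definition proj :: "real^'n^'n \<Rightarrow> real^'n^'n" where
  "proj b = b ** (Em ** (mat.ainv (gram b) ** (Em ** transpose b)))"

lemma gram_v: "gram b *v v = E (transpose b *v (b *v E v)) + (v - E v)"
  unfolding gram_def mv_simps Em_v by (rule refl)

lemma proj_v: "proj b *v v = b *v E (mat.ainv (gram b) *v E (transpose b *v v))"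
  unfolding proj_def mv_simps Em_v by (rule refl)

lemma W_F_sum: "x \<in> W \<Longrightarrow> y \<in> F \<Longrightarrow> x + y = 0 \<Longrightarrow> x = 0 \<and> y = 0"
proof -
  assume xy: "x \<in> W" "y \<in> F" "x + y = 0"
  then have "x = - y" by (simp add: eq_neg_iff_add_eq_0)
  then have "x \<in> F" using xy(2) F(1) subspace_neg by blast
  then have "x = 0" by (rule W_F[OF xy(1)])
  then show ?thesis using xy(3) by simp
qed

text \<open>\<open>gram b\<close> is the Gram operator of \<open>b\<close> on \<open>W\<close>,
  completed by the identity on \<open>F\<close>; a vector \<open>v\<close> in its kernel satisfies
  \<open>b *v E v = 0\<close>.\<close>

lemma gram_unit:
  assumes b: "b \<in> LC"
  shows "mat.unit (gram b)"
proof (rule mat_unitI)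
  fix v assume "gram b *v v = 0"
  then have "E (transpose b *v (b *v E v)) + (v - E v) = 0" by (simp only: gram_v)
  then have 0: "E (transpose b *v (b *v E v)) = 0" "v - E v = 0"
    using W_F_sum[OF E(2) E(3)] by blast+
  have "E v \<bullet> (transpose b *v (b *v E v)) = 0" using inner_E[OF E(2), of v "transpose b *v (b *v E v)"] 0 by simp
  then have "b *v E v = 0" unfolding inner_transpose by simp
  then have "E v = 0" using mat_ainv_v(1)[OF L_unit[OF b], of "E v"] by simp
  then show "v = 0" using 0(2) by simp
qed

lemma proj_in: "proj b *v v \<in> act b"
  unfolding proj_v using E(2) by blast

text \<open>These are the normal equations of least squares: \<open>y\<close> solves the Gram system
  with right-hand side \<open>E (transpose b *v v)\<close>.\<close>

lemma proj_orth:
  assumes b: "b \<in> LC" and w: "w \<in> act b"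
  shows "(v - proj b *v v) \<bullet> w = 0"
proof -
  obtain w0 where w0: "w0 \<in> W" "w = b *v w0" using w by blast
  define y where "y = mat.ainv (gram b) *v E (transpose b *v v)"
  have gy: "E (transpose b *v (b *v E y)) + (y - E y) = E (transpose b *v v)"
    using mat_ainv_v(2)[OF gram_unit[OF b], of "E (transpose b *v v)"] unfolding y_def gram_v .
  then have "(E (transpose b *v (b *v E y)) - E (transpose b *v v)) + (y - E y) = 0" by (simp add: algebra_simps)
  moreover have "E (transpose b *v (b *v E y)) - E (transpose b *v v) \<in> W" using E(2) W(1) subspace_diff by blast
  ultimately have eq: "E (transpose b *v (b *v E y)) = E (transpose b *v v)" using W_F_sum[OF _ E(3)] by fastforce
  have "w0 \<bullet> (transpose b *v (b *v E y)) = w0 \<bullet> (transpose b *v v)"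
    using inner_E[OF w0(1), of "transpose b *v (b *v E y)"] inner_E[OF w0(1), of "transpose b *v v"] eq by simp
  then show ?thesis unfolding w0(2) proj_v y_def[symmetric] inner_transpose inner_diff_left by (simp add: inner_commute)
qed

lemma proj_fix:
  assumes b: "b \<in> LC" and v: "v \<in> act b"
  shows "proj b *v v = v"
proof -
  have "v - proj b *v v \<in> act b"
    by (rule subspace_diff[OF pointD(1)[OF point_act[OF b]] v proj_in])
  from proj_orth[OF b this, of v] show ?thesis by simp
qed

lemma proj_cong:
  assumes b: "b \<in> LC" "b' \<in> LC" and eq: "act b = act b'"
  shows "proj b = proj b'"
proof -
  have "proj b *v v = proj b' *v v" for v
  proof -
    let ?d = "proj b *v v - proj b' *v v"
    have d: "?d \<in> act b"
      by (rule subspace_diff[OF pointD(1)[OF point_act[OF b(1)]] proj_in]) (simp add: eq proj_in)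
    have "(v - proj b *v v) \<bullet> ?d = 0" "(v - proj b' *v v) \<bullet> ?d = 0"
      using proj_orth[OF b(1) d] proj_orth[OF b(2)] d eq by auto
    then have "?d \<bullet> ?d = 0" by (simp add: inner_diff_left)
    then show ?thesis by simp
  qed
  then show ?thesis by (simp add: matrix_eq)
qed

lemma smooth_proj:
  assumes f: "smooth_on A f" "\<And>x. x \<in> A \<Longrightarrow> f x \<in> LC"
  shows "smooth_on A (\<lambda>x. proj (f x))"
proof -
  have "linear (transpose :: real^'n^'n \<Rightarrow> real^'n^'n)"
    by (rule linearI) (simp_all add: transpose_def vec_eq_iff)
  then have tr: "smooth_on A (\<lambda>x. transpose (f x))"
    by (intro smooth_on_bounded_linear[OF _ f(1)]) (simp add: linear_conv_bounded_linear)
  have gr: "smooth_on A (\<lambda>x. gram (f x))" unfolding gram_def by (intro mat.smooth_intros f tr)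
  show ?thesis unfolding proj_def by (intro mat.smooth_intros f tr gr gram_unit)
qed

lemma line_L: "g \<in> LC \<Longrightarrow> X \<in> HH \<Longrightarrow> g ** (mat 1 + t *\<^sub>R X) \<in> LC"
  using subspace_HH by (intro mul_L) (auto simp: subspace_scale HH_def dest!: subspace_scale[where c = t])

text \<open>Differentiating \<open>proj (?c t) *v (?c t *v w) = ?c t *v w\<close> by the product
  rule. Thus \<open>D\<close> determines \<open>g *v (X *v w)\<close> modulo
  \<open>act g\<close>.\<close>

lemma proj_derivative:
  assumes g: "g \<in> LC" and X: "X \<in> HH" and w: "w \<in> W"
    and D: "((\<lambda>t. proj (g ** (mat 1 + t *\<^sub>R X))) has_vector_derivative D) (at 0)"
  shows "D *v (g *v w) + proj g *v (g *v (X *v w)) = g *v (X *v w)"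
proof -
  let ?c = "\<lambda>t. g ** (mat 1 + t *\<^sub>R X)"
  have c: "?c t *v w = g *v w + t *\<^sub>R (g *v (X *v w))" for t
    by (simp add: mv_simps scaleR_matrix_vector_assoc[symmetric] matrix_vector_mult_scaleR)
  have dc: "((\<lambda>t. ?c t *v w) has_vector_derivative g *v (X *v w)) (at 0)"
    unfolding c by (auto intro!: derivative_eq_intros)
  have "((\<lambda>t. proj (?c t) *v (?c t *v w)) has_vector_derivative
      proj (?c 0) *v (g *v (X *v w)) + D *v (?c 0 *v w)) (at 0)"
    by (rule bounded_bilinear.has_vector_derivative[OF bounded_bilinear_mv D dc])
  moreover have "proj (?c t) *v (?c t *v w) = ?c t *v w" for t
    by (rule proj_fix[OF line_L[OF g X] imageI[OF w]])
  ultimately have "((\<lambda>t. ?c t *v w) has_vector_derivative proj (?c 0) *v (g *v (X *v w)) + D *v (?c 0 *v w)) (at 0)"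
    by (simp only:)
  from vector_derivative_unique_at[OF this dc] show ?thesis by (simp add: add.commute)
qed

text \<open>The derivative formula is applied to \<open>g\<close> at \<open>p *v w\<close> and to
  \<open>g ** p\<close> at \<open>w\<close>. Adding the two cancels \<open>D\<close>, so a vector
  fixed by the projection remains, that is, an element of \<open>act g\<close>.\<close>

lemma proj_anticommute:
  assumes g: "g \<in> LC" and p: "p \<in> Q" and X: "X \<in> HH" and w: "w \<in> W"
    and D: "((\<lambda>t. proj (g ** (mat 1 + t *\<^sub>R X))) has_vector_derivative D) (at 0)"
      "((\<lambda>t. proj (g ** p ** (mat 1 + t *\<^sub>R X))) has_vector_derivative - D) (at 0)"
  shows "p *v (X *v w) + X *v (p *v w) \<in> W"
proof -
  have pL: "p \<in> LC" and pw: "p *v w \<in> W" and pW: "act p = W" using p w by (auto simp: Q_iff stab_def)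
  have gp: "g ** p \<in> LC" using g pL by (rule mul_L)
  have "act (g ** p) = act g" unfolding act_mul pW ..
  then have pr: "proj (g ** p) = proj g" by (rule proj_cong[OF gp g])
  have "D *v (g *v (p *v w)) + proj g *v (g *v (X *v (p *v w))) = g *v (X *v (p *v w))"
    by (rule proj_derivative[OF g X pw D(1)])
  moreover have "- D *v (g *v (p *v w)) + proj g *v (g *v (p *v (X *v w))) = g *v (p *v (X *v w))"
    using proj_derivative[OF gp X w D(2)] unfolding pr matrix_vector_mul_assoc[symmetric] .
  moreover have "- D *v (g *v (p *v w)) = - (D *v (g *v (p *v w)))"
    using matrix_vector_mult_diff_rdistrib[of 0 D "g *v (p *v w)"] by simp
  ultimately have "proj g *v (g *v (p *v (X *v w))) + proj g *v (g *v (X *v (p *v w)))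
      = g *v (p *v (X *v w)) + g *v (X *v (p *v w))" by (simp add: algebra_simps)
  then have "proj g *v (g *v (p *v (X *v w) + X *v (p *v w))) = g *v (p *v (X *v w) + X *v (p *v w))"
    by (simp only: matrix_vector_right_distrib)
  then have "g *v (p *v (X *v w) + X *v (p *v w)) \<in> act g" using proj_in by metis
  then obtain w' where "w' \<in> W" "g *v (p *v (X *v w) + X *v (p *v w)) = g *v w'" by blast
  then show ?thesis using mat_unit_inj[OF L_unit[OF g]] by (metis injD)
qed

end

subsection \<open>Coordinate subspaces\<close>

definition coord :: "'n set \<Rightarrow> (real^'n) set" where "coord I = {v. \<forall>i. i \<notin> I \<longrightarrow> v $ i = 0}"

definition restr :: "'n set \<Rightarrow> real^'n \<Rightarrow> real^'n" where "restr I v = (\<chi> i. if i \<in> I then v $ i else 0)"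

lemma span_axis: "span ((\<lambda>i. axis i 1) ` I) = coord (I :: 'n::finite set)"
proof
  show "span ((\<lambda>i. axis i 1) ` I) \<subseteq> coord I"
    by (rule span_minimal) (auto simp: coord_def subspace_def axis_def)
  show "coord I \<subseteq> span ((\<lambda>i. axis i 1) ` I)"
  proof
    fix v :: "real^'n" assume v: "v \<in> coord I"
    have "v = (\<Sum>i\<in>UNIV. v $ i *\<^sub>R axis i 1)" using basis_expansion[of v] by (simp add: scalar_mult_eq_scaleR)
    also have "\<dots> = (\<Sum>i\<in>I. v $ i *\<^sub>R axis i 1)"
      by (rule sum.mono_neutral_right) (use v in \<open>auto simp: coord_def\<close>)
    also have "\<dots> \<in> span ((\<lambda>i. axis i 1) ` I)" by (intro span_sum span_scale span_base) auto
    finally show "v \<in> span ((\<lambda>i. axis i 1) ` I)" .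
  qed
qed

lemma subspace_coord: "subspace (coord I)"
  by (auto simp: coord_def subspace_def)

lemma dim_coord: "dim (coord (I :: 'n::finite set)) = card I"
  unfolding coord_def using dim_substandard_cart[where ?'a = real, of I] by (simp add: dim_vec_eq)

lemma coordinate_geometry:
  fixes I :: "'n::finite set" and B :: "real^'n \<Rightarrow> real^'n \<Rightarrow> real"
  assumes B: "bilinear B" "\<And>x. B x x = 0"
    "(\<forall>x y. B x y = 0) \<or> ((\<forall>x. (\<forall>y. B x y = 0) \<longrightarrow> x = 0) \<and> CARD('n) = 2 * card I)"
    and iso: "\<And>u v. u \<in> coord I \<Longrightarrow> v \<in> coord I \<Longrightarrow> B u v = 0"
      "\<And>u v. u \<in> coord (- I) \<Longrightarrow> v \<in> coord (- I) \<Longrightarrow> B u v = 0"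
    and I: "I \<noteq> {}" "I \<noteq> UNIV"
  shows "isotropic_geometry B (card I) (coord I) (coord (- I)) (restr I)"
proof (rule isotropic_geometry.intro)
  show "linear (restr I)" by (rule linearI) (auto simp: restr_def vec_eq_iff)
  show "restr I x \<in> coord I" "x - restr I x \<in> coord (- I)" for x by (auto simp: restr_def coord_def)
  show "w \<bullet> f = 0" if "w \<in> coord I" "f \<in> coord (- I)" for w f
    unfolding inner_vec_def by (rule sum.neutral) (use that in \<open>auto simp: coord_def\<close>)
  have c: "card (- I) = CARD('n) - card I" by (simp add: Compl_eq_Diff_UNIV card_Diff_subset)
  then show "dim (coord (- I)) = DIM(real^'n) - card I" by (simp add: dim_coord)
  show "0 < card I" using I(1) by (simp add: card_gt_0_iff)
  show "card I < DIM(real^'n)" using I(2) by (simp add: psubset_card_mono psubset_eq)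
qed (use B iso in \<open>simp_all add: subspace_coord dim_coord\<close>)

section \<open>The product with the projective line\<close>

lemma GL_geometry:
  fixes I :: "'n::finite set"
  assumes "I \<noteq> {}" "I \<noteq> UNIV"
  shows "matrix_geometry (\<lambda>_ _. 0) (card I) (coord I) (coord (- I)) (restr I) GL"
proof -
  interpret isotropic_geometry "\<lambda>_ _. 0" "card I" "coord I" "coord (- I)" "restr I"
    by (rule coordinate_geometry) (use assms in \<open>auto simp: bilinear_def intro: linear_zero\<close>)
  have "invertible A \<longleftrightarrow> similitude ((*v) A)" for A :: "real^'n^'n"
  proof -
    have "invertible A \<longleftrightarrow> inj ((*v) A)"
      unfolding invertible_left_inverse matrix_left_invertible_injective ..
    also have "\<dots> \<longleftrightarrow> similitude ((*v) A)"
    proof -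
      have "\<exists>c::real. c \<noteq> 0" by (rule exI[of _ 1]) simp
      then show ?thesis unfolding similitude_def by simp
    qed
    finally show ?thesis .
  qed
  then show ?thesis
    by (intro matrix_geometry.intro matrix_geometry_axioms.intro isotropic_geometry_axioms) (simp add: GL_def)
qed

text \<open>The projective line is the Grassmannian of lines in the plane, hence an instance with
  \<open>B = 0\<close>; its cells and its stabilizer come from the same lemmas.\<close>

global_interpretation line: matrix_geometry "\<lambda>_ _. 0" "card {1 :: 2}" "coord {1 :: 2}" "coord (- {1})" "restr {1}" GL
  by (rule GL_geometry) (auto simp: UNIV_2)

declare line.L.carrier_G [simp del]

lemma line_stab_eq: "line_stab = line.Q"
  unfolding line_stab_def using span_axis[of "{1 :: 2}"] by simp

definition pmul :: "(real^'m^'m) \<times> (real^'n^'n) \<Rightarrow> (real^'m^'m) \<times> (real^'n^'n) \<Rightarrow> (real^'m^'m) \<times> (real^'n^'n)" where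
  "pmul x y = (fst x ** fst y, snd x ** snd y)"

lemma pmul_Pair [simp]: "pmul (a, b) (c, d) = (a ** c, b ** d)"
  by (simp add: pmul_def)

lemma bounded_bilinear_pmul: "bounded_bilinear pmul"
  by (rule bounded_bilinearI_linear; rule linearI)
    (auto simp: pmul_def mat.distribs mat.bil.scaleR_left mat.bil.scaleR_right)

global_interpretation pair: fd_algebra pmul "(mat 1 :: real^'m^'m, mat 1 :: real^'n^'n)"
  by (rule fd_algebra.intro[OF bounded_bilinear_pmul]) (simp_all add: pmul_def matrix_mul_assoc)

lemma pair_unit: "mat.unit a \<Longrightarrow> mat.unit b \<Longrightarrow> pair.unit (a, b)"
  by (rule pair.unitI[of _ "(mat.ainv a, mat.ainv b)"]) (simp_all add: mat.ainv)

lemma pair_ainv: "mat.unit a \<Longrightarrow> mat.unit b \<Longrightarrow> pair.ainv (a, b) = (mat.ainv a, mat.ainv b)"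
  by (rule pair.ainv_eqI) (simp_all add: mat.ainv)

text \<open>The condition \<open>large\<close> says that \<open>F\<close> has dimension at least 2.
  It keeps the cells connected after two points are removed, and it makes \<open>x1 + x2\<close> a
  proper subspace when these points meet in a hyperplane.\<close>

locale avoiding_geometry = matrix_geometry B k W F E L
  for B :: "real^'n \<Rightarrow> real^'n \<Rightarrow> real" and k W F E L +
  fixes l1 l2 :: "real^'n^'n"
  assumes l: "l1 \<in> LC" "l2 \<in> LC" "l1 <#\<^bsub>L\<^esub> Q \<noteq> l2 <#\<^bsub>L\<^esub> Q"
    and large: "k + 1 < CARD('n)"
begin

abbreviation G :: "((real^2^2) \<times> (real^'n^'n)) monoid" where "G \<equiv> GL \<times>\<times> L"

definition T :: "((real^2^2) \<times> (real^'n^'n)) set" where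
  "T = {(a, b). a \<in> line.LC \<and> b \<in> LC \<and> act b \<noteq> act l1 \<and> act b \<noteq> act l2}"

abbreviation M :: "((real^2^2) \<times> (real^'n^'n)) set set" where "M \<equiv> M_bar L Q l1 l2"

lemma T_iff: "(a, b) \<in> T \<longleftrightarrow> a \<in> line.LC \<and> b \<in> LC \<and> act b \<noteq> act l1 \<and> act b \<noteq> act l2"
  by (simp add: T_def)

lemma coset_L: "b \<in> LC \<Longrightarrow> b' \<in> LC \<Longrightarrow> b <#\<^bsub>L\<^esub> Q = b' <#\<^bsub>L\<^esub> Q \<longleftrightarrow> act b = act b'"
proof
  assume b: "b \<in> LC" "b' \<in> LC"
  have Qa: "act (b ** q) = act b" if "q \<in> Q" for b q
    using that unfolding act_mul stab_def by simp
  have mem: "x <#\<^bsub>L\<^esub> Q = (\<lambda>q. x ** q) ` Q" for x by (auto simp: l_coset_def)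
  have one: "mat 1 \<in> Q" using one_L by (simp add: Q_iff)
  {
    assume "b <#\<^bsub>L\<^esub> Q = b' <#\<^bsub>L\<^esub> Q"
    moreover have "b ** mat 1 \<in> b <#\<^bsub>L\<^esub> Q" unfolding mem using one by (rule imageI)
    ultimately have "b \<in> b' <#\<^bsub>L\<^esub> Q" by simp
    then obtain q where "q \<in> Q" "b = b' ** q" unfolding mem by blast
    then show "act b = act b'" using Qa by simp
  }
  assume eq: "act b = act b'"
  have sub: "x <#\<^bsub>L\<^esub> Q \<subseteq> y <#\<^bsub>L\<^esub> Q" if x: "x \<in> LC" "y \<in> LC" "act x = act y" for x y
  proof
    fix z assume "z \<in> x <#\<^bsub>L\<^esub> Q"
    then obtain q where q: "q \<in> Q" "z = x ** q" unfolding mem by blast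
    have "mat.ainv y ** z \<in> Q"
    proof -
      have "mat.ainv y ** x \<in> Q" using act_eq_iff[OF x(2,1)] x(3) by simp
      then have "mat.ainv y ** x \<in> LC" "act (mat.ainv y ** x) = W" unfolding stab_def by blast+
      moreover have "q \<in> LC" "act q = W" using q(1) unfolding stab_def by blast+
      ultimately have "mat.ainv y ** x ** q \<in> LC" "act (mat.ainv y ** x ** q) = W"
        by (auto intro: mul_L simp only: act_mul[of _ q])
      then show ?thesis unfolding q(2) stab_def by (simp add: matrix_mul_assoc)
    qed
    moreover have "z = y ** (mat.ainv y ** z)" using L_unit[OF x(2)] by simp
    ultimately show "z \<in> y <#\<^bsub>L\<^esub> Q" unfolding mem by (rule image_eqI[rotated])
  qed
  show "b <#\<^bsub>L\<^esub> Q = b' <#\<^bsub>L\<^esub> Q" using sub[OF b eq] sub[OF b(2,1) eq[symmetric]] by (rule equalityI)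
qed

lemma distinct: "act l1 \<noteq> act l2"
  using l coset_L by blast

lemma coset_pair: "(a, b) <#\<^bsub>G\<^esub> (line_stab \<times> Q) = (a <#\<^bsub>GL\<^esub> line_stab) \<times> (b <#\<^bsub>L\<^esub> Q)"
  by (force simp: l_coset_def DirProd_def)

lemma T_cosets: "T = {g \<in> line.LC \<times> LC. g <#\<^bsub>G\<^esub> (line_stab \<times> Q) \<in> M}"
proof -
  have ne: "x \<in> x <#\<^bsub>GL\<^esub> line_stab" if "x \<in> line.LC" for x
    using line.one_L by (auto simp: l_coset_def line_stab_eq line.Q_iff intro!: bexI[of _ "mat 1"])
  have ne': "x \<in> x <#\<^bsub>L\<^esub> Q" if "x \<in> LC" for x
    using one_L by (auto simp: l_coset_def Q_iff intro!: bexI[of _ "mat 1"])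
  have iff: "(a, b) \<in> T \<longleftrightarrow> (a, b) <#\<^bsub>G\<^esub> (line_stab \<times> Q) \<in> M" if ab: "a \<in> line.LC" "b \<in> LC" for a b
  proof
    assume "(a, b) \<in> T"
    then have "b <#\<^bsub>L\<^esub> Q \<noteq> l1 <#\<^bsub>L\<^esub> Q" "b <#\<^bsub>L\<^esub> Q \<noteq> l2 <#\<^bsub>L\<^esub> Q"
      using ab l by (auto simp: T_iff coset_L)
    then show "(a, b) <#\<^bsub>G\<^esub> (line_stab \<times> Q) \<in> M"
      unfolding coset_pair M_bar_def LCOSETS_def using ab by blast
  next
    assume "(a, b) <#\<^bsub>G\<^esub> (line_stab \<times> Q) \<in> M"
    then obtain A A' where A: "(a <#\<^bsub>GL\<^esub> line_stab) \<times> (b <#\<^bsub>L\<^esub> Q) = A \<times> A'"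
      "A' \<noteq> l1 <#\<^bsub>L\<^esub> Q" "A' \<noteq> l2 <#\<^bsub>L\<^esub> Q"
      unfolding coset_pair M_bar_def by blast
    \<comment> \<open>A product of nonempty sets determines its factors.\<close>
    then have "A' = b <#\<^bsub>L\<^esub> Q" using ne[OF ab(1)] ne'[OF ab(2)] by blast
    then show "(a, b) \<in> T" using A(2,3) ab l by (simp add: T_iff coset_L)
  qed
  show ?thesis
  proof (rule Set.set_eqI)
    fix z :: "(real^2^2) \<times> (real^'n^'n)"
    obtain a b where z: "z = (a, b)" by (cases z)
    show "z \<in> T \<longleftrightarrow> z \<in> {g \<in> line.LC \<times> LC. g <#\<^bsub>G\<^esub> (line_stab \<times> Q) \<in> M}"
    proof (cases "a \<in> line.LC \<and> b \<in> LC")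
      case True
      then show ?thesis unfolding z mem_Collect_eq using iff by blast
    next
      case False
      then show ?thesis unfolding z mem_Collect_eq T_iff by blast
    qed
  qed
qed

lemma group_eq: "G = \<lparr>carrier = line.LC \<times> LC, monoid.mult = pmul, one = (mat 1, mat 1)\<rparr>"
  by (simp add: DirProd_def pmul_def fun_eq_iff split_def)

lemma common_cell_pair:
  assumes g: "(a1, b1) \<in> T" "(a2, b2) \<in> T"
  obtains a b where "a \<in> line.LC" "b \<in> LC"
    "mat.unit (line.Em ** ((mat.ainv a ** a1) ** line.Em) + (mat 1 - line.Em))"
    "mat.unit (line.Em ** ((mat.ainv a ** a2) ** line.Em) + (mat 1 - line.Em))"
    "mat.unit (Em ** ((mat.ainv b ** b1) ** Em) + (mat 1 - Em))"
    "mat.unit (Em ** ((mat.ainv b ** b2) ** Em) + (mat 1 - Em))"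
proof -
  have m: "a1 \<in> line.LC" "a2 \<in> line.LC" "b1 \<in> LC" "b2 \<in> LC" using g by (auto simp: T_iff)
  obtain a where a: "a \<in> line.LC"
    "mat.unit (line.Em ** ((mat.ainv a ** a1) ** line.Em) + (mat 1 - line.Em))"
    "mat.unit (line.Em ** ((mat.ainv a ** a2) ** line.Em) + (mat 1 - line.Em))"
    by (rule line.common_complement[OF m(1,2)])
  obtain b where b: "b \<in> LC"
    "mat.unit (Em ** ((mat.ainv b ** b1) ** Em) + (mat 1 - Em))"
    "mat.unit (Em ** ((mat.ainv b ** b2) ** Em) + (mat 1 - Em))"
    by (rule common_complement[OF m(3,4)])
  show ?thesis by (rule that[OF a(1) b(1) a(2,3) b(2,3)])
qed

text \<open>At most one point of a cell lies over each of the two removed points, and the cell has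
  dimension at least two.\<close>

lemma connected_cell:
  assumes a: "a \<in> line.LC" and b: "b \<in> LC"
  shows "connected {X \<in> line.HH \<times> HH. pmul (a, b) ((mat 1, mat 1) + X) \<in> T}"
proof -
  define bad where "bad x = {X \<in> HH. act (b ** (mat 1 + X)) = x}" for x
  have fin: "countable (bad x)" for x
  proof -
    have "X = Y" if "X \<in> bad x" "Y \<in> bad x" for X Y
    proof (rule graph_unique)
      show "X \<in> HH" "Y \<in> HH" using that by (auto simp: bad_def)
      have "(*v) b ` act (mat 1 + X) = (*v) b ` act (mat 1 + Y)"
        using that unfolding bad_def act_mul by simp
      then show "act (mat 1 + X) = act (mat 1 + Y)" using mat_unit_inj[OF L_unit[OF b]] by (simp only: inj_image_eq_iff)
    qed
    then have "bad x = {} \<or> (\<exists>X. bad x = {X})" by blast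
    then show ?thesis by auto
  qed
  have conv: "connected HH" using subspace_HH by (simp add: convex_connected subspace_imp_convex)
  have aff: "affine hull HH = HH" using subspace_HH by (simp add: subspace_imp_affine)
  have 2: "connected (HH - (bad (act l1) \<union> bad (act l2)))"
  proof (rule connected_openin_diff_countable[OF conv _ HH_not_collinear[OF large]])
    show "openin (top_of_set (affine hull HH)) HH" unfolding aff by simp
    show "countable (bad (act l1) \<union> bad (act l2))" by (intro countable_Un fin)
  qed
  have 1: "connected line.HH" using line.subspace_HH by (simp add: convex_connected subspace_imp_convex)
  have "{X \<in> line.HH \<times> HH. pmul (a, b) ((mat 1, mat 1) + X) \<in> T} = line.HH \<times> (HH - (bad (act l1) \<union> bad (act l2)))"
  proof (rule Set.set_eqI)
    fix Z :: "(real^2^2) \<times> (real^'n^'n)"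
    obtain Z1 Z2 where Z: "Z = (Z1, Z2)" by (cases Z)
    have "a ** (mat 1 + Z1) \<in> line.LC" if "Z1 \<in> line.HH" using that a by (intro line.mul_L) (auto simp: line.HH_def)
    moreover have "b ** (mat 1 + Z2) \<in> LC" if "Z2 \<in> HH" using that b by (intro mul_L) (auto simp: HH_def)
    ultimately show "Z \<in> {X \<in> line.HH \<times> HH. pmul (a, b) ((mat 1, mat 1) + X) \<in> T} \<longleftrightarrow>
        Z \<in> line.HH \<times> (HH - (bad (act l1) \<union> bad (act l2)))"
      unfolding Z mem_Collect_eq plus_prod_def fst_conv snd_conv pmul_Pair T_iff bad_def by blast
  qed
  then show ?thesis using connected_Times[OF 1 2] by simp
qed

lemma closed_condition: "b \<in> LC \<Longrightarrow> b' \<in> LC \<Longrightarrow> act b' = act b \<longleftrightarrow> (mat 1 - Em) ** ((mat.ainv b ** b') ** Em) = 0"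
  using act_eq_iff[of b b'] mul_L[OF ainv_L, of b b'] unfolding Q_alg by auto

text \<open>Equality with a removed point is the vanishing of a block that depends continuously on
  the group element, so each removed point is closed.\<close>

lemma T_openin: "openin (top_of_set (line.LC \<times> LC)) T"
proof -
  let ?f = "\<lambda>l g. (mat 1 - Em) ** ((mat.ainv l ** snd g) ** Em)"
  have op: "openin (top_of_set (line.LC \<times> LC)) ((line.LC \<times> LC) \<inter> ?f l -` (- {0}))" for l
    by (rule continuous_openin_preimage_gen) (auto intro!: mat.bil.continuous_on continuous_intros)
  have "openin (top_of_set (line.LC \<times> LC))
    (((line.LC \<times> LC) \<inter> ?f l1 -` (- {0})) \<inter> ((line.LC \<times> LC) \<inter> ?f l2 -` (- {0})))"
    by (rule openin_Int[OF op op])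
  moreover have "((line.LC \<times> LC) \<inter> ?f l1 -` (- {0})) \<inter> ((line.LC \<times> LC) \<inter> ?f l2 -` (- {0})) = T"
  proof (rule Set.set_eqI)
    fix z :: "(real^2^2) \<times> (real^'n^'n)"
    obtain a b where z: "z = (a, b)" by (cases z)
    have "b \<in> LC \<Longrightarrow> act b \<noteq> act l1 \<longleftrightarrow> ?f l1 z \<noteq> 0" "b \<in> LC \<Longrightarrow> act b \<noteq> act l2 \<longleftrightarrow> ?f l2 z \<noteq> 0"
      unfolding z snd_conv using closed_condition[OF l(1), of b] closed_condition[OF l(2), of b] by blast+
    then show "z \<in> ((line.LC \<times> LC) \<inter> ?f l1 -` (- {0})) \<inter> ((line.LC \<times> LC) \<inter> ?f l2 -` (- {0})) \<longleftrightarrow> z \<in> T"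
      unfolding Int_iff vimage_eq Compl_iff singleton_iff z T_iff mem_Times_iff fst_conv snd_conv by blast
  qed
  ultimately show ?thesis by simp
qed

lemma flat_axioms:
  "flat_parabolic pmul (mat 1, mat 1) (line.LC \<times> LC) G (line.Em, Em) (line_stab \<times> Q) (line.HH \<times> HH) M T"
proof (intro flat_parabolic.intro unit_group.intro unit_group_axioms.intro flat_parabolic_axioms.intro)
  show "fd_algebra pmul (mat 1 :: real^2^2, mat 1 :: real^'n^'n)" by (rule pair.fd_algebra_axioms)
  show "G = \<lparr>carrier = line.LC \<times> LC, monoid.mult = pmul, one = (mat 1, mat 1)\<rparr>" by (rule group_eq)
  show "(mat 1, mat 1) \<in> line.LC \<times> LC" using line.one_L one_L by simp
  show "pmul x y \<in> line.LC \<times> LC" if "x \<in> line.LC \<times> LC" "y \<in> line.LC \<times> LC" for x y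
    using that line.mul_L mul_L by (auto simp: pmul_def)
  show "pair.unit x" if "x \<in> line.LC \<times> LC" for x
    using that line.L_unit L_unit by (auto intro: pair_unit)
  show "pair.ainv x \<in> line.LC \<times> LC" if "x \<in> line.LC \<times> LC" for x
    using that line.L_unit L_unit line.ainv_L ainv_L by (auto simp: pair_ainv)
  show "pmul (line.Em, Em) (line.Em, Em) = (line.Em, Em)" by simp
  show "line_stab \<times> Q = {g \<in> line.LC \<times> LC. pmul ((mat 1, mat 1) - (line.Em, Em)) (pmul g (line.Em, Em)) = 0}"
    unfolding line_stab_eq line.Q_alg Q_alg by (auto simp: zero_prod_def)
  show "pair.ainv p \<in> line_stab \<times> Q" if "p \<in> line_stab \<times> Q" for p
    using that line.ainv_Q ainv_Q line.L_unit L_unit by (auto simp: line_stab_eq pair_ainv line.Q_iff Q_iff)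
  show "line.HH \<times> HH = {X. pmul ((mat 1, mat 1) - (line.Em, Em)) (pmul X (line.Em, Em)) = X \<and> (mat 1, mat 1) + X \<in> line.LC \<times> LC}"
    unfolding line.HH_def HH_def by auto
  show "subspace (line.HH \<times> HH)" using line.subspace_HH subspace_HH by (rule subspace_Times)
  show "M \<subseteq> lcosets\<^bsub>G\<^esub> (line_stab \<times> Q)" by (rule M_bar_subset)
  show "T = {g \<in> line.LC \<times> LC. g <#\<^bsub>G\<^esub> (line_stab \<times> Q) \<in> M}" by (rule T_cosets)
  show "openin (top_of_set (line.LC \<times> LC)) T" by (rule T_openin)
next
  fix g :: "(real^2^2) \<times> (real^'n^'n)"
  let ?E = "(line.Em, Em)" and ?e = "(mat 1, mat 1) :: (real^2^2) \<times> (real^'n^'n)"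
  let ?k = "pmul ?E (pmul g ?E) + (?e - ?E)"
  assume g: "g \<in> line.LC \<times> LC" and u: "pair.unit ?k"
  obtain a b where ab: "g = (a, b)" by (cases g)
  obtain y where y: "pmul ?k y = ?e" "pmul y ?k = ?e" using u by (auto simp: pair.unit_def)
  let ?k1 = "line.Em ** (a ** line.Em) + (mat 1 - line.Em)" and ?k2 = "Em ** (b ** Em) + (mat 1 - Em)"
  have k: "?k = (?k1, ?k2)" by (simp add: ab)
  have u1: "mat.unit ?k1" by (rule mat.unitI[of _ "fst y"]) (use y in \<open>simp_all add: ab pmul_def\<close>)
  have u2: "mat.unit ?k2" by (rule mat.unitI[of _ "snd y"]) (use y in \<open>simp_all add: ab pmul_def\<close>)
  have "pair.ainv ?k = (mat.ainv ?k1, mat.ainv ?k2)" unfolding k by (rule pair_ainv[OF u1 u2])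
  then show "?e + pmul (?e - ?E) (pmul g (pmul ?E (pair.ainv ?k))) \<in> line.LC \<times> LC"
    using g line.cell_L[OF _ u1] cell_L[OF _ u2] by (simp add: ab)
next
  fix g1 g2 :: "(real^2^2) \<times> (real^'n^'n)"
  let ?E = "(line.Em, Em)" and ?e = "(mat 1, mat 1) :: (real^2^2) \<times> (real^'n^'n)"
  assume g: "g1 \<in> T" "g2 \<in> T"
  obtain a1 b1 a2 b2 where g12: "g1 = (a1, b1)" "g2 = (a2, b2)" by (cases g1; cases g2)
  obtain a b where ab: "a \<in> line.LC" "b \<in> LC"
    "mat.unit (line.Em ** ((mat.ainv a ** a1) ** line.Em) + (mat 1 - line.Em))"
    "mat.unit (line.Em ** ((mat.ainv a ** a2) ** line.Em) + (mat 1 - line.Em))"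
    "mat.unit (Em ** ((mat.ainv b ** b1) ** Em) + (mat 1 - Em))"
    "mat.unit (Em ** ((mat.ainv b ** b2) ** Em) + (mat 1 - Em))"
    using common_cell_pair g unfolding g12 by blast
  have inv: "pair.ainv (a, b) = (mat.ainv a, mat.ainv b)"
    by (rule pair_ainv[OF line.L_unit[OF ab(1)] L_unit[OF ab(2)]])
  have "pair.unit (pmul ?E (pmul (pmul (pair.ainv (a, b)) g1) ?E) + (?e - ?E))"
    "pair.unit (pmul ?E (pmul (pmul (pair.ainv (a, b)) g2) ?E) + (?e - ?E))"
    unfolding inv g12 pmul_Pair minus_prod_def plus_prod_def fst_conv snd_conv
    by (rule pair_unit[OF ab(3,5)], rule pair_unit[OF ab(4,6)])
  then show "\<exists>u\<in>line.LC \<times> LC. pair.unit (pmul ?E (pmul (pmul (pair.ainv u) g1) ?E) + (?e - ?E)) \<and>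
      pair.unit (pmul ?E (pmul (pmul (pair.ainv u) g2) ?E) + (?e - ?E)) \<and>
      connected {X \<in> line.HH \<times> HH. pmul u (?e + X) \<in> T}"
    using ab(1,2) connected_cell[OF ab(1,2)] by (intro bexI[of _ "(a, b)"]) auto
qed

sublocale flat: flat_parabolic pmul "(mat 1, mat 1)" "line.LC \<times> LC" G "(line.Em, Em)" "line_stab \<times> Q"
  "line.HH \<times> HH" M T
  by (rule flat_axioms)

end

context avoiding_geometry
begin

section \<open>Symmetries and homogeneity of the complement of two points\<close>

abbreviation x1 :: "(real^'n) set" where "x1 \<equiv> act l1"
abbreviation x2 :: "(real^'n) set" where "x2 \<equiv> act l2"

lemma points: "point x1" "point x2"
  using point_act l by auto

text \<open>A removed point sent to a remaining one would contradict surjectivity onto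
  \<open>T\<close>, since \<open>b\<close> can be cancelled in the group.\<close>

lemma T_permutes:
  assumes b: "a \<in> line.LC" "b \<in> LC" and bT: "(\<lambda>g. pmul (a, b) g) ` T = T"
  shows "((*v) b ` x1 = x1 \<and> (*v) b ` x2 = x2) \<or> ((*v) b ` x1 = x2 \<and> (*v) b ` x2 = x1)"
proof -
  have "act (b ** m) = x1 \<or> act (b ** m) = x2" if m: "m \<in> LC" "act m = x1 \<or> act m = x2" for m
  proof (rule ccontr)
    assume "\<not> ?thesis"
    then have "(mat 1, b ** m) \<in> T" using line.one_L mul_L[OF b(2) m(1)] by (simp add: T_iff)
    then have "(mat 1, b ** m) \<in> (\<lambda>g. pmul (a, b) g) ` T" by (simp only: bT)
    then obtain z where z: "(mat 1, b ** m) = pmul (a, b) z" "z \<in> T" by (rule imageE)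
    obtain c d where cd: "z = (c, d)" by (cases z)
    have "b ** m = b ** d" using z(1) cd by simp
    then have "mat.ainv b ** (b ** m) = mat.ainv b ** (b ** d)" by (simp only:)
    then have "m = d" using L_unit[OF b(2)] by simp
    then show False using z(2) m(2) unfolding cd T_iff by blast
  qed
  from this[OF l(1)] this[OF l(2)] have im: "(*v) b ` x1 = x1 \<or> (*v) b ` x1 = x2" "(*v) b ` x2 = x1 \<or> (*v) b ` x2 = x2"
    unfolding act_mul by blast+
  have "(*v) b ` x1 \<noteq> (*v) b ` x2"
    using distinct mat_unit_inj[OF L_unit[OF b(2)]] by (simp only: inj_image_eq_iff not_False_eq_True)
  then show ?thesis using im by metis
qed

text \<open>The derivatives of the projection entries turn the symmetry condition at the critical
  point into anticommutation with every tangent vector modulo \<open>W\<close>. This forces the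
  scalars r and -r that \<open>no_symmetry_point\<close> excludes.\<close>

lemma symmetric_imp_near:
  assumes sym: "symmetric_geometry (line_stab \<times> Q) flat.\<X>"
  shows "dim (x1 \<inter> x2) + 1 = k"
proof (rule ccontr)
  assume far: "dim (x1 \<inter> x2) + 1 \<noteq> k"
  obtain x where x: "point x" "x \<noteq> x1" "x \<noteq> x2"
    and no: "\<And>b r. linear b \<Longrightarrow> r \<noteq> 0 \<Longrightarrow> (\<And>v. v \<in> x \<Longrightarrow> b v = r *\<^sub>R v) \<Longrightarrow> (\<And>v. b v + r *\<^sub>R v \<in> x) \<Longrightarrow>
      \<not> ((b ` x1 = x1 \<and> b ` x2 = x2) \<or> (b ` x1 = x2 \<and> b ` x2 = x1))"
    by (rule no_symmetry_point[OF points distinct far]) blast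
  obtain g where g: "g \<in> LC" "act g = x" by (rule point_exists[OF x(1)])
  define u where "u = (mat 1 :: real^2^2, g)"
  have u: "u \<in> T" using g x line.one_L by (simp add: u_def T_iff)
  have "orbit (line_stab \<times> Q) flat.\<X> u \<in> base (line_stab \<times> Q) flat.\<X>" using u by (simp add: base_def)
  then obtain \<Phi> where \<Phi>: "symmetry_at (line_stab \<times> Q) flat.\<X> (orbit (line_stab \<times> Q) flat.\<X> u) \<Phi>"
    using sym unfolding symmetric_geometry_def by blast
  then have aut: "automorphism (line_stab \<times> Q) flat.\<X> \<Phi>"
    and orb: "\<Phi> ` orbit (line_stab \<times> Q) flat.\<X> u = orbit (line_stab \<times> Q) flat.\<X> u"
    unfolding symmetry_at_def by blast+
  obtain c where c: "c \<in> line.LC \<times> LC" "\<And>z. z \<in> T \<Longrightarrow> \<Phi> z = pmul c z" "(\<lambda>z. pmul c z) ` T = T"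
    by (rule flat.automorphism_left_mult[OF aut]) blast
  obtain a b where ab: "c = (a, b)" by (cases c)
  have aG: "a \<in> line.LC" and bL: "b \<in> LC" using c(1) ab by auto
  have uS: "u \<in> line.LC \<times> LC" using g line.one_L by (simp add: u_def)
  have cuS: "pmul c u \<in> line.LC \<times> LC" using c(1) uS line.mul_L mul_L by (auto simp: pmul_def)
  have "orbit (line_stab \<times> Q) flat.\<X> u = orbit (line_stab \<times> Q) flat.\<X> (pmul c u)"
    using flat.image_orbit[OF c(2) u] orb by simp
  then have "pmul (pair.ainv u) (pmul c u) \<in> line_stab \<times> Q" using flat.orbit_iff[OF uS cuS] by simp
  moreover have "pair.ainv u = (mat 1, mat.ainv g)"
    unfolding u_def using pair_ainv[of "mat 1 :: real^2^2" g] L_unit[OF g(1)] by simp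
  ultimately have "mat.ainv g ** (b ** g) \<in> Q" by (simp add: u_def ab)
  \<comment> \<open>This is \<open>b\<close> in the frame \<open>g\<close>. As
    \<open>b ** g = g ** p\<close>, it sends the cell line through \<open>g\<close> to the line
    through \<open>g ** p\<close>.\<close>
  moreover define p where "p = mat.ainv g ** (b ** g)"
  ultimately have pQ: "p \<in> Q" by simp
  have pL: "p \<in> LC" and pW: "act p = W" using pQ unfolding stab_def by blast+
  have gp: "b ** g = g ** p" using L_unit[OF g(1)] by (simp add: p_def)
  have anti: "p *v (X w) + X (p *v w) \<in> W" if X: "nil X" and w: "w \<in> W" for X w
  proof -
    define Y where "Y = matrix X"
    have lin: "linear X" using X by (simp add: nil_def)
    have Yv: "(*v) Y = X" unfolding Y_def by (rule matrix_vector_mul(2)[OF lin])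
    then have Y: "Y \<in> HH" using X by (simp add: HH_iff)
    have sm: "smooth_on UNIV (\<lambda>t::real. proj (h ** (mat 1 + t *\<^sub>R Y)))" if "h \<in> LC" for h
      by (intro smooth_proj mat.smooth_intros smooth_on_bilinear[OF bounded_bilinear_scaleR] line_L that Y)
    define D where "D = vector_derivative (\<lambda>t. proj (g ** (mat 1 + t *\<^sub>R Y))) (at 0)"
    define D' where "D' = vector_derivative (\<lambda>t. proj (g ** p ** (mat 1 + t *\<^sub>R Y))) (at 0)"
    have D: "((\<lambda>t. proj (g ** (mat 1 + t *\<^sub>R Y))) has_vector_derivative D) (at 0)"
      unfolding D_def by (rule smooth_on_has_vector_derivative[OF sm[OF g(1)]])
    have D': "((\<lambda>t. proj (g ** p ** (mat 1 + t *\<^sub>R Y))) has_vector_derivative D') (at 0)"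
      unfolding D'_def by (rule smooth_on_has_vector_derivative[OF sm[OF mul_L[OF g(1) pL]]])
    \<comment> \<open>The symmetry condition concerns real functions on the base, so the projection
      is tested entry by entry, along directions tangent to the second factor.\<close>
    have "D' $ i $ j = - (D $ i $ j)" for i j
    proof -
      have bl: "bounded_linear (\<lambda>A :: real^'n^'n. A $ i $ j)"
        by (rule bounded_linear_compose[OF bounded_linear_vec_nth bounded_linear_vec_nth])
      have smT: "smooth_on T (\<lambda>z. proj (snd z) $ i $ j)"
        by (intro smooth_on_bounded_linear[OF bl] smooth_proj smooth_on_snd smooth_on_ident) (auto simp: T_def)
      have inv: "proj (snd (pmul z q)) $ i $ j = proj (snd z) $ i $ j" if "z \<in> T" "q \<in> line_stab \<times> Q" for z q
      proof -
        have z: "snd z \<in> LC" "snd q \<in> LC" "act (snd q) = W" using that unfolding T_def stab_def by auto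
        have "act (snd z ** snd q) = act (snd z)" unfolding act_mul z(3) ..
        then show ?thesis using proj_cong[OF mul_L[OF z(1,2)] z(1)] by (simp add: pmul_def)
      qed
      have Z: "(0, Y) \<in> line.HH \<times> HH" using Y line.subspace_HH subspace_0 by blast
      have e1: "snd (pmul u ((mat 1, mat 1) + t *\<^sub>R (0, Y))) = g ** (mat 1 + t *\<^sub>R Y)" for t
        by (simp add: u_def)
      have e2: "snd (pmul c (pmul u ((mat 1, mat 1) + t *\<^sub>R (0, Y)))) = g ** p ** (mat 1 + t *\<^sub>R Y)" for t
        by (simp add: u_def ab flip: gp) (simp add: matrix_mul_assoc)
      show ?thesis
      proof (rule flat.symmetry_derivative[OF \<Phi> u c(2,3) smT inv Z])
        show "((\<lambda>t. proj (snd (pmul u ((mat 1, mat 1) + t *\<^sub>R (0, Y)))) $ i $ j) has_vector_derivative D $ i $ j) (at 0)"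
          unfolding e1 by (rule bounded_linear.has_vector_derivative[OF bl D])
        show "((\<lambda>t. proj (snd (pmul c (pmul u ((mat 1, mat 1) + t *\<^sub>R (0, Y))))) $ i $ j) has_vector_derivative D' $ i $ j) (at 0)"
          unfolding e2 by (rule bounded_linear.has_vector_derivative[OF bl D'])
      qed
    qed
    then have "D' = - D" by (simp add: vec_eq_iff)
    then show ?thesis using proj_anticommute[OF g(1) pQ Y w D] D' by (simp add: Yv)
  qed
  have pw: "p *v w \<in> W" if "w \<in> W" for w using pW that by blast
  have "\<exists>r. (\<forall>w\<in>W. p *v w = r *\<^sub>R w) \<and> (\<forall>f\<in>F. p *v f + r *\<^sub>R f \<in> W)"
    by (rule anticommuting_scalar[OF matrix_vector_mul_linear[of p] pw anti]) blast+
  then obtain r where r: "\<And>w. w \<in> W \<Longrightarrow> p *v w = r *\<^sub>R w" "\<And>f. f \<in> F \<Longrightarrow> p *v f + r *\<^sub>R f \<in> W"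
    by blast
  have r0: "r \<noteq> 0"
  proof
    assume "r = 0"
    obtain w where w: "w \<in> W" "w \<noteq> 0" using W_nonzero by blast
    have "p *v w = 0" using r(1)[OF w(1)] \<open>r = 0\<close> by simp
    then show False using mat_ainv_v(1)[OF L_unit[OF pL], of w] w(2) by simp
  qed
  have bg: "b *v (g *v v) = g *v (p *v v)" for v
    unfolding matrix_vector_mul_assoc gp ..
  have "\<not> (((*v) b ` x1 = x1 \<and> (*v) b ` x2 = x2) \<or> ((*v) b ` x1 = x2 \<and> (*v) b ` x2 = x1))"
  proof (rule no[OF matrix_vector_mul_linear r0])
    fix v assume "v \<in> x"
    then obtain w where w: "w \<in> W" "v = g *v w" using g(2) by blast
    then show "b *v v = r *\<^sub>R v" by (simp add: bg r(1) matrix_vector_mult_scaleR)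
  next
    fix v
    define w where "w = mat.ainv g *v v"
    have v: "v = g *v w" using L_unit[OF g(1)] by (simp add: w_def)
    have "p *v w + r *\<^sub>R w = p *v (E w + (w - E w)) + r *\<^sub>R (E w + (w - E w))" by simp
    also have "\<dots> = (p *v E w + r *\<^sub>R E w) + (p *v (w - E w) + r *\<^sub>R (w - E w))"
      unfolding matrix_vector_right_distrib scaleR_add_right by (simp only: add_ac)
    also have "\<dots> \<in> W" 
      by (rule subspace_add[OF W(1) subspace_add[OF W(1) pw[OF E(2)] subspace_scale[OF W(1) E(2)]] r(2)[OF E(3)]])
    finally have "g *v (p *v w + r *\<^sub>R w) \<in> x" unfolding g(2)[symmetric] by (rule imageI)
    then show "b *v v + r *\<^sub>R v \<in> x" unfolding v bg by (simp add: matrix_vector_right_distrib matrix_vector_mult_scaleR)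
  qed
  from this T_permutes[OF aG bL c(3)[unfolded ab]] show False by (rule notE)
qed

lemma near_imp_symmetric:
  assumes near: "dim (x1 \<inter> x2) + 1 = k"
  shows "symmetric_geometry (line_stab \<times> Q) flat.\<X>"
  unfolding symmetric_geometry_def
proof
  fix y assume "y \<in> base (line_stab \<times> Q) flat.\<X>"
  then obtain a b where ab: "(a, b) \<in> T" "y = orbit (line_stab \<times> Q) flat.\<X> (a, b)" by (auto simp: base_def)
  have aG: "a \<in> line.LC" and bL: "b \<in> LC" and bx: "act b \<noteq> x1" "act b \<noteq> x2" using ab(1) by (auto simp: T_iff)
  obtain C where C: "copoint C" "act b \<inter> C = {0}"
    and perm: "\<And>r. linear r \<Longrightarrow> inj r \<Longrightarrow> (\<And>v. v \<in> act b \<Longrightarrow> r v = v) \<Longrightarrow> (\<And>v. v \<in> C \<Longrightarrow> r v = - v) \<Longrightarrow>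
      (r ` x1 = x1 \<and> r ` x2 = x2) \<or> (r ` x1 = x2 \<and> r ` x2 = x1)"
    by (rule reflection_complement[OF points point_act[OF bL] distinct near]) blast
  obtain h where h: "similitude h" "h ` W = act b" "h ` F = C"
    by (rule similitude_exists[OF point_act[OF bL] C])
  define g where "g = matrix h"
  have gL: "g \<in> LC" and gh: "(*v) g = h" unfolding g_def by (rule matrix_similitude[OF h(1)])+
  define s where "s = (line.Em + line.Em - mat 1, Em + Em - mat 1)"
  \<comment> \<open>This lies in the orbit of \<open>(a, b)\<close> because
    \<open>g W = b W\<close>. The frame \<open>g\<close> is preferred since it also sends
    \<open>F\<close> to the chosen complement \<open>C\<close>.\<close>
  define u where "u = (a, g)"
  have s: "s \<in> line.LC \<times> LC" using line.reflection_L reflection_L by (simp add: s_def)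
  have u: "u \<in> T" using aG gL gh h(2) bx by (simp add: u_def T_iff)
  have uS: "u \<in> line.LC \<times> LC" using aG gL by (simp add: u_def)
  let ?r = "pmul (pmul u s) (pair.ainv u)"
  define r2 where "r2 = g ** (Em + Em - mat 1) ** mat.ainv g"
  have r: "?r = (a ** (line.Em + line.Em - mat 1) ** mat.ainv a, r2)"
    by (simp add: u_def s_def r2_def pair_ainv[OF line.L_unit[OF aG] L_unit[OF gL]])
  have r2L: "r2 \<in> LC" unfolding r2_def by (intro mul_L ainv_L gL reflection_L)
  have r2g: "r2 *v (g *v v) = g *v (E v - (v - E v))" for v
    using L_unit[OF gL] by (simp add: r2_def reflection_v[symmetric] flip: matrix_vector_mul_assoc)
  have r2x: "r2 *v v = v" if v: "v \<in> act b" for v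
  proof -
    obtain w where "w \<in> W" "v = g *v w" using v unfolding h(2)[symmetric] gh by blast
    then show ?thesis by (simp add: r2g)
  qed
  have r2C: "r2 *v v = - v" if v: "v \<in> C" for v
  proof -
    obtain f where f: "f \<in> F" "v = g *v f" using v unfolding h(3)[symmetric] gh by blast
    then have "r2 *v v = g *v (- f)" by (simp add: r2g)
    then show ?thesis using linear_neg[OF matrix_vector_mul_linear[of g], of f] f(2) by simp
  qed
  have p: "((*v) r2 ` x1 = x1 \<and> (*v) r2 ` x2 = x2) \<or> ((*v) r2 ` x1 = x2 \<and> (*v) r2 ` x2 = x1)"
    by (rule perm[OF matrix_vector_mul_linear mat_unit_inj[OF L_unit[OF r2L]] r2x r2C])
  have rmem: "pmul ?r z \<in> T" if z: "z \<in> T" for z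
  proof -
    obtain c d where cd: "z = (c, d)" by (cases z)
    then have c: "c \<in> line.LC" and d: "d \<in> LC" "act d \<noteq> x1" "act d \<noteq> x2" using z by (auto simp: T_iff)
    have "(*v) r2 ` act d \<noteq> (*v) r2 ` x1" "(*v) r2 ` act d \<noteq> (*v) r2 ` x2"
      using d mat_unit_inj[OF L_unit[OF r2L]] by (simp_all only: inj_image_eq_iff not_False_eq_True)
    then have "act (r2 ** d) \<noteq> x1" "act (r2 ** d) \<noteq> x2" unfolding act_mul using p by metis+
    moreover have "a ** (line.Em + line.Em - mat 1) ** mat.ainv a ** c \<in> line.LC"
      by (intro line.mul_L line.ainv_L line.reflection_L aG c)
    ultimately show ?thesis using mul_L[OF r2L d(1)] by (simp add: r cd T_iff)
  qed
  have ss: "pmul s s = (mat 1, mat 1)"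
    using mat.reflection_square[OF line.Em_idem] mat.reflection_square[OF Em_idem] by (simp only: s_def pmul_Pair)
  have rr: "pmul ?r (pmul ?r z) = z" for z
  proof -
    have uu: "pair.unit u" using aG gL by (simp add: u_def pair_unit line.L_unit L_unit)
    have "pmul ?r (pmul ?r z) = pmul u (pmul (pmul s s) (pmul (pair.ainv u) z))"
      using uu by (simp add: pair.assoc)
    also have "\<dots> = z" unfolding ss using uu by simp
    finally show ?thesis .
  qed
  \<comment> \<open>The map is an involution, so mapping \<open>T\<close> into itself
    suffices.\<close>
  have rT: "(\<lambda>z. pmul ?r z) ` T = T"
  proof
    show "T \<subseteq> (\<lambda>z. pmul ?r z) ` T"
    proof
      fix z assume "z \<in> T"
      from imageI[OF rmem[OF this], of "\<lambda>z. pmul ?r z"]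
      show "z \<in> (\<lambda>z. pmul ?r z) ` T" unfolding rr .
    qed
  qed (use rmem in blast)
  have "symmetry_at (line_stab \<times> Q) flat.\<X> (orbit (line_stab \<times> Q) flat.\<X> u) (\<lambda>z. pmul ?r z)"
    by (rule flat.reflection_symmetry[OF u s _ rT]) (simp add: s_def)
  moreover have "orbit (line_stab \<times> Q) flat.\<X> u = y"
  proof -
    have abS: "(a, b) \<in> line.LC \<times> LC" using aG bL by simp
    have "mat.ainv g ** b \<in> Q" using act_eq_iff[OF gL bL] h(2) gh by simp
    moreover have "mat.ainv a ** a \<in> line_stab"
      using line.one_L by (simp add: mat.ainv(2)[OF line.L_unit[OF aG]] line_stab_eq line.Q_iff)
    ultimately have "pmul (pair.ainv u) (a, b) \<in> line_stab \<times> Q"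
      by (simp add: u_def pair_ainv[OF line.L_unit[OF aG] L_unit[OF gL]])
    then show ?thesis using flat.orbit_iff[OF uS abS] ab(2) by simp
  qed
  ultimately show "\<exists>\<Phi>. symmetry_at (line_stab \<times> Q) flat.\<X> y \<Phi>" by blast
qed

text \<open>Automorphisms preserve the sum of the two removed points; this separates the points of the
  pencil spanned by them from the others.\<close>

lemma near_imp_not_homogeneous:
  assumes near: "dim (x1 \<inter> x2) + 1 = k"
  shows "\<not> homogeneous (line_stab \<times> Q) flat.\<X>"
proof
  assume hom: "homogeneous (line_stab \<times> Q) flat.\<X>"
  let ?S = "setsums x1 x2"
  note s = pointD(1)[OF points(1)] pointD(1)[OF points(2)]
  have S: "subspace ?S" by (rule subspace_sums[OF s])
  have "v + 0 \<in> ?S" if "v \<in> x1" for v using that subspace_0[OF s(2)] by blast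
  moreover have "0 + v \<in> ?S" if "v \<in> x2" for v using that subspace_0[OF s(1)] by blast
  ultimately have sub: "x1 \<subseteq> ?S" "x2 \<subseteq> ?S" unfolding add_0_left add_0_right by blast+
  obtain z where z: "point z" "z \<noteq> x1" "z \<noteq> x2" "z \<subseteq> ?S" by (rule pencil_point[OF points distinct near])
  obtain g where g: "g \<in> LC" "act g = z" by (rule point_exists[OF z(1)])
  \<comment> \<open>This equals 2k - (k - 1) and is smaller than the ambient dimension by
    \<open>large\<close>. Hence some graph over \<open>W\<close> sticks out of \<open>?S\<close> and
    gives a remaining point that the pencil cannot reach.\<close>
  have "dim ?S = k + 1"
    using dim_sums_Int[OF s] near pointD(2)[OF points(1)] pointD(2)[OF points(2)] by simp
  then have "?S \<noteq> UNIV" using large by (metis DIM_cart DIM_real dim_UNIV less_irrefl mult.right_neutral)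
  then obtain X where X: "nil X" "\<not> (\<lambda>v. v + X v) ` W \<subseteq> ?S" using graph_points_span[OF S] by blast
  define g' where "g' = matrix (\<lambda>v. v + X v)"
  have sim: "similitude (\<lambda>v. v + X v)" by (rule nil_similitude[OF X(1)])
  have g': "g' \<in> LC" "act g' = (\<lambda>v. v + X v) ` W"
    unfolding g'_def by (rule matrix_similitude(1)[OF sim]) (simp only: matrix_similitude(2)[OF sim])
  define u where "u = (mat 1 :: real^2^2, g)"
  define u' where "u' = (mat 1 :: real^2^2, g')"
  have nsub: "\<not> act g' \<subseteq> ?S" unfolding g'(2) by (rule X(2))
  then have "act g' \<noteq> x1" "act g' \<noteq> x2" using sub by blast+
  then have u: "u \<in> T" "u' \<in> T" using g g'(1) z(2,3) line.one_L by (simp_all only: u_def u'_def T_iff not_False_eq_True simp_thms)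
  have "orbit (line_stab \<times> Q) flat.\<X> u \<in> base (line_stab \<times> Q) flat.\<X>"
    "orbit (line_stab \<times> Q) flat.\<X> u' \<in> base (line_stab \<times> Q) flat.\<X>" using u by (simp_all add: base_def)
  then obtain \<Phi> where \<Phi>: "automorphism (line_stab \<times> Q) flat.\<X> \<Phi>"
    "\<Phi> ` orbit (line_stab \<times> Q) flat.\<X> u = orbit (line_stab \<times> Q) flat.\<X> u'"
    using hom unfolding homogeneous_def by blast
  obtain c where c: "c \<in> line.LC \<times> LC" "\<And>z. z \<in> T \<Longrightarrow> \<Phi> z = pmul c z" "(\<lambda>z. pmul c z) ` T = T"
    by (rule flat.automorphism_left_mult[OF \<Phi>(1)]) blast
  obtain a b where ab: "c = (a, b)" by (cases c)
  have aG: "a \<in> line.LC" and bL: "b \<in> LC" using c(1) ab by auto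
  have S': "u' \<in> line.LC \<times> LC" "pmul c u \<in> line.LC \<times> LC"
    using aG g'(1) mul_L[OF bL g(1)] line.one_L by (simp_all add: u_def u'_def ab)
  have "orbit (line_stab \<times> Q) flat.\<X> u' = orbit (line_stab \<times> Q) flat.\<X> (pmul c u)"
    using flat.image_orbit[OF c(2) u(1)] \<Phi>(2) by simp
  then have "pmul (pair.ainv u') (pmul c u) \<in> line_stab \<times> Q" using flat.orbit_iff[OF S'] by simp
  moreover have "pair.ainv u' = (mat 1, mat.ainv g')"
    unfolding u'_def using pair_ainv[of "mat 1 :: real^2^2" g'] L_unit[OF g'(1)] by simp
  ultimately have "mat.ainv g' ** (b ** g) \<in> Q" by (simp add: u_def ab)
  then have eq: "act g' = (*v) b ` z" using act_eq_iff[OF g'(1) mul_L[OF bL g(1)]] by (simp add: act_mul g(2))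
  have perm: "((*v) b ` x1 = x1 \<and> (*v) b ` x2 = x2) \<or> ((*v) b ` x1 = x2 \<and> (*v) b ` x2 = x1)"
    by (rule T_permutes[OF aG bL c(3)[unfolded ab]])
  have "b *v v \<in> ?S" if v: "v \<in> z" for v
  proof -
    obtain v1 v2 where "v1 \<in> x1" "v2 \<in> x2" "v = v1 + v2" using v z(4) by blast
    then have eq: "b *v v = b *v v1 + b *v v2" and m: "b *v v1 \<in> (*v) b ` x1" "b *v v2 \<in> (*v) b ` x2"
      by (auto simp: matrix_vector_right_distrib)
    have eq': "b *v v = b *v v2 + b *v v1" unfolding eq by (rule add.commute)
    from perm show ?thesis
    proof
      assume "(*v) b ` x1 = x1 \<and> (*v) b ` x2 = x2"
      then have "b *v v1 \<in> x1" "b *v v2 \<in> x2" using m by simp_all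
      then show ?thesis using eq by blast
    next
      assume "(*v) b ` x1 = x2 \<and> (*v) b ` x2 = x1"
      then have "b *v v1 \<in> x2" "b *v v2 \<in> x1" using m by simp_all
      then show ?thesis using eq' by blast
    qed
  qed
  then have "act g' \<subseteq> ?S" unfolding eq by blast
  then show False using nsub by blast
qed

theorem nonhomogeneous_symmetric_iff:
  "nonhomogeneous_symmetric_restriction L Q l1 l2 \<longleftrightarrow> dim (x1 \<inter> x2) + 1 = k"
  unfolding nonhomogeneous_symmetric_restriction_def Let_def
  using flat.parabolic symmetric_imp_near near_imp_symmetric near_imp_not_homogeneous by blast

text \<open>Translation by the inverse of \<open>l1\<close> turns the pair of removed points into
  \<open>W\<close> and \<open>act m\<close>. Elements of \<open>Q\<close> preserve the dimension of
  the intersection, and \<open>transitive_on_pairs\<close> supplies the converse.\<close>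

lemma standard_pair:
  assumes D: "subspace D" "D \<subseteq> W" "dim D + 1 = k" and f: "f \<in> F" "f \<noteq> 0" and pt: "point (span (insert f D))"
  shows "(\<exists>q\<in>Q. (*v) (q \<otimes>\<^bsub>L\<^esub> inv\<^bsub>L\<^esub> l1 \<otimes>\<^bsub>L\<^esub> l2) ` W = span (insert f D)) \<longleftrightarrow> dim (x1 \<inter> x2) + 1 = k"
proof -
  define m where "m = mat.ainv l1 ** l2"
  have mL: "m \<in> LC" unfolding m_def by (intro mul_L ainv_L l)
  have inv: "inv\<^bsub>L\<^esub> l1 = mat.ainv l1" by (rule L.inv_G[OF l(1)])
  have prod: "(*v) (q \<otimes>\<^bsub>L\<^esub> inv\<^bsub>L\<^esub> l1 \<otimes>\<^bsub>L\<^esub> l2) ` W = (*v) q ` act m" for q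
    unfolding inv L_mult m_def act_mul[symmetric] by (simp add: matrix_mul_assoc)
  have l1m: "l1 ** m = l2" unfolding m_def by (rule mat.ainv_cancel(1)[OF L_unit[OF l(1)]])
  have dims: "dim (x1 \<inter> x2) = dim (W \<inter> act m)"
  proof -
    have "x2 = (*v) l1 ` act m" using act_mul[of l1 m] unfolding l1m .
    then have "x1 \<inter> x2 = (*v) l1 ` (W \<inter> act m)"
      using image_Int[OF mat_unit_inj[OF L_unit[OF l(1)]]] by simp
    moreover have "inj_on ((*v) l1) (span (W \<inter> act m))"
      using mat_unit_inj[OF L_unit[OF l(1)]] inj_on_subset by blast
    ultimately show ?thesis using dim_image_eq[OF matrix_vector_mul_linear[of l1]] by simp
  qed
  have meet: "W \<inter> span (insert f D) = D"
  proof
    show "D \<subseteq> W \<inter> span (insert f D)" using D(2) span_superset[of "insert f D"] by blast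
    show "W \<inter> span (insert f D) \<subseteq> D"
    proof
      fix v assume v: "v \<in> W \<inter> span (insert f D)"
      then obtain c d where cd: "d \<in> D" "v = d + c *\<^sub>R f" unfolding in_span_insert[OF D(1)] Int_iff by blast
      have "v - d \<in> W" using v cd(1) D(2) W(1) subspace_diff by blast
      moreover have "c *\<^sub>R f \<in> F" using f F(1) subspace_scale by blast
      ultimately have "c *\<^sub>R f = 0" using W_F[of "c *\<^sub>R f"] cd(2) by simp
      then have "v = d" using cd(2) by (simp only: add_0_right)
      then show "v \<in> D" using cd(1) by (simp only:)
    qed
  qed
  have ne: "act m \<noteq> W"
  proof
    assume "act m = W"
    then have "act (l1 ** m) = x1" unfolding act_mul by simp
    then show False using distinct l1m by simp
  qed
  show ?thesis unfolding prod dims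
  proof
    assume "\<exists>q\<in>Q. (*v) q ` act m = span (insert f D)"
    then obtain q where q: "q \<in> LC" "act q = W" "(*v) q ` act m = span (insert f D)" unfolding stab_def by blast
    have inj: "inj ((*v) q)" by (rule mat_unit_inj[OF L_unit[OF q(1)]])
    have "(*v) q ` (W \<inter> act m) = D" unfolding image_Int[OF inj] q(2,3) by (rule meet)
    moreover have "inj_on ((*v) q) (span (W \<inter> act m))" using inj inj_on_subset by blast
    ultimately show "dim (W \<inter> act m) + 1 = k" using dim_image_eq[OF matrix_vector_mul_linear[of q]] D(3) by metis
  next
    assume d: "dim (W \<inter> act m) + 1 = k"
    obtain h where h: "similitude h" "h ` W = W" "h ` span (insert f D) = act m"
      by (rule transitive_on_pairs[OF point_act[OF mL] ne d D f pt])
    define g where "g = matrix h"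
    have gL: "g \<in> LC" and gh: "(*v) g = h" unfolding g_def by (rule matrix_similitude[OF h(1)])+
    have restore: "(*v) (mat.ainv g) ` (h ` A) = A" for A
      unfolding gh[symmetric] image_image using L_unit[OF gL] by simp
    have "act (mat.ainv g) = W" using restore[of W] unfolding h(2) .
    then have "mat.ainv g \<in> Q" using ainv_L[OF gL] by (simp add: stab_def)
    moreover have "(*v) (mat.ainv g) ` act m = span (insert f D)" using restore[of "span (insert f D)"] unfolding h(3) .
    ultimately show "\<exists>q\<in>Q. (*v) q ` act m = span (insert f D)" by blast
  qed
qed

end

section \<open>The two series\<close>

lemma span_insert_axis:
  fixes J :: "'n::finite set"
  shows "span (insert (axis j 1) (coord J)) = coord (insert j J)"
proof -
  have "span (insert (axis j 1) (coord J)) = span (insert (axis j 1) ((\<lambda>i. axis i (1::real)) ` J))"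
    unfolding span_axis[symmetric] by (simp only: span_insert span_span)
  also have "\<dots> = coord (insert j J)" using span_axis[of "insert j J"] by simp
  finally show ?thesis .
qed

lemma coord_mono: "I \<subseteq> J \<Longrightarrow> coord I \<subseteq> coord J"
  by (auto simp: coord_def)

lemma bilinear_symp: "bilinear symp"
  unfolding bilinear_def
  by (intro conjI allI linearI)
    (simp_all add: symp_def algebra_simps sum.distrib sum_subtractf sum_distrib_left)

lemma symp_axis:
  fixes x :: "real^('c::finite + 'c)"
  shows "symp x (axis (Inr i) 1) = x $ Inl i" "symp x (axis (Inl i) 1) = - x $ Inr i"
proof -
  have a: "axis (Inl i) 1 $ Inl k = (if k = i then 1 else (0::real))"
    "axis (Inr i) 1 $ Inr k = (if k = i then 1 else (0::real))"
    "axis (Inl i) 1 $ Inr k = (0::real)" "axis (Inr i) 1 $ Inl k = (0::real)" for i k :: 'c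
    by (auto simp: axis_def)
  show "symp x (axis (Inr i) 1) = x $ Inl i" "symp x (axis (Inl i) 1) = - x $ Inr i"
    by (simp_all add: symp_def a if_distrib[of "\<lambda>z. _ * z"] sum_negf cong: if_cong)
qed

text \<open>A linear map that preserves \<open>symp\<close> up to a nonzero factor has trivial
  kernel by nondegeneracy, so the carrier of \<open>CSp\<close> consists exactly of the
  similitudes.\<close>

lemma CSp_geometry:
  "matrix_geometry (symp :: real^('c::finite + 'c) \<Rightarrow> _) CARD('c) (coord (range Inl)) (coord (range Inr))
    (restr (range Inl)) CSp"
proof -
  have compl: "- range Inl = (range Inr :: ('c + 'c) set)"
    by (auto simp: image_iff) (metis sum.exhaust)
  have card: "card (range (Inl :: 'c \<Rightarrow> 'c + 'c)) = CARD('c)" by (simp add: card_image)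
  have nd: "x = 0" if "\<forall>y. symp x y = 0" for x :: "real^('c + 'c)"
  proof -
    have "x $ s = 0" for s
      using that symp_axis[of x] by (cases s) (metis, metis neg_equal_0_iff_equal)
    then show ?thesis by (simp add: vec_eq_iff)
  qed
  have "isotropic_geometry (symp :: real^('c + 'c) \<Rightarrow> _) (card (range (Inl :: 'c \<Rightarrow> 'c + 'c)))
    (coord (range Inl)) (coord (- range Inl)) (restr (range Inl))"
  proof (rule coordinate_geometry)
    show "symp x x = 0" for x :: "real^('c + 'c)" by (simp add: symp_def mult.commute)
    show "(\<forall>x y :: real^('c + 'c). symp x y = 0) \<or>
      (\<forall>x :: real^('c + 'c). (\<forall>y. symp x y = 0) \<longrightarrow> x = 0) \<and> CARD('c + 'c) = 2 * card (range (Inl :: 'c \<Rightarrow> 'c + 'c))"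
      using nd by (simp add: card card_UNIV_sum)
    show "symp u v = 0" if "u \<in> coord (range Inl)" "v \<in> coord (range Inl)" for u v :: "real^('c + 'c)"
    proof -
      have "u $ Inr i = 0" "v $ Inr i = 0" for i using that by (auto simp: coord_def)
      then show ?thesis by (simp add: symp_def)
    qed
    show "symp u v = 0" if "u \<in> coord (- range Inl)" "v \<in> coord (- range Inl)" for u v :: "real^('c + 'c)"
    proof -
      have "u $ Inl i = 0" "v $ Inl i = 0" for i using that by (auto simp: coord_def)
      then show ?thesis by (simp add: symp_def)
    qed
  qed (auto simp: bilinear_symp)
  then interpret isotropic_geometry "symp :: real^('c + 'c) \<Rightarrow> _" "CARD('c)" "coord (range Inl)" "coord (range Inr)" "restr (range Inl)"
    unfolding card compl .
  have "(\<exists>c. c \<noteq> 0 \<and> (\<forall>x y. symp (A *v x) (A *v y) = c * symp x y)) \<longleftrightarrow> similitude ((*v) A)" for A :: "real^('c + 'c)^('c + 'c)"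
  proof
    assume "\<exists>c. c \<noteq> 0 \<and> (\<forall>x y. symp (A *v x) (A *v y) = c * symp x y)"
    then obtain c where c: "c \<noteq> 0" "\<And>x y. symp (A *v x) (A *v y) = c * symp x y" by blast
    have "x = 0" if "A *v x = 0" for x
    proof (rule nd, rule allI)
      fix y
      have "c * symp x y = 0" using c(2)[of x y] that bilinear_lzero[OF bilin] by simp
      then show "symp x y = 0" using c(1) by simp
    qed
    then have "inj ((*v) A)" using linear_injective_0[OF matrix_vector_mul_linear[of A]] by blast
    then show "similitude ((*v) A)" using c unfolding similitude_def by auto
  qed (auto simp: similitude_def)
  then show ?thesis
    by (intro matrix_geometry.intro matrix_geometry_axioms.intro isotropic_geometry_axioms) (simp add: CSp_def)
qed

lemma series_A:
  fixes I :: "'n::finite set"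
  assumes I: "i \<in> I" "j \<notin> I" "card I + 1 < CARD('n)"
    and l: "l1 \<in> carrier GL" "l2 \<in> carrier GL" "l1 <#\<^bsub>GL\<^esub> stab GL (coord I) \<noteq> l2 <#\<^bsub>GL\<^esub> stab GL (coord I)"
  shows "nonhomogeneous_symmetric_restriction GL (stab GL (coord I)) l1 l2 \<longleftrightarrow>
    (\<exists>q\<in>stab GL (coord I). (*v) (q \<otimes>\<^bsub>GL\<^esub> inv\<^bsub>GL\<^esub> l1 \<otimes>\<^bsub>GL\<^esub> l2) ` coord I = coord (insert j (I - {i})))"
proof -
  have geo: "matrix_geometry (\<lambda>_ _. 0) (card I) (coord I) (coord (- I)) (restr I) GL"
    by (rule GL_geometry) (use I in auto)
  interpret avoiding_geometry "\<lambda>_ _. 0" "card I" "coord I" "coord (- I)" "restr I" GL l1 l2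
    by (intro avoiding_geometry.intro avoiding_geometry_axioms.intro geo l I(3))
  have c: "card (I - {i}) + 1 = card I" using I(1) by (simp add: card_gt_0_iff card_Diff_singleton) (metis Suc_pred card_gt_0_iff empty_iff finite)
  have ij: "j \<notin> I - {i}" using I(2) by blast
  have sub: "coord (I - {i}) \<subseteq> coord I" by (rule coord_mono) blast
  have D: "dim (coord (I - {i})) + 1 = card I" using c by (simp add: dim_coord)
  have f: "axis j 1 \<in> coord (- I)" "axis j 1 \<noteq> (0 :: real^'n)"
    using I(2) by (auto simp: coord_def axis_def vec_eq_iff)
  have "point (coord (insert j (I - {i})))"
    unfolding point_def iso_def using c ij by (simp add: subspace_coord dim_coord)
  then show ?thesis
    unfolding nonhomogeneous_symmetric_iff span_insert_axis[symmetric]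
    by (rule standard_pair[symmetric, OF subspace_coord sub D f])
qed

lemma series_C:
  fixes i :: "'c::finite"
  assumes c2: "1 < CARD('c)"
    and l: "l1 \<in> carrier CSp" "l2 \<in> carrier CSp"
      "l1 <#\<^bsub>CSp\<^esub> stab CSp (coord (range Inl)) \<noteq> l2 <#\<^bsub>CSp\<^esub> stab CSp (coord (range (Inl :: 'c \<Rightarrow> 'c + 'c)))"
  shows "nonhomogeneous_symmetric_restriction CSp (stab CSp (coord (range Inl))) l1 l2 \<longleftrightarrow>
    (\<exists>q\<in>stab CSp (coord (range Inl)). (*v) (q \<otimes>\<^bsub>CSp\<^esub> inv\<^bsub>CSp\<^esub> l1 \<otimes>\<^bsub>CSp\<^esub> l2) ` coord (range Inl)
      = coord (insert (Inr i) (Inl ` (- {i}))))"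
proof -
  interpret avoiding_geometry symp "CARD('c)" "coord (range Inl)" "coord (range Inr)" "restr (range Inl)" CSp l1 l2
    by (intro avoiding_geometry.intro avoiding_geometry_axioms.intro CSp_geometry l) (use c2 in \<open>simp add: card_UNIV_sum\<close>)
  have c: "card (Inl ` (- {i}) :: ('c + 'c) set) + 1 = CARD('c)"
    using c2 by (simp add: card_image Compl_eq_Diff_UNIV card_Diff_subset)
  have sub: "coord (Inl ` (- {i})) \<subseteq> (coord (range Inl) :: (real^('c + 'c)) set)" by (rule coord_mono) auto
  have f: "axis (Inr i) 1 \<in> (coord (range Inr) :: (real^('c + 'c)) set)" "axis (Inr i) 1 \<noteq> (0 :: real^('c + 'c))"
    by (auto simp: coord_def axis_def vec_eq_iff)
  have "point (span (insert (axis (Inr i) 1) (coord (Inl ` (- {i})))))"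
  proof (rule point_insert)
    show "iso (coord (Inl ` (- {i})))" using sub W(3) unfolding iso_def by blast
    show "axis (Inr i) 1 \<notin> coord (Inl ` (- {i}))" using W_F[OF subsetD[OF sub] f(1)] f(2) by blast
    \<comment> \<open>Pairing with this vector reads off the coordinate \<open>Inl i\<close>, which
      vanishes since \<open>i\<close> is left out.\<close>
    show "symp d (axis (Inr i) 1) = 0" if "d \<in> coord (Inl ` (- {i}))" for d
      using that by (auto simp: symp_axis coord_def)
  qed (use c in \<open>auto simp: subspace_coord dim_coord\<close>)
  moreover have "dim (coord (Inl ` (- {i}) :: ('c + 'c) set)) + 1 = CARD('c)" using c by (simp add: dim_coord)
  ultimately show ?thesis
    unfolding nonhomogeneous_symmetric_iff span_insert_axis[symmetric]
    by (intro standard_pair[symmetric] subspace_coord sub f)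
qed

theorem theorem1:
  fixes \<nu> :: "nat \<Rightarrow> 'a::finite" and \<mu> :: "nat \<Rightarrow> 'c::finite"
  shows
    "(\<forall>n l (e :: nat \<Rightarrow> real^'a) W (L :: (real^'a^'a) monoid) Q l1 l2.
        l > 3 \<longrightarrow> n \<ge> 2 * l - 1 \<longrightarrow> bij_betw \<nu> {4..n} UNIV \<longrightarrow>
        e = (\<lambda>i. axis (\<nu> i) 1) \<longrightarrow>
        W = span (e ` {4..l}) \<longrightarrow> L = GL \<longrightarrow> Q = stab L W \<longrightarrow>
        l1 \<in> carrier L \<longrightarrow> l2 \<in> carrier L \<longrightarrow> l1 <#\<^bsub>L\<^esub> Q \<noteq> l2 <#\<^bsub>L\<^esub> Q \<longrightarrow>
        (nonhomogeneous_symmetric_restriction L Q l1 l2 \<longleftrightarrow>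
         (\<exists>q\<in>Q. (*v) (q \<otimes>\<^bsub>L\<^esub> inv\<^bsub>L\<^esub> l1 \<otimes>\<^bsub>L\<^esub> l2) ` W
                  = span (e ` {4..l - 1} \<union> {e (l + 1)}))))
     \<and>
     (\<forall>n (e :: nat \<Rightarrow> real^('c + 'c)) f W (L :: (real^('c + 'c)^('c + 'c)) monoid) Q l1 l2.
        n > 4 \<longrightarrow> bij_betw \<mu> {4..n} UNIV \<longrightarrow>
        e = (\<lambda>i. axis (Inl (\<mu> i)) 1) \<longrightarrow> f = (\<lambda>i. axis (Inr (\<mu> i)) 1) \<longrightarrow>
        W = span (e ` {4..n}) \<longrightarrow> L = CSp \<longrightarrow> Q = stab L W \<longrightarrow>
        l1 \<in> carrier L \<longrightarrow> l2 \<in> carrier L \<longrightarrow> l1 <#\<^bsub>L\<^esub> Q \<noteq> l2 <#\<^bsub>L\<^esub> Q \<longrightarrow>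
        (nonhomogeneous_symmetric_restriction L Q l1 l2 \<longleftrightarrow>
         (\<exists>q\<in>Q. (*v) (q \<otimes>\<^bsub>L\<^esub> inv\<^bsub>L\<^esub> l1 \<otimes>\<^bsub>L\<^esub> l2) ` W
                  = span (e ` {4..n - 1} \<union> {f n}))))"
proof (intro conjI allI impI)
  fix n l :: nat and e :: "nat \<Rightarrow> real^'a" and W L Q l1 l2
  assume l: "l > 3" and n: "n \<ge> 2 * l - 1" and \<nu>: "bij_betw \<nu> {4..n} (UNIV :: 'a set)"
    and e: "e = (\<lambda>i. axis (\<nu> i) 1)" and W: "W = span (e ` {4..l})" and L: "L = GL" and Q: "Q = stab L W"
    and l12: "l1 \<in> carrier L" "l2 \<in> carrier L" "l1 <#\<^bsub>L\<^esub> Q \<noteq> l2 <#\<^bsub>L\<^esub> Q"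
  have inj: "inj_on \<nu> {4..n}" using \<nu> by (simp add: bij_betw_def)
  have eI: "span (e ` J) = coord (\<nu> ` J)" for J
    using span_axis[of "\<nu> ` J"] by (simp add: e image_image)
  define I where "I = \<nu> ` {4..l}"
  have WI: "W = coord I" by (simp add: W eI I_def)
  have ln: "{4..l} \<subseteq> {4..n}" "l + 1 \<in> {4..n}" "l \<in> {4..n}" using l n by auto
  \<comment> \<open>The numbering of the basis starts at 4, which shifts every dimension by
    3.\<close>
  have card: "card I = l - 3" unfolding I_def
    using card_image[OF inj_on_subset[OF inj ln(1)]] by simp
  have cardn: "CARD('a) = n - 3" using bij_betw_same_card[OF \<nu>] by simp
  have i: "\<nu> l \<in> I" using l by (simp add: I_def)
  have j: "\<nu> (l + 1) \<notin> I"
    using inj_on_image_mem_iff[OF inj ln(2,1)] by (simp add: I_def)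
  have "I - {\<nu> l} = \<nu> ` ({4..l} - {l})"
  proof -
    have "{4..l} - {l} \<subseteq> {4..n}" "{l} \<subseteq> {4..n}" using ln(1,3) by blast+
    from inj_on_image_set_diff[OF inj this] show ?thesis by (simp add: I_def)
  qed
  also have "{4..l} - {l} = {4..l - 1}" using l by auto
  finally have I': "I - {\<nu> l} = \<nu> ` {4..l - 1}" .
  have W': "span (e ` {4..l - 1} \<union> {e (l + 1)}) = coord (insert (\<nu> (l + 1)) (I - {\<nu> l}))"
    using eI[of "insert (l + 1) {4..l - 1}"] by (simp add: I')
  \<comment> \<open>Here n - 3 is at least 2l - 4, which exceeds l - 2 because l > 3.\<close>
  have "card I + 1 < CARD('a)" using card cardn l n by simp
  from series_A[OF i j this, of l1 l2] l12
  show "nonhomogeneous_symmetric_restriction L Q l1 l2 \<longleftrightarrow>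
    (\<exists>q\<in>Q. (*v) (q \<otimes>\<^bsub>L\<^esub> inv\<^bsub>L\<^esub> l1 \<otimes>\<^bsub>L\<^esub> l2) ` W = span (e ` {4..l - 1} \<union> {e (l + 1)}))"
    unfolding Q L WI W' by blast
next
  fix n :: nat and e f :: "nat \<Rightarrow> real^('c + 'c)" and W L Q l1 l2
  assume n: "n > 4" and \<mu>: "bij_betw \<mu> {4..n} (UNIV :: 'c set)"
    and e: "e = (\<lambda>i. axis (Inl (\<mu> i)) 1)" and f: "f = (\<lambda>i. axis (Inr (\<mu> i)) 1)"
    and W: "W = span (e ` {4..n})" and L: "L = CSp" and Q: "Q = stab L W"
    and l12: "l1 \<in> carrier L" "l2 \<in> carrier L" "l1 <#\<^bsub>L\<^esub> Q \<noteq> l2 <#\<^bsub>L\<^esub> Q"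
  have inj: "inj_on \<mu> {4..n}" and im: "\<mu> ` {4..n} = UNIV" using \<mu> by (auto simp: bij_betw_def)
  have WI: "W = coord (range Inl)"
  proof -
    have "e ` {4..n} = (\<lambda>i. axis i 1) ` Inl ` \<mu> ` {4..n}" by (simp add: e image_image)
    then show ?thesis unfolding W im by (simp only: span_axis)
  qed
  have "\<mu> ` {4..n - 1} = \<mu> ` ({4..n} - {n})" using n by (intro arg_cong[where f = "image \<mu>"]) auto
  also have "\<dots> = - {\<mu> n}"
  proof -
    have "{4..n} - {n} \<subseteq> {4..n}" "{n} \<subseteq> {4..n}" using n by auto
    from inj_on_image_set_diff[OF inj this] show ?thesis by (simp add: im Compl_eq_Diff_UNIV)
  qed
  finally have D: "\<mu> ` {4..n - 1} = - {\<mu> n}" .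
  have "span (e ` {4..n - 1} \<union> {f n}) = span ((\<lambda>i. axis i 1) ` insert (Inr (\<mu> n)) (Inl ` \<mu> ` {4..n - 1}))"
    by (simp add: e f image_image)
  then have W': "span (e ` {4..n - 1} \<union> {f n}) = coord (insert (Inr (\<mu> n)) (Inl ` (- {\<mu> n})))"
    unfolding span_axis D .
  have "CARD('c) = n - 3" using bij_betw_same_card[OF \<mu>] by simp
  \<comment> \<open>With k = n - 3 at least 2, k + 1 is smaller than the ambient dimension 2k, as
    \<open>large\<close> requires.\<close>
  then have "1 < CARD('c)" using n by simp
  from series_C[OF this, of l1 l2 "\<mu> n"] l12
  show "nonhomogeneous_symmetric_restriction L Q l1 l2 \<longleftrightarrow>
    (\<exists>q\<in>Q. (*v) (q \<otimes>\<^bsub>L\<^esub> inv\<^bsub>L\<^esub> l1 \<otimes>\<^bsub>L\<^esub> l2) ` W = span (e ` {4..n - 1} \<union> {f n}))"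
    unfolding Q L WI W' by blast
qed

end
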